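(* The symmetric functions $Lie_n$ and $Lie_n^{(2)}$ satisfy the following identities. (1) For all $n\ge 1$: $\displaystyle\sum_{\lambda\vdash n}H_\lambda[Lie]=p_1^n$ and $\displaystyle\sum_{\lambda\vdash n}E_\lambda[Lie^{(2)}]=p_1^n$. (2) $\displaystyle H\Big[\sum_{n\geq 1} (-1)^{n-1}\omega(Lie_n)\Big]=1+p_1$ and $\displaystyle E\Big[\sum_{n\geq 1} (-1)^{n-1}\omega(Lie^{(2)}_n)\Big]=1+p_1$. (3) For all $n\geq 2$: $\displaystyle\sum_{\lambda\vdash n}(-1)^{n-\ell(\lambda)}E_\lambda[Lie]=0$ and $\displaystyle\sum_{\lambda\vdash n}(-1)^{n-\ell(\lambda)}H_\lambda[Lie^{(2)}]=0$. (4) For all $n\geq 2$: $\displaystyle\sum_{\lambda\vdash n}E_\lambda[Lie]=2e_2\, p_1^{n-2}$ and $\displaystyle\sum_{\lambda\vdash n}H_\lambda[Lie^{(2)}]=\sum_{\lambda} p_\lambda$, where the last sum is over all partitions $\lambda$ of $n$ all of whose parts are powers of $2$ (including $1=2^0$). Moreover, the four identities for $Lie$ are equivalent to one another, and the four identities for $Lie^{(2)}$ are equivalent to one another.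
   Context: Work in the ring of symmetric functions (completed to allow formal infinite sums of homogeneous terms); $h_n,e_n,p_n$ are the complete homogeneous, elementary and power-sum symmetric functions, $p_\lambda=\prod_i p_{\lambda_i}$, $\omega$ is the involution with $\omega(h_n)=e_n$ (applied termwise), $\mathrm{ch}$ is the Frobenius characteristic, and $f[g]$ denotes plethysm. $H=\sum_{r\ge 0}h_r$, $E=\sum_{r\ge0}e_r$. $\ell(\lambda)$ is the number of parts of $\lambda$. Let $C_n\subset S_n$ be the cyclic group generated by an $n$-cycle. $Lie_n=\mathrm{ch}\big(\chi\uparrow_{C_n}^{S_n}\big)$, where $\chi$ is the linear character of $C_n$ sending the generator to $\exp(2\pi i/n)$; equivalently $Lie_n=\frac1n\sum_{d|n}\mu(d)p_d^{n/d}$. Let $2^{k_n}$ be the largest power of $2$ dividing $n$. $Lie_n^{(2)}=\mathrm{ch}\big(\chi'\uparrow_{C_n}^{S_n}\big)$, where $\chi'$ sends the generator to $\exp(\frac{2\pi i}{n}\cdot 2^{k_n})$. Put $Lie=\sum_{n\ge1}Lie_n$, $Lie^{(2)}=\sum_{n\ge1}Lie^{(2)}_n$. For a series $Q=\sum_{i\ge1}q_i$ with $q_i$ homogeneous of degree $i$, and a partition $\lambda$ with $m_i$ parts equal to $i$, put $H_\lambda[Q]=\prod_{i:m_i\ge1}h_{m_i}[q_i]$ and $E_\lambda[Q]=\prod_{i:m_i\ge1}e_{m_i}[q_i]$. *)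

theory Defs
  imports
    Complex_Main
    "HOL-Library.Multiset"
    "HOL-Combinatorics.Orbits"
    "HOL-Computational_Algebra.Primes"
    "HOL-Algebra.Sym_Groups"
begin

section \<open>The completed ring of symmetric functions\<close>

text \<open>
  A monomial in the variables \<open>x\<^sub>0, x\<^sub>1, x\<^sub>2, \<dots>\<close> is the multiset of the indices of its
  variables, so multiplication of monomials is the sum of multisets and the degree is the size.
  The symmetric formal power series with complex coefficients are exactly the formal infinite
  sums of homogeneous symmetric functions.
\<close>

typedef symfun =
  "{f :: nat multiset \<Rightarrow> complex. \<forall>s M. bij s \<longrightarrow> f (image_mset s M) = f M}"
  morphisms mcoeff Abs_symfun
  by (rule exI[of _ "\<lambda>_. 0"]) simp

setup_lifting type_definition_symfun

lemma finite_mset_splits: "finite {(A, B). A + B = (M :: 'a multiset)}"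
proof -
  have "finite {N. N \<subseteq># M}"
  proof (rule finite_subset)
    show "{N. N \<subseteq># M} \<subseteq> (\<Union>k\<le>size M. {N. set_mset N \<subseteq> set_mset M \<and> size N = k})"
      by (auto dest: mset_subset_eqD size_mset_mono)
    show "finite (\<Union>k\<le>size M. {N. set_mset N \<subseteq> set_mset M \<and> size N = k})"
      using finite_multisets_of_size[of "set_mset M"] by (simp add: multisets_of_size_def)
  qed
  moreover have "{(A, B). A + B = M} \<subseteq> {N. N \<subseteq># M} \<times> {N. N \<subseteq># M}"
    by auto
  ultimately show ?thesis
    by (meson finite_SigmaI finite_subset)
qed

lemma image_mset_inv_bij:
  assumes "bij s"
  shows "image_mset s (image_mset (inv' s) M) = M" "image_mset (inv' s) (image_mset s M) = M"
  using assms by (simp_all add: multiset.map_comp bij_is_surj bij_is_inj surj_iff[THEN iffD1]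
      inj_iff[THEN iffD1])

instantiation symfun :: comm_ring_1
begin

lift_definition zero_symfun :: symfun is "\<lambda>_. 0" by simp

lift_definition one_symfun :: symfun is "\<lambda>M. if M = {#} then 1 else 0" by simp

lift_definition plus_symfun :: "symfun \<Rightarrow> symfun \<Rightarrow> symfun" is "\<lambda>f g M. f M + g M" by simp

lift_definition minus_symfun :: "symfun \<Rightarrow> symfun \<Rightarrow> symfun" is "\<lambda>f g M. f M - g M" by simp

lift_definition uminus_symfun :: "symfun \<Rightarrow> symfun" is "\<lambda>f M. - f M" by simp

lift_definition times_symfun :: "symfun \<Rightarrow> symfun \<Rightarrow> symfun" is
  "\<lambda>f g M. \<Sum>(A, B) \<in> {(A, B). A + B = M}. f A * g B"
proof -
  fix f g :: "nat multiset \<Rightarrow> complex" and s :: "nat \<Rightarrow> nat" and M :: "nat multiset"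
  assume f: "\<And>s M. bij s \<Longrightarrow> f (image_mset s M) = f M"
    and g: "\<And>s M. bij s \<Longrightarrow> g (image_mset s M) = g M" and s: "bij s"
  show "(\<Sum>(A, B) \<in> {(A, B). A + B = image_mset s M}. f A * g B) =
        (\<Sum>(A, B) \<in> {(A, B). A + B = M}. f A * g B)"
    by (rule sum.reindex_bij_witness
          [of _ "map_prod (image_mset s) (image_mset s)"
                "map_prod (image_mset (inv' s)) (image_mset (inv' s))"])
       (auto simp: image_mset_inv_bij[OF s] f s g bij_imp_bij_inv simp flip: image_mset_union)
qed

instance
proof
  fix a b c :: symfun
  show "a * b * c = a * (b * c)"
  proof transfer
    fix f g h :: "nat multiset \<Rightarrow> complex"
    let ?S = "\<lambda>M. {(A, B). A + B = (M :: nat multiset)}"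
    have "(\<Sum>(A, B) \<in> ?S M. (\<Sum>(C, D) \<in> ?S A. f C * g D) * h B) =
          (\<Sum>(A, B) \<in> ?S M. f A * (\<Sum>(C, D) \<in> ?S B. g C * h D))" for M
    proof -
      have "(\<Sum>(A, B) \<in> ?S M. (\<Sum>(C, D) \<in> ?S A. f C * g D) * h B) =
            (\<Sum>p \<in> ?S M. \<Sum>q \<in> ?S (fst p). f (fst q) * g (snd q) * h (snd p))"
        by (simp add: sum_distrib_right case_prod_beta)
      also have "\<dots> = (\<Sum>(p, q) \<in> Sigma (?S M) (\<lambda>p. ?S (fst p)).
                        f (fst q) * g (snd q) * h (snd p))"
        by (rule sum.Sigma) (auto simp: finite_mset_splits)
      also have "\<dots> = (\<Sum>(p, q) \<in> Sigma (?S M) (\<lambda>p. ?S (snd p)).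
                        f (fst p) * (g (fst q) * h (snd q)))"
        by (rule sum.reindex_bij_witness
              [of _ "\<lambda>((A, B), (C, D)). ((A + C, D), (A, C))"
                    "\<lambda>((A, B), (C, D)). ((C, D + B), (D, B))"])
           (auto simp: ac_simps)
      also have "\<dots> = (\<Sum>p \<in> ?S M. \<Sum>q \<in> ?S (snd p). f (fst p) * (g (fst q) * h (snd q)))"
        by (rule sum.Sigma[symmetric]) (auto simp: finite_mset_splits)
      also have "\<dots> = (\<Sum>(A, B) \<in> ?S M. f A * (\<Sum>(C, D) \<in> ?S B. g C * h D))"
        by (simp add: sum_distrib_left case_prod_beta)
      finally show ?thesis .
    qed
    then show "(\<lambda>M. \<Sum>(A, B) \<in> ?S M. (\<Sum>(C, D) \<in> ?S A. f C * g D) * h B) =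
          (\<lambda>M. \<Sum>(A, B) \<in> ?S M. f A * (\<Sum>(C, D) \<in> ?S B. g C * h D))"
      by blast
  qed
  show "a * b = b * a"
    by transfer
      (auto intro!: ext sum.reindex_bij_witness[of _ "\<lambda>(A, B). (B, A)" "\<lambda>(A, B). (B, A)"]
            simp: ac_simps)
  show "1 * a = a"
  proof transfer
    fix f :: "nat multiset \<Rightarrow> complex"
    have "(\<Sum>(A, B) \<in> {(A, B). A + B = M}. (if A = {#} then 1 else 0) * f B) =
          (\<Sum>(A, B) \<in> {({#} :: nat multiset, M)}. (if A = {#} then 1 else 0) * f B)" for M
      by (rule sum.mono_neutral_right) (auto simp: finite_mset_splits split: if_splits)
    then show "(\<lambda>M. \<Sum>(A, B) \<in> {(A, B). A + B = M}. (if A = {#} then 1 else 0) * f B) = f"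
      by simp
  qed
  show "(a + b) * c = a * c + b * c"
    by transfer (simp add: case_prod_beta distrib_right sum.distrib)
  show "0 \<noteq> (1 :: symfun)"
    by transfer (auto dest: fun_cong[of _ _ "{#}"])
qed (transfer; simp add: fun_eq_iff add.assoc add.commute)+

end

lift_definition scale :: "complex \<Rightarrow> symfun \<Rightarrow> symfun" is "\<lambda>c f M. c * f M" by simp

text \<open>
  The formal sum of a locally finite family, that is, one in which every monomial has nonzero
  coefficient in only finitely many members. (Coefficients at monomials violating this are
  junk, namely 0.)
\<close>

lift_definition formal_sum :: "('a \<Rightarrow> symfun) \<Rightarrow> 'a set \<Rightarrow> symfun" is
  "\<lambda>f I M. \<Sum>i \<in> {i \<in> I. f i M \<noteq> 0}. f i M" by simp

lift_definition hom_component :: "nat \<Rightarrow> symfun \<Rightarrow> symfun" is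
  "\<lambda>n f M. if size M = n then f M else 0" by simp

definition homogeneous :: "nat \<Rightarrow> symfun \<Rightarrow> bool" where
  "homogeneous n f \<longleftrightarrow> (\<forall>M. mcoeff f M \<noteq> 0 \<longrightarrow> size M = n)"


section \<open>Classical families, the involution and plethysm\<close>

lift_definition sym_h :: "nat \<Rightarrow> symfun" is "\<lambda>n M. if size M = n then 1 else 0" by simp

lift_definition sym_e :: "nat \<Rightarrow> symfun" is
  "\<lambda>n M. if size M = n \<and> (\<forall>i. count M i \<le> 1) then 1 else 0"
proof -
  fix n and s :: "nat \<Rightarrow> nat" and M :: "nat multiset"
  assume s: "bij s"
  have *: "\<forall>i. count (image_mset t N) i \<le> 1"
    if "bij t" "\<forall>i. count N i \<le> 1" for t :: "nat \<Rightarrow> nat" and N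
  proof
    fix i
    have "count (image_mset t N) (t (inv' t i)) = count N (inv' t i)"
      using that(1) by (induction N) (auto simp: bij_is_inj inj_eq)
    then show "count (image_mset t N) i \<le> 1"
      using that by (metis surj_f_inv_f bij_is_surj)
  qed
  have "(\<forall>i. count (image_mset s M) i \<le> 1) \<longleftrightarrow> (\<forall>i. count M i \<le> 1)"
    using *[OF s, of M] *[OF bij_imp_bij_inv[OF s], of "image_mset s M"]
    by (metis image_mset_inv_bij(2)[OF s])
  then show "(if size (image_mset s M) = n \<and> (\<forall>i. count (image_mset s M) i \<le> 1) then 1 else 0) =
             (if size M = n \<and> (\<forall>i. count M i \<le> 1) then 1 else (0 :: complex))"
    by simp
qed

text \<open>Only the power sums of positive index are meaningful (and used) below.\<close>

lift_definition sym_p :: "nat \<Rightarrow> symfun" is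
  "\<lambda>n M. if \<exists>i. M = replicate_mset n i then 1 else 0"
proof -
  fix n and s :: "nat \<Rightarrow> nat" and M :: "nat multiset"
  assume s: "bij s"
  have "(\<exists>i. image_mset s M = replicate_mset n i) \<longleftrightarrow> (\<exists>i. M = replicate_mset n i)"
    by (metis image_mset_inv_bij(2)[OF s] image_replicate_mset)
  then show "(if \<exists>i. image_mset s M = replicate_mset n i then 1 else 0) =
             (if \<exists>i. M = replicate_mset n i then 1 else (0 :: complex))"
    by simp
qed

definition all_partitions :: "nat multiset set" where
  "all_partitions = {lam. 0 \<notin># lam}"

definition partitions_of :: "nat \<Rightarrow> nat multiset set" where
  "partitions_of n = {lam \<in> all_partitions. \<Sum>\<^sub># lam = n}"

definition sym_p_part :: "nat multiset \<Rightarrow> symfun" where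
  "sym_p_part lam = (\<Prod>i\<in>#lam. sym_p i)"

definition H_series :: symfun where
  "H_series = formal_sum sym_h UNIV"

definition E_series :: symfun where
  "E_series = formal_sum sym_e UNIV"

text \<open>
  The involution is determined by its values on the complete homogeneous functions, since these
  generate the algebra; the last clause says that it is applied termwise in the completion.
\<close>

definition omega :: "symfun \<Rightarrow> symfun" where
  "omega = (THE w.
     w 1 = 1 \<and>
     (\<forall>f g. w (f + g) = w f + w g) \<and>
     (\<forall>f g. w (f * g) = w f * w g) \<and>
     (\<forall>c f. w (scale c f) = scale c (w f)) \<and>
     (\<forall>n. w (sym_h n) = sym_e n) \<and>
     (\<forall>n f. w (hom_component n f) = hom_component n (w f)))"

text \<open>The coefficients of the expansion in the basis of the power sum products.\<close>

definition p_coeffs :: "symfun \<Rightarrow> nat multiset \<Rightarrow> complex" where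
  "p_coeffs f = (THE c.
     (\<forall>lam. lam \<notin> all_partitions \<longrightarrow> c lam = 0) \<and>
     f = formal_sum (\<lambda>lam. scale (c lam) (sym_p_part lam)) all_partitions)"

lemma image_mset_repeat_mset: "image_mset s (repeat_mset k M) = repeat_mset k (image_mset s M)"
  by (induction k) auto

text \<open>
  Plethysm by a power sum, i.e. the substitution of \<open>x\<^sub>i\<^sup>k\<close> for \<open>x\<^sub>i\<close> (for \<open>k \<ge> 1\<close>);
  scalars are fixed.
\<close>

lift_definition p_plethysm :: "nat \<Rightarrow> symfun \<Rightarrow> symfun" is
  "\<lambda>k f M. if \<exists>N. M = repeat_mset k N then f (THE N. M = repeat_mset k N) else 0"
proof -
  fix k and f :: "nat multiset \<Rightarrow> complex" and s :: "nat \<Rightarrow> nat" and M :: "nat multiset"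
  assume f: "\<And>s M. bij s \<Longrightarrow> f (image_mset s M) = f M" and s: "bij s"
  note inv = image_mset_inv_bij[OF s]
  have ex: "(\<exists>N. image_mset s M = repeat_mset k N) \<longleftrightarrow> (\<exists>N. M = repeat_mset k N)"
    by (metis image_mset_repeat_mset inv(2))
  have the: "f (THE N. image_mset s M = repeat_mset k N) = f (THE N. M = repeat_mset k N)"
    if "\<exists>N. M = repeat_mset k N"
  proof (cases "k = 0")
    case True
    with that show ?thesis by simp
  next
    case False
    have inj: "N = N'" if "repeat_mset k N = repeat_mset k N'" for N N' :: "nat multiset"
      using that False by (simp add: repeat_mset_cancel1)
    from \<open>\<exists>N. M = repeat_mset k N\<close> obtain N where N: "M = repeat_mset k N" ..
    have "(THE N. M = repeat_mset k N) = N"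
      using N inj by blast
    moreover have "(THE N'. image_mset s M = repeat_mset k N') = image_mset s N"
      using N inj by (intro the_equality) (auto simp: image_mset_repeat_mset)
    ultimately show ?thesis
      using f s by simp
  qed
  show "(if \<exists>N. image_mset s M = repeat_mset k N
         then f (THE N. image_mset s M = repeat_mset k N) else 0) =
        (if \<exists>N. M = repeat_mset k N then f (THE N. M = repeat_mset k N) else 0)"
    using ex the by simp
qed

text \<open>
  The plethysm \<open>f[g]\<close>: expand \<open>f\<close> in power sums and replace each power sum \<open>p\<^sub>k\<close> by \<open>p\<^sub>k[g]\<close>.
  If \<open>f\<close> has unbounded degree, this is meaningful only for \<open>g\<close> without constant term.
\<close>

definition plethysm :: "symfun \<Rightarrow> symfun \<Rightarrow> symfun" where
  "plethysm f g =
     formal_sum (\<lambda>lam. scale (p_coeffs f lam) (\<Prod>k\<in>#lam. p_plethysm k g)) all_partitions"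

text \<open>
  The series \<open>Q\<close> is given by the sequence \<open>q\<close> of its homogeneous components \<open>q i\<close>, \<open>i \<ge> 1\<close>;
  \<open>count lam i\<close> is the number of parts equal to \<open>i\<close>.
\<close>

definition H_part :: "nat multiset \<Rightarrow> (nat \<Rightarrow> symfun) \<Rightarrow> symfun" where
  "H_part lam q = (\<Prod>i \<in> set_mset lam. plethysm (sym_h (count lam i)) (q i))"

definition E_part :: "nat multiset \<Rightarrow> (nat \<Rightarrow> symfun) \<Rightarrow> symfun" where
  "E_part lam q = (\<Prod>i \<in> set_mset lam. plethysm (sym_e (count lam i)) (q i))"


section \<open>Induced characters and the Frobenius characteristic\<close>

definition induced_char ::
    "('a, 'b) monoid_scheme \<Rightarrow> 'a set \<Rightarrow> ('a \<Rightarrow> complex) \<Rightarrow> 'a \<Rightarrow> complex" where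
  "induced_char G K \<chi> g =
     (\<Sum>x \<in> {x \<in> carrier G. inv\<^bsub>G\<^esub> x \<otimes>\<^bsub>G\<^esub> g \<otimes>\<^bsub>G\<^esub> x \<in> K}.
        \<chi> (inv\<^bsub>G\<^esub> x \<otimes>\<^bsub>G\<^esub> g \<otimes>\<^bsub>G\<^esub> x)) / of_nat (card K)"

definition cycle_type :: "nat \<Rightarrow> (nat \<Rightarrow> nat) \<Rightarrow> nat multiset" where
  "cycle_type n s = image_mset card (mset_set (Orbits.orbit s ` {1..n}))"

definition frobenius_ch :: "nat \<Rightarrow> ((nat \<Rightarrow> nat) \<Rightarrow> complex) \<Rightarrow> symfun" where
  "frobenius_ch n \<chi> = scale (1 / fact n)
     (\<Sum>s \<in> carrier (sym_group n). scale (\<chi> s) (sym_p_part (cycle_type n s)))"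

definition long_cycle :: "nat \<Rightarrow> nat \<Rightarrow> nat" where
  "long_cycle n = cycle_of_list [1..<Suc n]"

definition cyclic_subgroup :: "nat \<Rightarrow> (nat \<Rightarrow> nat) set" where
  "cyclic_subgroup n = generate (sym_group n) {long_cycle n}"

text \<open>
  For an \<open>n\<close>-th root of unity \<open>z\<close>, the linear character of the cyclic subgroup that sends the
  generator to \<open>z\<close>; as \<open>z ^ n = 1\<close>, the choice of the exponent \<open>j\<close> does not matter.
\<close>

definition cyclic_char :: "nat \<Rightarrow> complex \<Rightarrow> (nat \<Rightarrow> nat) \<Rightarrow> complex" where
  "cyclic_char n z g = z ^ (LEAST j :: nat. g = long_cycle n [^]\<^bsub>sym_group n\<^esub> j)"

definition Lie :: "nat \<Rightarrow> symfun" where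
  "Lie n = frobenius_ch n (induced_char (sym_group n) (cyclic_subgroup n)
     (cyclic_char n (exp (2 * of_real pi * \<i> / of_nat n))))"

definition Lie2 :: "nat \<Rightarrow> symfun" where
  "Lie2 n = frobenius_ch n (induced_char (sym_group n) (cyclic_subgroup n)
     (cyclic_char n (exp (2 * of_real pi * \<i> / of_nat n * 2 ^ multiplicity 2 n))))"

end

theory Submission
  imports Defs "HOL-Algebra.Multiplicative_Group"
begin

text \<open>
  Write \<open>Z a Q = exp (\<Sum>k. a k / k * p\<^sub>k[Q])\<close>, so that \<open>H[Q] = Z 1 Q\<close> and \<open>E[Q] = Z sgn Q\<close>
  with \<open>sgn k = (-1) ^ (k - 1)\<close>. The sum of all \<open>H\<^sub>\<lambda>[Q]\<close> with \<open>\<lambda>\<close> a partition of \<open>n\<close> is the degree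
  \<open>n\<close> component of \<open>H[Q]\<close>, and likewise for \<open>E\<close>, so that identity (1) reads \<open>Z a Q * (1 - p\<^sub>1) = 1\<close>.
  As \<open>Z a Q * Z (-a) Q = 1\<close>, this says \<open>Z (-a) Q = 1 - p\<^sub>1\<close>, which is (3); applying the
  automorphism \<open>p\<^sub>k \<mapsto> - p\<^sub>k\<close> turns it into (2). Identity (4) follows from \<open>H[Q] = E[Q] * p\<^sub>2[H[Q]]\<close>,
  since a series with constant term 1 that is fixed by \<open>p\<^sub>2[\<cdot>]\<close> is 1. The Euler derivation \<open>D\<close>
  (multiplication by the degree) replaces exponentials and logarithms:
  \<open>D (Z a Q) = (\<Sum>k. a k * p\<^sub>k[D Q]) * Z a Q\<close>. Finally \<open>n Lie\<^sub>n\<close> is a sum over \<open>d\<close> dividing \<open>n\<close> of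
  Ramanujan sums times \<open>p\<^sub>d ^ (n / d)\<close>, and summing Ramanujan sums over divisors gives sums of
  all \<open>n\<close>-th roots of unity, so \<open>\<Sum>k. a k * p\<^sub>k[D Q]\<close> is the geometric series in \<open>p\<^sub>1\<close>.
\<close>

section \<open>The ring of symmetric functions\<close>

text \<open>\<open>omega\<close>, \<open>p_coeffs\<close> and with it \<open>plethysm\<close> are
  definite descriptions, so nothing can be computed before the power sum products are known to form
  a basis and \<open>omega\<close> is known explicitly; this accounts for the triangularity argument
  and for the attention to continuity. Infinite products are never formed: the factorisation of H[Q]
  over the homogeneous parts of Q appears as two sequences obeying one Newton recursion, and many
  identities of series are checked modulo high degree. The involution does not commute with plethysm
  by p_k; it is therefore split into a sign depending on the degree and a map that does commute, and
  the sign (-1)^(n-1) prescribed in (2) cancels the former up to a global minus. The twist by the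
  2-part of n in \<open>Lie2\<close> enters through one fact only: the Ramanujan sum c_d(2^K) is the
  same for every K that is at least the 2-adic valuation of d. The coefficients of n Lie2_n thus
  depend on d alone, and Dirichlet convolution applies.\<close>

lemma symfun_eqI: "(\<And>M. mcoeff f M = mcoeff g M) \<Longrightarrow> f = g"
  by (metis mcoeff_inject ext)

lemma mcoeff_zero [simp]: "mcoeff 0 M = 0"
  by (simp add: zero_symfun.rep_eq)

lemma mcoeff_one: "mcoeff 1 M = (if M = {#} then 1 else 0)"
  by (simp add: one_symfun.rep_eq)

lemma mcoeff_add [simp]: "mcoeff (f + g) M = mcoeff f M + mcoeff g M"
  by (simp add: plus_symfun.rep_eq)

lemma mcoeff_diff [simp]: "mcoeff (f - g) M = mcoeff f M - mcoeff g M"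
  by (simp add: minus_symfun.rep_eq)

lemma mcoeff_uminus [simp]: "mcoeff (- f) M = - mcoeff f M"
  by (simp add: uminus_symfun.rep_eq)

lemma mcoeff_scale [simp]: "mcoeff (scale c f) M = c * mcoeff f M"
  by (simp add: scale.rep_eq)

lemma mcoeff_sum [simp]: "mcoeff (\<Sum>i\<in>I. f i) M = (\<Sum>i\<in>I. mcoeff (f i) M)"
  by (induction I rule: infinite_finite_induct) auto

lemma mcoeff_times: "mcoeff (f * g) M = (\<Sum>(A, B)\<in>{(A, B). A + B = M}. mcoeff f A * mcoeff g B)"
  by (simp add: times_symfun.rep_eq)

lemma mcoeff_times_empty [simp]: "mcoeff (f * g) {#} = mcoeff f {#} * mcoeff g {#}"
proof -
  have "{(A, B). A + B = ({#} :: nat multiset)} = {({#}, {#})}" by auto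
  then show ?thesis by (simp add: mcoeff_times)
qed

lemma mcoeff_hom_component [simp]:
  "mcoeff (hom_component n f) M = (if size M = n then mcoeff f M else 0)"
  by (simp add: hom_component.rep_eq)

lemma mcoeff_image_mset: "bij s \<Longrightarrow> mcoeff f (image_mset s M) = mcoeff f M"
  using mcoeff[of f] by blast

lemma scale_mult_left [simp]: "scale c f * g = scale c (f * g)"
  by (rule symfun_eqI) (simp add: mcoeff_times sum_distrib_left case_prod_beta mult.assoc)

lemma scale_mult_right [simp]: "f * scale c g = scale c (f * g)"
  by (metis mult.commute scale_mult_left)

lemma scale_scale [simp]: "scale c (scale d f) = scale (c * d) f"
  by (rule symfun_eqI) simp

lemma scale_one [simp]: "scale 1 f = f"
  by (rule symfun_eqI) simp

lemma scale_zero_left [simp]: "scale 0 f = 0"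
  by (rule symfun_eqI) simp

lemma scale_zero_right [simp]: "scale c 0 = 0"
  by (rule symfun_eqI) simp

lemma scale_minus_left [simp]: "scale (- c) f = - scale c f"
  by (rule symfun_eqI) simp

lemma scale_minus_right [simp]: "scale c (- f) = - scale c f"
  by (rule symfun_eqI) simp

lemma scale_add_left: "scale (c + d) f = scale c f + scale d f"
  by (rule symfun_eqI) (simp add: algebra_simps)

lemma scale_sum_right: "scale c (\<Sum>i\<in>I. f i) = (\<Sum>i\<in>I. scale c (f i))"
  by (rule symfun_eqI) (simp add: sum_distrib_left)

lemma scale_sum_left: "scale (\<Sum>i\<in>I. c i) f = (\<Sum>i\<in>I. scale (c i) f)"
  by (rule symfun_eqI) (simp add: sum_distrib_right)

lemma of_nat_symfun: "(of_nat n :: symfun) = scale (of_nat n) 1"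
  by (induction n) (simp_all add: scale_add_left)

lemma neg_one_power_symfun: "((-1) ^ n :: symfun) = scale ((-1) ^ n) 1"
  by (induction n) simp_all

lemma prod_scale: "(\<Prod>i\<in>I. scale (c i) (f i)) = scale (\<Prod>i\<in>I. c i) (\<Prod>i\<in>I. f i)"
  by (induction I rule: infinite_finite_induct) (simp_all add: mult.commute)

lemma prod_mset_scale: "(\<Prod>k\<in>#lam. scale (c k) (f k)) = scale (\<Prod>k\<in>#lam. c k) (\<Prod>k\<in>#lam. f k)"
  by (induction lam) (simp_all add: mult.commute)

section \<open>The Euler derivation and linear differential equations\<close>

lift_definition euler :: "symfun \<Rightarrow> symfun" is "\<lambda>f M. of_nat (size M) * f M" by simp

lemma mcoeff_euler [simp]: "mcoeff (euler f) M = of_nat (size M) * mcoeff f M"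
  by (simp add: euler.rep_eq)

lemma euler_mult: "euler (f * g) = euler f * g + f * euler g"
proof (rule symfun_eqI)
  fix M
  have "of_nat (size M) * (\<Sum>(A, B)\<in>{(A, B). A + B = M}. mcoeff f A * mcoeff g B)
      = (\<Sum>(A, B)\<in>{(A, B). A + B = M}. of_nat (size A) * mcoeff f A * mcoeff g B
          + mcoeff f A * (of_nat (size B) * mcoeff g B))"
    unfolding sum_distrib_left by (rule sum.cong) (auto simp: algebra_simps)
  then show "mcoeff (euler (f * g)) M = mcoeff (euler f * g + f * euler g) M"
    by (simp add: mcoeff_times sum.distrib case_prod_beta)
qed

lemma euler_one [simp]: "euler 1 = 0"
  by (rule symfun_eqI) (simp add: mcoeff_one)

lemma euler_scale [simp]: "euler (scale c f) = scale c (euler f)"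
  by (rule symfun_eqI) simp

lemma euler_sum: "euler (\<Sum>i\<in>I. f i) = (\<Sum>i\<in>I. euler (f i))"
  by (rule symfun_eqI) (simp add: sum_distrib_left)

text \<open>Leibniz rule with equal factors collected into a multiplicity, the shape in which
  \<open>cycle_index_recursion\<close> takes it up.\<close>

lemma euler_prod_mset:
  "euler (\<Prod>k\<in>#lam. g k) =
     (\<Sum>k\<in>set_mset lam. scale (of_nat (count lam k)) (euler (g k) * (\<Prod>j\<in>#lam - {#k#}. g j)))"
proof (induction lam)
  case empty
  then show ?case by simp
next
  case (add a lam)
  let ?t = "\<lambda>lam k. scale (of_nat (count lam k)) (euler (g k) * (\<Prod>j\<in>#lam - {#k#}. g j))"
  have rem: "(\<Prod>j\<in>#add_mset a lam - {#k#}. g j) = g a * (\<Prod>j\<in>#lam - {#k#}. g j)"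
    if "k \<in># lam" for k
    using that by (metis diff_union_swap insert_DiffM add_mset_remove_trivial image_mset_add_mset prod_mset.add_mset)
  have "g a * ?t lam k = scale (of_nat (count lam k)) (euler (g k) * (\<Prod>j\<in>#add_mset a lam - {#k#}. g j))"
    if "k \<in># lam" for k
    using rem[OF that] by (simp add: mult_ac)
  then have "euler (\<Prod>k\<in>#add_mset a lam. g k) = euler (g a) * (\<Prod>k\<in>#lam. g k)
      + (\<Sum>k\<in>set_mset lam. scale (of_nat (count lam k)) (euler (g k) * (\<Prod>j\<in>#add_mset a lam - {#k#}. g j)))"
    by (simp add: euler_mult add.IH sum_distrib_left)
  \<comment> \<open>Enlarging the index set by \<open>a\<close> adds nothing: if \<open>a\<close> is
    new, its multiplicity in \<open>lam\<close> is 0.\<close>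
  also have "(\<Sum>k\<in>set_mset lam. scale (of_nat (count lam k)) (euler (g k) * (\<Prod>j\<in>#add_mset a lam - {#k#}. g j)))
     = (\<Sum>k\<in>insert a (set_mset lam). scale (of_nat (count lam k)) (euler (g k) * (\<Prod>j\<in>#add_mset a lam - {#k#}. g j)))"
    by (rule sum.mono_neutral_left) (auto simp: not_in_iff)
  also have "euler (g a) * (\<Prod>k\<in>#lam. g k) =
     (\<Sum>k\<in>insert a (set_mset lam). if k = a then euler (g k) * (\<Prod>j\<in>#add_mset a lam - {#k#}. g j) else 0)"
    by simp
  also have "\<dots> + (\<Sum>k\<in>insert a (set_mset lam). scale (of_nat (count lam k)) (euler (g k) * (\<Prod>j\<in>#add_mset a lam - {#k#}. g j)))
     = (\<Sum>k\<in>insert a (set_mset lam). scale (of_nat (count (add_mset a lam) k)) (euler (g k) * (\<Prod>j\<in>#add_mset a lam - {#k#}. g j)))"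
    unfolding sum.distrib[symmetric] by (rule sum.cong[OF refl]) (simp add: scale_add_left)
  finally show ?case by simp
qed

text \<open>As \<open>a\<close> lacks a constant term, the equation in degree n > 0 expresses n
  times the degree n part through parts of lower degree, and n is invertible. The constant term is
  the only freedom. Most identities between exponentials below are reduced to this.\<close>

lemma euler_unique:
  assumes "euler f = a * f" "euler g = a * g" "mcoeff f {#} = mcoeff g {#}" "mcoeff a {#} = 0"
  shows "f = g"
proof (rule symfun_eqI)
  fix M show "mcoeff f M = mcoeff g M"
  proof (induction "size M" arbitrary: M rule: less_induct)
    case less
    show ?case
    proof (cases "M = {#}")
      case False
      have "mcoeff (a * f) M = mcoeff (a * g) M"
        unfolding mcoeff_times
      proof (rule sum.cong[OF refl], clarify)
        fix A B assume AB: "M = A + B"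
        show "mcoeff a A * mcoeff f B = mcoeff a A * mcoeff g B"
          using AB assms(4) less[of B] by (cases "A = {#}") (auto simp: nonempty_has_size)
      qed
      then have "of_nat (size M) * mcoeff f M = of_nat (size M) * mcoeff g M"
        using assms(1,2) by (metis mcoeff_euler)
      with False show ?thesis by simp
    qed (simp add: assms)
  qed
qed

text \<open>Congruence modulo the terms of degree above \<open>N\<close>. It stands in for the
  topology of the completion: a formal sum is compared with finite partial sums, one
  \<open>N\<close> at a time.\<close>

definition agree_upto :: "nat \<Rightarrow> symfun \<Rightarrow> symfun \<Rightarrow> bool" where
  "agree_upto N f g \<longleftrightarrow> (\<forall>M. size M \<le> N \<longrightarrow> mcoeff f M = mcoeff g M)"

lemma agree_upto_refl [simp]: "agree_upto N f f"
  by (simp add: agree_upto_def)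

lemma agree_upto_sym: "agree_upto N f g \<Longrightarrow> agree_upto N g f"
  by (simp add: agree_upto_def)

lemma agree_upto_trans [trans]: "agree_upto N f g \<Longrightarrow> agree_upto N g h \<Longrightarrow> agree_upto N f h"
  by (simp add: agree_upto_def)

lemma agree_upto_eqI: "(\<And>N. agree_upto N f g) \<Longrightarrow> f = g"
  by (rule symfun_eqI) (auto simp: agree_upto_def)

lemma agree_upto_mult:
  assumes "agree_upto N f f'" "agree_upto N g g'"
  shows "agree_upto N (f * g) (f' * g')"
  using assms unfolding agree_upto_def mcoeff_times
  by (auto intro!: sum.cong)

lemma agree_upto_sum: "(\<And>i. i \<in> I \<Longrightarrow> agree_upto N (f i) (g i)) \<Longrightarrow> agree_upto N (\<Sum>i\<in>I. f i) (\<Sum>i\<in>I. g i)"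
  unfolding agree_upto_def by (auto intro!: sum.cong)

lemma agree_upto_euler: "agree_upto N f g \<Longrightarrow> agree_upto N (euler f) (euler g)"
  by (simp add: agree_upto_def)

section \<open>Homogeneous components\<close>

lemma homogeneous_iff: "homogeneous n f \<longleftrightarrow> hom_component n f = f"
proof
  assume "homogeneous n f"
  then show "hom_component n f = f"
    by (intro symfun_eqI) (auto simp: homogeneous_def)
next
  assume "hom_component n f = f"
  then show "homogeneous n f"
    unfolding homogeneous_def by (metis mcoeff_hom_component)
qed

lemma homogeneous_one [simp]: "homogeneous 0 1"
  by (simp add: homogeneous_def mcoeff_one)

lemma homogeneous_zero [simp]: "homogeneous n 0"
  by (simp add: homogeneous_def)

lemma homogeneous_add: "homogeneous n f \<Longrightarrow> homogeneous n g \<Longrightarrow> homogeneous n (f + g)"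
  unfolding homogeneous_def by (metis mcoeff_add add.right_neutral)

lemma homogeneous_uminus: "homogeneous n f \<Longrightarrow> homogeneous n (- f)"
  by (simp add: homogeneous_def)

lemma homogeneous_scale: "homogeneous n f \<Longrightarrow> homogeneous n (scale c f)"
  by (simp add: homogeneous_def)

lemma homogeneous_sum: "(\<And>i. i \<in> I \<Longrightarrow> homogeneous n (f i)) \<Longrightarrow> homogeneous n (\<Sum>i\<in>I. f i)"
  by (induction I rule: infinite_finite_induct) (auto intro: homogeneous_add)

lemma homogeneous_mult:
  assumes "homogeneous m f" "homogeneous n g"
  shows "homogeneous (m + n) (f * g)"
  unfolding homogeneous_def mcoeff_times
proof (intro allI impI)
  fix M assume "(\<Sum>(A, B)\<in>{(A, B). A + B = M}. mcoeff f A * mcoeff g B) \<noteq> 0"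
  then obtain A B where "A + B = M" "mcoeff f A * mcoeff g B \<noteq> 0"
    by (elim sum.not_neutral_contains_not_neutral) auto
  with assms show "size M = m + n"
    unfolding homogeneous_def by auto
qed

lemma homogeneous_prod_mset:
  "(\<And>i. i \<in># lam \<Longrightarrow> homogeneous (d i) (f i)) \<Longrightarrow> homogeneous (\<Sum>i\<in>#lam. d i) (\<Prod>i\<in>#lam. f i)"
  by (induction lam) (auto intro: homogeneous_mult)

lemma homogeneous_power: "homogeneous d f \<Longrightarrow> homogeneous (d * n) (f ^ n)"
  by (induction n) (auto intro: homogeneous_mult)

lemma hom_component_homogeneous:
  "homogeneous n f \<Longrightarrow> hom_component m f = (if m = n then f else 0)"
  by (rule symfun_eqI) (auto simp: homogeneous_def)

lemma hom_component_add: "hom_component n (f + g) = hom_component n f + hom_component n g"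
  by (rule symfun_eqI) simp

lemma hom_component_diff: "hom_component n (f - g) = hom_component n f - hom_component n g"
  by (rule symfun_eqI) simp

lemma hom_component_uminus: "hom_component n (- f) = - hom_component n f"
  by (rule symfun_eqI) simp

lemma hom_component_scale: "hom_component n (scale c f) = scale c (hom_component n f)"
  by (rule symfun_eqI) simp

lemma hom_component_sum: "hom_component n (\<Sum>i\<in>I. f i) = (\<Sum>i\<in>I. hom_component n (f i))"
  by (rule symfun_eqI) simp

lemma hom_component_euler: "hom_component n (euler f) = scale (of_nat n) (hom_component n f)"
  by (rule symfun_eqI) simp

lemma hom_component_0: "hom_component 0 f = scale (mcoeff f {#}) 1"
  by (rule symfun_eqI) (simp add: mcoeff_one)

lemma hom_component_eqI: "(\<And>n. hom_component n f = hom_component n g) \<Longrightarrow> f = g"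
  by (rule symfun_eqI) (metis mcoeff_hom_component)

lemma hom_component_mult:
  "hom_component n (f * g) = (\<Sum>j\<le>n. hom_component j f * hom_component (n - j) g)"
proof (rule symfun_eqI)
  fix M :: "nat multiset"
  let ?S = "{(A, B). A + B = M}"
  have "mcoeff (\<Sum>j\<le>n. hom_component j f * hom_component (n - j) g) M
     = (\<Sum>j\<le>n. \<Sum>p\<in>?S. (if size (fst p) = j then mcoeff f (fst p) else 0) *
           (if size (snd p) = n - j then mcoeff g (snd p) else 0))"
    by (simp add: mcoeff_times case_prod_beta)
  also have "\<dots> = (\<Sum>p\<in>?S. \<Sum>j\<le>n. (if size (fst p) = j then mcoeff f (fst p) else 0) *
           (if size (snd p) = n - j then mcoeff g (snd p) else 0))"
    by (rule sum.swap)
  also have "\<dots> = (\<Sum>p\<in>?S. if size M = n then mcoeff f (fst p) * mcoeff g (snd p) else 0)"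
  proof (rule sum.cong[OF refl], clarify)
    fix A B assume "M = A + B"
    have "(\<Sum>j\<le>n. (if size A = j then mcoeff f A else 0) * (if size B = n - j then mcoeff g B else 0))
      = (\<Sum>j\<le>n. if j = size A then mcoeff f A * (if size B = n - j then mcoeff g B else 0) else 0)"
      by (rule sum.cong) auto
    also have "\<dots> = (if size (A + B) = n then mcoeff f A * mcoeff g B else 0)"
      by (subst sum.delta) auto
    finally show "(\<Sum>j\<le>n. (if size (fst (A, B)) = j then mcoeff f (fst (A, B)) else 0) *
           (if size (snd (A, B)) = n - j then mcoeff g (snd (A, B)) else 0)) = 
        (if size (A + B) = n then mcoeff f (fst (A, B)) * mcoeff g (snd (A, B)) else 0)"
      by (simp only: fst_conv snd_conv)
  qed
  finally show "mcoeff (hom_component n (f * g)) M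
      = mcoeff (\<Sum>j\<le>n. hom_component j f * hom_component (n - j) g) M"
    by (simp add: mcoeff_times case_prod_beta)
qed

section \<open>The basis of power sum products\<close>

text \<open>Replaces the support, which depends on \<open>M\<close>, by any finite \<open>J\<close>
  containing it.\<close>

lemma mcoeff_formal_sum:
  assumes "finite J" "J \<subseteq> I" "\<And>i. i \<in> I \<Longrightarrow> mcoeff (f i) M \<noteq> 0 \<Longrightarrow> i \<in> J"
  shows "mcoeff (formal_sum f I) M = (\<Sum>i\<in>J. mcoeff (f i) M)"
  unfolding formal_sum.rep_eq using assms by (intro sum.mono_neutral_left) auto

lemma partitions_of_iff: "lam \<in> partitions_of n \<longleftrightarrow> lam \<in> all_partitions \<and> \<Sum>\<^sub># lam = n"
  by (simp add: partitions_of_def)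

lemma size_le_sum_mset: "0 \<notin># lam \<Longrightarrow> size lam \<le> \<Sum>\<^sub># (lam :: nat multiset)"
proof (induction lam)
  case (add x lam)
  then have "x \<ge> 1" "size lam \<le> \<Sum>\<^sub># lam" by simp_all
  then show ?case by simp
qed simp

lemma finite_partitions_of [simp]: "finite (partitions_of n)"
proof (rule finite_subset)
  show "partitions_of n \<subseteq> (\<Union>k\<le>n. multisets_of_size {..n} k)"
  proof
    fix lam assume "lam \<in> partitions_of n"
    then have lam: "0 \<notin># lam" "\<Sum>\<^sub># lam = n"
      by (simp_all add: partitions_of_iff all_partitions_def)
    then have "size lam \<le> n" using size_le_sum_mset by blast
    moreover have "i \<le> n" if "i \<in># lam" for i
      using multi_member_split[OF that] lam(2) by auto
    ultimately show "lam \<in> (\<Union>k\<le>n. multisets_of_size {..n} k)"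
      by (auto simp: multisets_of_size_def)
  qed
qed (simp add: finite_multisets_of_size)

lemma partitions_of_0 [simp]: "partitions_of 0 = {{#}}"
proof -
  have "lam = {#}" if "0 \<notin># lam" "\<Sum>\<^sub># lam = 0" for lam :: "nat multiset"
    using size_le_sum_mset[OF that(1)] that(2) by simp
  then show ?thesis by (auto simp: partitions_of_iff all_partitions_def)
qed

lemma all_partitions_simps [simp]:
  "{#} \<in> all_partitions"
  "add_mset k lam \<in> all_partitions \<longleftrightarrow> 0 < k \<and> lam \<in> all_partitions"
  "lam + mu \<in> all_partitions \<longleftrightarrow> lam \<in> all_partitions \<and> mu \<in> all_partitions"
  by (auto simp: all_partitions_def)

lemma all_partitions_pos: "lam \<in> all_partitions \<Longrightarrow> k \<in># lam \<Longrightarrow> 0 < k"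
  by (auto simp: all_partitions_def intro: gr0I)

lemma partitions_of_1: "partitions_of (Suc 0) = {{#Suc 0#}}"
proof -
  have "lam = {#Suc 0#}" if "0 \<notin># lam" "\<Sum>\<^sub># lam = Suc 0" for lam
    using that
  proof (cases lam)
    case (add k mu)
    with that have "k + \<Sum>\<^sub># mu = Suc 0" "0 < k" "0 \<notin># mu" by auto
    then have "k = Suc 0" "\<Sum>\<^sub># mu = 0" "0 \<notin># mu" by linarith+
    then have "mu \<in> partitions_of 0" unfolding partitions_of_def all_partitions_def by blast
    with add \<open>k = Suc 0\<close> show ?thesis by simp
  qed auto
  then show ?thesis by (auto simp: partitions_of_def all_partitions_def)
qed

text \<open>The hypothesis bounds the partitions that can reach a given monomial, so the family is
  locally finite and the junk value of \<open>formal_sum\<close> never occurs.\<close>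

lemma agree_upto_formal_sum_partitions:
  assumes "\<And>lam M. lam \<in> all_partitions \<Longrightarrow> size M < \<Sum>\<^sub># lam \<Longrightarrow> mcoeff (f lam) M = 0"
  shows "agree_upto N (formal_sum f all_partitions) (\<Sum>n\<le>N. \<Sum>lam\<in>partitions_of n. f lam)"
  unfolding agree_upto_def
proof (intro allI impI)
  fix M :: "nat multiset" assume M: "size M \<le> N"
  have "mcoeff (formal_sum f all_partitions) M = (\<Sum>lam\<in>(\<Union>n\<le>N. partitions_of n). mcoeff (f lam) M)"
  proof (rule mcoeff_formal_sum)
    fix lam assume lam: "lam \<in> all_partitions" "mcoeff (f lam) M \<noteq> 0"
    then have "\<Sum>\<^sub># lam \<le> N" using assms[of lam M] M by (meson le_trans not_less)
    with lam show "lam \<in> (\<Union>n\<le>N. partitions_of n)" by (auto simp: partitions_of_def)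
  qed (auto simp: partitions_of_iff)
  also have "\<dots> = (\<Sum>n\<le>N. \<Sum>lam\<in>partitions_of n. mcoeff (f lam) M)"
    by (rule sum.UNION_disjoint) (simp_all add: partitions_of_iff disjoint_iff)
  finally show "mcoeff (formal_sum f all_partitions) M = mcoeff (\<Sum>n\<le>N. \<Sum>lam\<in>partitions_of n. f lam) M"
    by simp
qed

lemma mcoeff_sym_p: "mcoeff (sym_p n) M = (if \<exists>i. M = replicate_mset n i then 1 else 0)"
  by (simp add: sym_p.rep_eq)

lemma homogeneous_sym_p [simp]: "homogeneous n (sym_p n)"
  by (auto simp: homogeneous_def mcoeff_sym_p)

lemma sym_p_part_simps [simp]:
  "sym_p_part {#} = 1"
  "sym_p_part (add_mset k lam) = sym_p k * sym_p_part lam"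
  "sym_p_part (lam + mu) = sym_p_part lam * sym_p_part mu"
  by (simp_all add: sym_p_part_def)

lemma homogeneous_sym_p_part [simp]: "homogeneous (\<Sum>\<^sub># lam) (sym_p_part lam)"
  using homogeneous_prod_mset[of lam "\<lambda>k. k" sym_p] by (simp add: sym_p_part_def)

text \<open>A factor p_k takes \<open>k\<close> copies of a single variable out of \<open>M\<close>;
  since \<open>k > 0\<close>, that variable can be recovered from the removed block.\<close>

lemma mcoeff_sym_p_mult:
  assumes "k > 0"
  shows "mcoeff (sym_p k * f) M =
    (\<Sum>i\<in>{i \<in> set_mset M. k \<le> count M i}. mcoeff f (M - replicate_mset k i))"
proof -
  let ?I = "{i \<in> set_mset M. k \<le> count M i}"
  let ?h = "\<lambda>i. (replicate_mset k i, M - replicate_mset k i)"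
  have inj: "inj_on ?h ?I"
    using assms by (auto simp: inj_on_def) (metis in_replicate_mset)
  have "mcoeff (sym_p k * f) M = (\<Sum>(A, B)\<in>?h ` ?I. mcoeff (sym_p k) A * mcoeff f B)"
    unfolding mcoeff_times
  proof (rule sum.mono_neutral_right[OF finite_mset_splits])
    show "?h ` ?I \<subseteq> {(A, B). A + B = M}"
      by (auto simp: multiset_eq_iff)
    show "\<forall>p\<in>{(A, B). A + B = M} - ?h ` ?I. (case p of (A, B) \<Rightarrow> mcoeff (sym_p k) A * mcoeff f B) = 0"
    proof
      fix p assume "p \<in> {(A, B). A + B = M} - ?h ` ?I"
      then obtain A B where p: "p = (A, B)" "A + B = M" "(A, B) \<notin> ?h ` ?I" by auto
      have False if "mcoeff (sym_p k) A \<noteq> 0"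
      proof -
        from that obtain i where i: "A = replicate_mset k i" by (auto simp: mcoeff_sym_p split: if_splits)
        then have "(A, B) = ?h i" "i \<in> ?I" using p(2) assms by auto
        with p(3) show False by blast
      qed
      then show "(case p of (A, B) \<Rightarrow> mcoeff (sym_p k) A * mcoeff f B) = 0"
        using p(1) by auto
    qed
  qed
  also have "\<dots> = (\<Sum>i\<in>?I. mcoeff f (M - replicate_mset k i))"
    using inj by (subst sum.reindex) (auto simp: mcoeff_sym_p intro!: sum.cong)
  finally show ?thesis .
qed

text \<open>The exponents of the monomial \<open>M\<close> as a partition: the invariant that
  classifies monomials up to renaming of variables.\<close>

definition exponents :: "nat multiset \<Rightarrow> nat multiset" where
  "exponents M = image_mset (count M) (mset_set (set_mset M))"

lemma sum_mset_exponents: "\<Sum>\<^sub># (exponents M) = size M"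
  by (simp add: exponents_def size_multiset_overloaded_eq flip: sum_unfold_sum_mset)

lemma size_exponents: "size (exponents M) = card (set_mset M)"
  by (simp add: exponents_def)

lemma exponents_all_partitions [simp]: "exponents M \<in> all_partitions"
  by (auto simp: exponents_def all_partitions_def) (metis count_eq_zero_iff)

lemma set_mset_diff_replicate:
  "set_mset (M - replicate_mset k i) = (if count M i \<le> k then set_mset M - {i} else set_mset M)"
  by (auto simp: set_eq_iff in_diff_count simp flip: count_greater_zero_iff)

lemma exponents_remove:
  assumes "i \<in># M"
  shows "exponents M = add_mset (count M i) (exponents (M - replicate_mset (count M i) i))"
proof -
  have s: "set_mset (M - replicate_mset (count M i) i) = set_mset M - {i}"
    by (auto simp: set_mset_diff_replicate)
  have "mset_set (set_mset M) = add_mset i (mset_set (set_mset M - {i}))"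
    using assms by (simp add: mset_set.remove)
  then show ?thesis
    unfolding exponents_def s by (auto intro!: image_mset_cong)
qed

text \<open>Infinitely many variables are available, so each new part can be placed on a fresh
  one.\<close>

lemma exponents_surj: "lam \<in> all_partitions \<Longrightarrow> \<exists>M. exponents M = lam"
proof (induction lam)
  case (add k lam)
  then obtain M where M: "exponents M = lam" by auto
  obtain i where i: "i \<notin># M"
    using ex_new_if_finite[of "set_mset M"] by auto
  have "exponents (M + replicate_mset k i) = add_mset k lam"
    using exponents_remove[of i "M + replicate_mset k i"] add.prems i M by (simp add: not_in_iff)
  then show ?case ..
qed (auto simp: exponents_def intro!: exI[of _ "{#}"])

text \<open>Matching variables of equal exponent only gives a bijection between the two supports,
  whereas the symmetry of a \<open>symfun\<close> concerns bijections of all variables; the partial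
  matching has to be extended.\<close>

lemma exponents_eq_imp_bij:
  assumes "exponents M = exponents N"
  shows "\<exists>s. bij s \<and> N = image_mset s M"
proof -
  have *: "\<exists>s. bij_betw s (set_mset M) (set_mset N) \<and> (\<forall>i\<in>set_mset M. count N (s i) = count M i)"
    using assms
  proof (induction "card (set_mset M)" arbitrary: M N)
    case 0
    then show ?case by (auto simp: exponents_def mset_set_empty_iff)
  next
    case (Suc m)
    then obtain i where i: "i \<in># M" by (metis card.empty equals0I nat.distinct(1))
    then have "count M i \<in># exponents N"
      using exponents_remove[OF i] Suc.prems by (metis union_single_eq_member)
    then obtain j where j: "j \<in># N" "count N j = count M i"
      by (auto simp: exponents_def)
    define M' where "M' = M - replicate_mset (count M i) i"
    define N' where "N' = N - replicate_mset (count N j) j"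
    have s: "set_mset M' = set_mset M - {i}" "set_mset N' = set_mset N - {j}"
      by (auto simp: M'_def N'_def set_mset_diff_replicate)
    have c: "count M' x = count M x" if "x \<noteq> i" for x using that by (simp add: M'_def)
    have d: "count N' x = count N x" if "x \<noteq> j" for x using that by (simp add: N'_def)
    have "exponents M' = exponents N'"
      using Suc.prems exponents_remove[OF i] exponents_remove[OF j(1)] j(2)
      by (simp add: M'_def N'_def)
    moreover have "m = card (set_mset M')" using Suc.hyps(2) i by (simp add: s)
    ultimately obtain s where s': "bij_betw s (set_mset M') (set_mset N')"
       "\<forall>x\<in>set_mset M'. count N' (s x) = count M' x"
      using Suc.hyps(1) by blast
    have "bij_betw (s(i := j)) (insert i (set_mset M')) (insert j (set_mset N'))"
      using s' by (intro bij_betw_combine[of _ "{i}" "{j}", simplified]) 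
        (auto simp: s bij_betw_def inj_on_def image_def)
    moreover have "insert i (set_mset M') = set_mset M" "insert j (set_mset N') = set_mset N"
      using i j by (auto simp: s)
    moreover have "\<forall>x\<in>set_mset M. count N ((s(i := j)) x) = count M x"
    proof
      fix x assume x: "x \<in># M"
      show "count N ((s(i := j)) x) = count M x"
      proof (cases "x = i")
        case False
        then have "x \<in># M'" using x by (simp add: s)
        moreover have "s x \<in># N'" using s'(1) \<open>x \<in># M'\<close> by (auto simp: bij_betw_def)
        then have "count N' (s x) = count N (s x)" using s(2) by (intro d) auto
        ultimately show ?thesis using s'(2) c[OF False] False by auto
      qed (simp add: j)
    qed
    ultimately show ?case by auto
  qed
  then obtain s where s: "bij_betw s (set_mset M) (set_mset N)" "\<forall>i\<in>set_mset M. count N (s i) = count M i"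
    by blast
  \<comment> \<open>Inside the finite union \<open>F\<close> the complements of the two supports
    have equal size and can be matched; outside \<open>F\<close> the identity is used.\<close>
  define F where "F = set_mset M \<union> set_mset N"
  have "card (F - set_mset M) = card (F - set_mset N)"
    using bij_betw_same_card[OF s(1)] by (simp add: F_def card_Diff_subset)
  then obtain t where t: "bij_betw t (F - set_mset M) (F - set_mset N)"
    by (metis F_def finite_Diff finite_Un finite_same_card_bij finite_set_mset)
  define u where "u x = (if x \<in># M then s x else if x \<in> F then t x else x)" for x
  have 1: "bij_betw u (set_mset M) (set_mset N)"
    using s(1) by (subst bij_betw_cong[of _ u s]) (auto simp: u_def)
  have 2: "bij_betw u (F - set_mset M) (F - set_mset N)"
    using t by (subst bij_betw_cong[of _ u t]) (auto simp: u_def)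
  have "bij_betw u (set_mset M \<union> (F - set_mset M)) (set_mset N \<union> (F - set_mset N))"
    by (rule bij_betw_combine[OF 1 2]) auto
  then have "bij_betw u F F" by (simp add: F_def Un_absorb1 Un_commute)
  moreover have "bij_betw u (- F) (- F)"
    by (rule bij_betw_cong[THEN iffD1, OF _ bij_betw_id]) (auto simp: u_def F_def)
  ultimately have "bij_betw u (F \<union> - F) (F \<union> - F)"
    by (rule bij_betw_combine) auto
  then have u: "bij u" by simp
  have "count N y = count (image_mset u M) y" for y
  proof -
    obtain x where x: "y = u x" using u by (metis bij_pointE)
    have "count (image_mset u M) (u x) = count M x"
      by (induction M) (use u in \<open>auto simp: bij_is_inj inj_eq\<close>)
    moreover have "count N (u x) = count M x"
    proof (cases "x \<in># M")
      case True
      then show ?thesis using s(2) by (simp add: u_def)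
    next
      case False
      have "u x \<notin># N"
      proof
        assume "u x \<in># N"
        then obtain x' where "x' \<in># M" "u x' = u x" using 1 by (metis bij_betw_def imageE)
        then show False using False u by (metis bij_is_inj injD)
      qed
      then show ?thesis using False by (simp add: not_in_iff)
    qed
    ultimately show ?thesis by (simp add: x)
  qed
  then have "N = image_mset u M" by (intro multiset_eqI)
  with u show ?thesis by blast
qed

lemma mcoeff_cong_exponents: "exponents M = exponents N \<Longrightarrow> mcoeff f M = mcoeff f N"
  using exponents_eq_imp_bij[of M N] mcoeff_image_mset by metis

text \<open>The power sum products are triangular in the monomial basis with respect to the number of
  parts, whence they form a basis.\<close>

lemma sym_p_part_leading:
  assumes "lam \<in> all_partitions" "mcoeff (sym_p_part lam) M \<noteq> 0"
  shows "card (set_mset M) < size lam \<or> exponents M = lam"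
  using assms
proof (induction lam arbitrary: M)
  case empty
  then show ?case by (auto simp: mcoeff_one exponents_def split: if_splits)
next
  case (add k lam)
  then have k: "k > 0" by simp
  from add.prems obtain i where i: "i \<in># M" "k \<le> count M i"
    and nz: "mcoeff (sym_p_part lam) (M - replicate_mset k i) \<noteq> 0"
    by (auto simp: mcoeff_sym_p_mult[OF k] elim!: sum.not_neutral_contains_not_neutral)
  let ?M = "M - replicate_mset k i"
  have IH: "card (set_mset ?M) < size lam \<or> exponents ?M = lam"
    using add nz by auto
  have "set_mset M - {i} \<subseteq> set_mset ?M" by (auto simp: set_mset_diff_replicate)
  then have c: "card (set_mset M) \<le> Suc (card (set_mset ?M))"
    by (metis card_Suc_Diff1 card_mono finite_set_mset i(1) not_less_eq_eq Suc_le_mono)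
  show ?case
  proof (cases "k = count M i")
    case True
    then show ?thesis using IH c exponents_remove[OF i(1)] by auto
  next
    \<comment> \<open>The variable \<open>i\<close> survives the removal, so the number of variables
      stays the same while the number of parts grows by one, and the inequality becomes
      strict.\<close>
    case False
    then have "set_mset ?M = set_mset M" using i by (auto simp: set_mset_diff_replicate)
    then have "card (set_mset M) = card (set_mset ?M)" by simp
    also have "\<dots> \<le> size lam" using IH size_exponents[of ?M] by auto
    finally show ?thesis by simp
  qed
qed

text \<open>Being natural numbers, the coefficients cannot cancel; this is what makes the diagonal
  entries nonzero in \<open>mcoeff_sym_p_part_exponents\<close>.\<close>

lemma mcoeff_sym_p_part_nat: "lam \<in> all_partitions \<Longrightarrow> mcoeff (sym_p_part lam) M \<in> \<nat>"
proof (induction lam arbitrary: M)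
  case (add k lam)
  then have "\<And>M. mcoeff (sym_p_part lam) M \<in> \<nat>" by simp
  then have "(\<Sum>i\<in>I. mcoeff (sym_p_part lam) (M - replicate_mset k i)) \<in> \<nat>" for I
    by (induction I rule: infinite_finite_induct) (auto intro: Nats_add)
  then show ?case using add.prems by (simp add: mcoeff_sym_p_mult)
qed (auto simp: mcoeff_one)

lemma mcoeff_sym_p_part_exponents: "mcoeff (sym_p_part (exponents M)) M \<noteq> 0"
proof (induction "exponents M" arbitrary: M)
  case empty
  then have "M = {#}" by (auto simp: exponents_def mset_set_empty_iff)
  then show ?case by (simp add: exponents_def mcoeff_one)
next
  case (add k lam)
  then have "k \<in># exponents M" by (metis union_single_eq_member)
  then obtain i where i: "i \<in># M" "count M i = k" by (auto simp: exponents_def)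
  let ?M = "M - replicate_mset k i"
  let ?I = "{i \<in> set_mset M. k \<le> count M i}"
  have lam: "lam = exponents ?M" using exponents_remove[OF i(1)] i(2) add.hyps(2) by simp
  have k: "k > 0" using i by auto
  have "lam \<in> all_partitions" using lam by simp
  then have "\<forall>j. \<exists>m::nat. mcoeff (sym_p_part lam) (M - replicate_mset k j) = of_nat m"
    using mcoeff_sym_p_part_nat by (auto simp: Nats_def image_iff) 
  then obtain m where m: "\<And>j. mcoeff (sym_p_part lam) (M - replicate_mset k j) = of_nat (m j :: nat)"
    by metis
  have "mcoeff (sym_p_part (exponents M)) M = of_nat (\<Sum>j\<in>?I. m j)"
    by (simp add: add.hyps(2)[symmetric] mcoeff_sym_p_mult[OF k] m)
  moreover have "m i \<noteq> 0"
    using add.hyps(1)[OF lam] m[of i] lam by auto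
  then have "(\<Sum>j\<in>?I. m j) \<noteq> 0"
    using i by auto
  ultimately show ?case by (simp only: of_nat_eq_0_iff not_False_eq_True)
qed

text \<open>Ranking by \<open>- int (r x)\<close> makes the induction insert an element
  \<open>a\<close> of least rank, for which triangularity kills \<open>K a y\<close> at all earlier
  \<open>y\<close>. The equations already solved are not disturbed, and \<open>c a\<close> is free
  to satisfy the remaining one.\<close>

lemma triangular_solvable:
  fixes K :: "'a \<Rightarrow> 'a \<Rightarrow> 'b :: field" and r :: "'a \<Rightarrow> nat"
  assumes "finite S" "\<And>x y. x \<in> S \<Longrightarrow> y \<in> S \<Longrightarrow> K x y \<noteq> 0 \<Longrightarrow> x \<noteq> y \<Longrightarrow> r y < r x"
    "\<And>x. x \<in> S \<Longrightarrow> K x x \<noteq> 0"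
  shows "\<exists>c. \<forall>y\<in>S. (\<Sum>x\<in>S. c x * K x y) = b y"
  using assms
proof (induction S rule: finite_ranking_induct[where f = "\<lambda>x. - int (r x)"])
  case (insert a S)
  show ?case
  proof (cases "a \<in> S")
    case True
    then show ?thesis using insert by (simp add: insert_absorb)
  next
    case False
    from insert obtain c where c: "\<forall>y\<in>S. (\<Sum>x\<in>S. c x * K x y) = b y" by auto
    define d where "d = c(a := (b a - (\<Sum>x\<in>S. c x * K x a)) / K a a)"
    have d: "(\<Sum>x\<in>S. d x * K x y) = (\<Sum>x\<in>S. c x * K x y)" for y
      using False by (intro sum.cong) (auto simp: d_def)
    have "K a y = 0" if "y \<in> S" for y
      using insert.prems(1)[of a y] insert.hyps(2)[OF that] that False by force
    then have "(\<Sum>x\<in>insert a S. d x * K x y) = b y" if "y \<in> insert a S" for y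
      using that insert.hyps(1) False c insert.prems(2)[of a]
      by (auto simp: d) (simp add: d_def)
    then show ?thesis by blast
  qed
qed auto

lemma triangular_injective:
  fixes K :: "'a \<Rightarrow> 'a \<Rightarrow> 'b :: field" and r :: "'a \<Rightarrow> nat"
  assumes "finite S" "\<And>x y. x \<in> S \<Longrightarrow> y \<in> S \<Longrightarrow> K x y \<noteq> 0 \<Longrightarrow> x \<noteq> y \<Longrightarrow> r y < r x"
    "\<And>x. x \<in> S \<Longrightarrow> K x x \<noteq> 0" "\<forall>y\<in>S. (\<Sum>x\<in>S. c x * K x y) = 0"
  shows "\<forall>x\<in>S. c x = 0"
  using assms
proof (induction S rule: finite_ranking_induct[where f = "\<lambda>x. - int (r x)"])
  case (insert a S)
  show ?case
  proof (cases "a \<in> S")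
    case True
    then show ?thesis using insert by (simp add: insert_absorb)
  next
    case False
    have "K a y = 0" if "y \<in> S" for y
      using insert.prems(1)[of a y] insert.hyps(2)[OF that] that False by force
    then have "\<forall>y\<in>S. (\<Sum>x\<in>S. c x * K x y) = 0"
      using insert.prems(3) insert.hyps(1) False by auto
    then have S: "\<forall>x\<in>S. c x = 0" using insert.IH insert.prems by simp
    have "(\<Sum>x\<in>insert a S. c x * K x a) = c a * K a a"
      using insert.hyps(1) False S by simp
    then have "c a = 0" using insert.prems(2,3) by auto
    with S show ?thesis by simp
  qed
qed auto

definition p_series :: "(nat multiset \<Rightarrow> complex) \<Rightarrow> symfun" where
  "p_series c = formal_sum (\<lambda>lam. scale (c lam) (sym_p_part lam)) all_partitions"

lemma mcoeff_sym_p_part_eq_0: "size M \<noteq> \<Sum>\<^sub># lam \<Longrightarrow> mcoeff (sym_p_part lam) M = 0"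
  using homogeneous_sym_p_part[of lam] unfolding homogeneous_def by blast

lemma mcoeff_p_series:
  "mcoeff (p_series c) M = (\<Sum>lam\<in>partitions_of (size M). c lam * mcoeff (sym_p_part lam) M)"
proof -
  have "lam \<in> partitions_of (size M)"
    if "lam \<in> all_partitions" "mcoeff (scale (c lam) (sym_p_part lam)) M \<noteq> 0" for lam
    using that mcoeff_sym_p_part_eq_0[of M lam] by (cases "size M = \<Sum>\<^sub># lam") (simp_all add: partitions_of_iff)
  then show ?thesis
    unfolding p_series_def
    by (subst mcoeff_formal_sum[where J = "partitions_of (size M)"]) (auto simp: partitions_of_iff)
qed

lemma hom_component_p_series:
  "hom_component n (p_series c) = (\<Sum>lam\<in>partitions_of n. scale (c lam) (sym_p_part lam))"
proof (rule symfun_eqI)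
  fix M
  have "mcoeff (sym_p_part lam) M = 0" if "size M \<noteq> n" "lam \<in> partitions_of n" for lam
    using that by (simp add: mcoeff_sym_p_part_eq_0 partitions_of_iff)
  then show "mcoeff (hom_component n (p_series c)) M =
      mcoeff (\<Sum>lam\<in>partitions_of n. scale (c lam) (sym_p_part lam)) M"
    by (simp add: mcoeff_p_series)
qed

lemma agree_upto_p_series:
  "agree_upto N (p_series c) (\<Sum>n\<le>N. \<Sum>lam\<in>partitions_of n. scale (c lam) (sym_p_part lam))"
  unfolding p_series_def
  by (intro agree_upto_formal_sum_partitions) (simp add: mcoeff_sym_p_part_eq_0)

text \<open>Any monomial of the given type would do, by \<open>mcoeff_cong_exponents\<close>; one
  per partition turns the basis question into finite square systems.\<close>

definition monomial_of :: "nat multiset \<Rightarrow> nat multiset" where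
  "monomial_of lam = (SOME M. exponents M = lam)"

lemma exponents_monomial_of: "lam \<in> all_partitions \<Longrightarrow> exponents (monomial_of lam) = lam"
  unfolding monomial_of_def using exponents_surj by (rule someI_ex)

lemma size_monomial_of: "lam \<in> partitions_of n \<Longrightarrow> size (monomial_of lam) = n"
  using sum_mset_exponents[of "monomial_of lam"]
  by (simp add: exponents_monomial_of partitions_of_iff)

lemma monomial_of_triangular:
  assumes "lam \<in> partitions_of n" "mu \<in> partitions_of n"
    "mcoeff (sym_p_part lam) (monomial_of mu) \<noteq> 0" "lam \<noteq> mu"
  shows "size mu < size lam"
proof -
  have ex: "exponents (monomial_of mu) = mu"
    using assms(2) by (simp add: exponents_monomial_of partitions_of_iff)
  have "card (set_mset (monomial_of mu)) < size lam"
    using sym_p_part_leading[OF _ assms(3)] assms(1,4) ex by (simp add: partitions_of_iff)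
  then show ?thesis
    using size_exponents[of "monomial_of mu"] ex by simp
qed

lemma monomial_of_diagonal:
  "lam \<in> partitions_of n \<Longrightarrow> mcoeff (sym_p_part lam) (monomial_of lam) \<noteq> 0"
  using mcoeff_sym_p_part_exponents[of "monomial_of lam"]
  by (simp add: exponents_monomial_of partitions_of_iff)

lemma p_series_surj: "\<exists>c. (\<forall>lam. lam \<notin> all_partitions \<longrightarrow> c lam = 0) \<and> f = p_series c"
proof -
  have "\<forall>n. \<exists>c. \<forall>mu\<in>partitions_of n. (\<Sum>lam\<in>partitions_of n. c lam * mcoeff (sym_p_part lam) (monomial_of mu))
       = mcoeff f (monomial_of mu)"
    by (intro allI triangular_solvable[where r = size] finite_partitions_of monomial_of_diagonal)
      (erule (3) monomial_of_triangular)
  then obtain c where c: "\<And>n. \<forall>mu\<in>partitions_of n. (\<Sum>lam\<in>partitions_of n. c n lam *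
       mcoeff (sym_p_part lam) (monomial_of mu)) = mcoeff f (monomial_of mu)"
    by metis
  \<comment> \<open>The systems are solved degree by degree; each partition takes its coefficient
    from the solution for its own degree.\<close>
  define d where "d lam = (if lam \<in> all_partitions then c (\<Sum>\<^sub># lam) lam else 0)" for lam
  have "f = p_series d"
  proof (rule symfun_eqI)
    fix M :: "nat multiset"
    let ?mu = "exponents M"
    have mu: "?mu \<in> partitions_of (size M)" by (simp add: partitions_of_iff sum_mset_exponents)
    have ex: "exponents M = exponents (monomial_of ?mu)" by (simp add: exponents_monomial_of)
    have "mcoeff f M = mcoeff f (monomial_of ?mu)" using ex by (rule mcoeff_cong_exponents)
    also have "\<dots> = (\<Sum>lam\<in>partitions_of (size M). c (size M) lam * mcoeff (sym_p_part lam) (monomial_of ?mu))"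
      using c mu by simp
    also have "\<dots> = (\<Sum>lam\<in>partitions_of (size M). d lam * mcoeff (sym_p_part lam) M)"
      using mcoeff_cong_exponents[OF ex] by (intro sum.cong) (auto simp: d_def partitions_of_iff)
    finally show "mcoeff f M = mcoeff (p_series d) M" by (simp add: mcoeff_p_series)
  qed
  then show ?thesis by (intro exI[of _ d]) (simp add: d_def)
qed

lemma p_series_inj:
  assumes "p_series c = p_series d" "lam \<in> all_partitions"
  shows "c lam = d lam"
proof -
  let ?n = "\<Sum>\<^sub># lam"
  have "\<forall>lam\<in>partitions_of ?n. c lam - d lam = 0"
  proof (rule triangular_injective[where r = size])
    show "\<forall>mu\<in>partitions_of ?n. (\<Sum>lam\<in>partitions_of ?n. (c lam - d lam) *
        mcoeff (sym_p_part lam) (monomial_of mu)) = 0"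
    proof
      fix mu assume "mu \<in> partitions_of ?n"
      then show "(\<Sum>lam\<in>partitions_of ?n. (c lam - d lam) *
        mcoeff (sym_p_part lam) (monomial_of mu)) = 0"
        using mcoeff_p_series[of c "monomial_of mu"] mcoeff_p_series[of d "monomial_of mu"] assms(1)
        by (simp add: size_monomial_of left_diff_distrib sum_subtractf)
    qed
  qed (simp, erule (3) monomial_of_triangular, erule monomial_of_diagonal)
  then show ?thesis using assms(2) by (auto simp: partitions_of_iff)
qed

text \<open>Makes the description in \<open>p_coeffs\<close> denote. The zeros off
  \<open>all_partitions\<close> secure uniqueness, because those values do not enter the formal
  sum.\<close>

lemma p_coeffs_ex1:
  "\<exists>!c. (\<forall>lam. lam \<notin> all_partitions \<longrightarrow> c lam = 0) \<and>
     f = formal_sum (\<lambda>lam. scale (c lam) (sym_p_part lam)) all_partitions"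
proof -
  obtain c where c: "\<forall>lam. lam \<notin> all_partitions \<longrightarrow> c lam = 0" "f = p_series c"
    using p_series_surj[of f] by blast
  have "d = c" if "\<forall>lam. lam \<notin> all_partitions \<longrightarrow> d lam = 0" "f = p_series d" for d
  proof
    fix lam show "d lam = c lam"
      using that c p_series_inj[of c d lam] by (cases "lam \<in> all_partitions") auto
  qed
  with c show ?thesis unfolding p_series_def[symmetric] by blast
qed

lemma p_coeffs_outside: "lam \<notin> all_partitions \<Longrightarrow> p_coeffs f lam = 0"
  using theI'[OF p_coeffs_ex1[of f]] unfolding p_coeffs_def by blast

lemma p_series_p_coeffs [simp]: "p_series (p_coeffs f) = f"
  using theI'[OF p_coeffs_ex1[of f]] unfolding p_coeffs_def p_series_def by simp

lemma p_coeffs_p_series: "lam \<in> all_partitions \<Longrightarrow> p_coeffs (p_series c) lam = c lam"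
  by (rule p_series_inj) simp_all

section \<open>Cycle indices and plethystic exponentials\<close>

text \<open>The order of the centralizer of a permutation of cycle type \<open>lam\<close>, usually
  written z_lambda.\<close>

definition zee :: "nat multiset \<Rightarrow> complex" where
  "zee lam = (\<Prod>k\<in>#lam. of_nat k) * (\<Prod>i\<in>set_mset lam. fact (count lam i))"

lemma zee_empty [simp]: "zee {#} = 1"
  by (simp add: zee_def)

lemma zee_add_mset: "zee (add_mset k mu) = of_nat k * of_nat (Suc (count mu k)) * zee mu"
proof -
  let ?S = "set_mset mu"
  have "(\<Prod>i\<in>insert k ?S. fact (count (add_mset k mu) i) :: complex)
      = fact (Suc (count mu k)) * (\<Prod>i\<in>?S - {k}. fact (count mu i))"
    by (subst prod.insert_remove) (auto intro!: prod.cong)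
  also have "\<dots> = of_nat (Suc (count mu k)) * (fact (count mu k) * (\<Prod>i\<in>?S - {k}. fact (count mu i)))"
    by simp
  also have "fact (count mu k) * (\<Prod>i\<in>?S - {k}. fact (count mu i)) = (\<Prod>i\<in>?S. fact (count mu i) :: complex)"
    by (cases "k \<in># mu") (simp_all add: prod.remove[of ?S k] not_in_iff)
  finally show ?thesis by (simp add: zee_def)
qed

text \<open>The cycle index of the symmetric group on \<open>m\<close> points, evaluated at \<open>g 1, g 2, \<dots>\<close>.\<close>

definition cycle_index :: "nat \<Rightarrow> (nat \<Rightarrow> symfun) \<Rightarrow> symfun" where
  "cycle_index m g = (\<Sum>lam\<in>partitions_of m. scale (1 / zee lam) (\<Prod>k\<in>#lam. g k))"

lemma cycle_index_0 [simp]: "cycle_index 0 g = 1"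
  by (simp add: cycle_index_def)

lemma cycle_index_1: "cycle_index (Suc 0) g = g (Suc 0)"
  by (simp add: cycle_index_def partitions_of_1 zee_add_mset)

lemma sum_mset_set_mset: "(\<Sum>k\<in>set_mset lam. of_nat (count lam k) * of_nat k) = (of_nat (\<Sum>\<^sub># lam) :: complex)"
proof -
  have "(\<Sum>k\<in>S. of_nat (count lam k) * of_nat k) = (of_nat (\<Sum>\<^sub># lam) :: complex)"
    if "finite S" "set_mset lam \<subseteq> S" for S
    using that(2)
  proof (induction lam)
    case (add x lam)
    have "(\<Sum>k\<in>S. of_nat (count (add_mset x lam) k) * of_nat k)
       = (\<Sum>k\<in>S. (if k = x then of_nat k else 0) + of_nat (count lam k) * (of_nat k :: complex))"
      by (rule sum.cong) (auto simp: algebra_simps)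
    with add that(1) show ?case by (simp add: sum.distrib)
  qed simp
  then show ?thesis by simp
qed

text \<open>Marking a part \<open>k\<close> of \<open>lam\<close> and deleting it leaves a partition
  \<open>mu\<close> of \<open>m - k\<close>, and the weights obey
  \<open>count lam k / zee lam = 1 / (k * zee mu)\<close>. The factor \<open>\<phi> k\<close> is
  left open because it is \<open>k\<close> times \<open>g k\<close> in Newton's identity and
  \<open>euler (g k)\<close> in the derivative.\<close>

lemma cycle_index_recursion:
  "(\<Sum>lam\<in>partitions_of m. scale (1 / zee lam)
      (\<Sum>k\<in>set_mset lam. scale (of_nat (count lam k)) (\<phi> k * (\<Prod>j\<in>#lam - {#k#}. g j))))
   = (\<Sum>k=1..m. scale (1 / of_nat k) (\<phi> k * cycle_index (m - k) g))"
proof -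
  have "(\<Sum>lam\<in>partitions_of m. scale (1 / zee lam)
      (\<Sum>k\<in>set_mset lam. scale (of_nat (count lam k)) (\<phi> k * (\<Prod>j\<in>#lam - {#k#}. g j))))
    = (\<Sum>(lam, k)\<in>Sigma (partitions_of m) set_mset.
        scale (of_nat (count lam k) / zee lam) (\<phi> k * (\<Prod>j\<in>#lam - {#k#}. g j)))"
    by (subst sum.Sigma[symmetric]) (auto simp: scale_sum_right)
  also have "\<dots> = (\<Sum>(k, mu)\<in>Sigma {1..m} (\<lambda>k. partitions_of (m - k)).
        scale (1 / of_nat k / zee mu) (\<phi> k * (\<Prod>j\<in>#mu. g j)))"
  proof (rule sum.reindex_bij_witness[where i = "\<lambda>(k, mu). (add_mset k mu, k)"
        and j = "\<lambda>(lam, k). (k, lam - {#k#})"], goal_cases)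
    case (1 p)
    then show ?case by auto
  next
    case (2 p)
    then obtain lam k where p: "lam \<in> partitions_of m" "k \<in># lam" "p = (lam, k)" by (rule SigmaE)
    obtain mu where "lam = add_mset k mu" using multi_member_split[OF p(2)] by blast
    with p show ?case by (simp add: partitions_of_iff) linarith
  next
    case (3 p)
    then show ?case by (auto simp: case_prod_beta)
  next
    case (4 p)
    then obtain k mu where "k \<in> {1..m}" "mu \<in> partitions_of (m - k)" "p = (k, mu)" by (rule SigmaE)
    then show ?case by (simp add: partitions_of_iff)
  next
    case (5 p)
    then obtain lam k where p: "lam \<in> partitions_of m" "k \<in># lam" "p = (lam, k)" by (rule SigmaE)
    obtain mu where mu: "lam = add_mset k mu" using multi_member_split[OF p(2)] by blast
    have "a / (of_nat k * a * zee mu) = 1 / of_nat k / zee mu" if "a \<noteq> 0" for a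
      using that by simp
    then have "of_nat (Suc (count mu k)) / zee (add_mset k mu) = 1 / of_nat k / zee mu"
      unfolding zee_add_mset using of_nat_neq_0 by blast
    with p mu show ?case by simp
  qed
  also have "\<dots> = (\<Sum>k=1..m. scale (1 / of_nat k) (\<phi> k * cycle_index (m - k) g))"
    by (subst sum.Sigma[symmetric]) (auto simp: cycle_index_def scale_sum_right sum_distrib_left)
  finally show ?thesis .
qed

text \<open>For power sums this is Newton's identity for the complete homogeneous functions. The
  factor \<open>m\<close> is the sum of the parts, and each part \<open>k\<close> contributes
  \<open>k\<close> times its own deletion.\<close>

lemma cycle_index_newton:
  "scale (of_nat m) (cycle_index m g) = (\<Sum>k=1..m. g k * cycle_index (m - k) g)"
proof -
  have key: "scale (of_nat m) (\<Prod>j\<in>#lam. g j)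
      = (\<Sum>k\<in>set_mset lam. scale (of_nat (count lam k)) (scale (of_nat k) (g k) * (\<Prod>j\<in>#lam - {#k#}. g j)))"
    if "lam \<in> partitions_of m" for lam
  proof -
    have "(\<Sum>k\<in>set_mset lam. scale (of_nat (count lam k)) (scale (of_nat k) (g k) * (\<Prod>j\<in>#lam - {#k#}. g j)))
       = (\<Sum>k\<in>set_mset lam. scale (of_nat (count lam k) * of_nat k) (\<Prod>j\<in>#lam. g j))"
      by (rule sum.cong[OF refl]) (metis (no_types, lifting) image_mset_add_mset insert_DiffM prod_mset.add_mset scale_mult_left scale_scale)
    also have "\<dots> = scale (of_nat m) (\<Prod>j\<in>#lam. g j)"
      unfolding scale_sum_left[symmetric] sum_mset_set_mset using that by (simp only: partitions_of_iff)
    finally show ?thesis ..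
  qed
  have "scale (of_nat m) (cycle_index m g) = (\<Sum>lam\<in>partitions_of m. scale (1 / zee lam)
      (\<Sum>k\<in>set_mset lam. scale (of_nat (count lam k)) (scale (of_nat k) (g k) * (\<Prod>j\<in>#lam - {#k#}. g j))))"
    unfolding cycle_index_def scale_sum_right[of "of_nat m"]
  proof (intro sum.cong refl)
    fix lam assume "lam \<in> partitions_of m"
    moreover have "scale (of_nat m) (scale (1 / zee lam) f) = scale (1 / zee lam) (scale (of_nat m) f)" for f
      by (simp add: mult.commute)
    ultimately show "scale (of_nat m) (scale (1 / zee lam) (\<Prod>j\<in>#lam. g j)) = scale (1 / zee lam)
        (\<Sum>k\<in>set_mset lam. scale (of_nat (count lam k)) (scale (of_nat k) (g k) * (\<Prod>j\<in>#lam - {#k#}. g j)))"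
      by (simp only: key)
  qed
  also have "\<dots> = (\<Sum>k=1..m. g k * cycle_index (m - k) g)"
    unfolding cycle_index_recursion by (intro sum.cong) auto
  finally show ?thesis .
qed

lemma euler_cycle_index:
  "euler (cycle_index m g) = (\<Sum>k=1..m. scale (1 / of_nat k) (euler (g k) * cycle_index (m - k) g))"
  unfolding cycle_index_recursion[symmetric] by (simp add: cycle_index_def euler_sum euler_prod_mset)

section \<open>Substitution of k-th powers for the variables\<close>

lemma mcoeff_p_plethysm_repeat [simp]:
  assumes "k > 0"
  shows "mcoeff (p_plethysm k f) (repeat_mset k N) = mcoeff f N"
proof -
  have "(THE N'. repeat_mset k N = repeat_mset k N') = N"
    using assms by (intro the_equality) (auto simp: repeat_mset_cancel1)
  then show ?thesis by (auto simp: p_plethysm.rep_eq)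
qed

lemma mcoeff_p_plethysm_0: "(\<And>N. M \<noteq> repeat_mset k N) \<Longrightarrow> mcoeff (p_plethysm k f) M = 0"
  by (simp add: p_plethysm.rep_eq)

lemma p_plethysm_eqI:
  assumes "k > 0" "\<And>N. mcoeff g (repeat_mset k N) = mcoeff f N"
    "\<And>M. (\<And>N. M \<noteq> repeat_mset k N) \<Longrightarrow> mcoeff g M = 0"
  shows "p_plethysm k f = g"
proof (rule symfun_eqI)
  fix M show "mcoeff (p_plethysm k f) M = mcoeff g M"
    using assms by (cases "\<exists>N. M = repeat_mset k N") (auto simp: mcoeff_p_plethysm_0)
qed

lemma p_plethysm_add: "k > 0 \<Longrightarrow> p_plethysm k (f + g) = p_plethysm k f + p_plethysm k g"
  by (rule p_plethysm_eqI) (auto simp: mcoeff_p_plethysm_0)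

lemma p_plethysm_uminus: "k > 0 \<Longrightarrow> p_plethysm k (- f) = - p_plethysm k f"
  by (rule p_plethysm_eqI) (auto simp: mcoeff_p_plethysm_0)

lemma p_plethysm_diff: "k > 0 \<Longrightarrow> p_plethysm k (f - g) = p_plethysm k f - p_plethysm k g"
  by (rule p_plethysm_eqI) (auto simp: mcoeff_p_plethysm_0)

lemma p_plethysm_scale: "k > 0 \<Longrightarrow> p_plethysm k (scale c f) = scale c (p_plethysm k f)"
  by (rule p_plethysm_eqI) (auto simp: mcoeff_p_plethysm_0)

lemma p_plethysm_sum: "k > 0 \<Longrightarrow> p_plethysm k (\<Sum>i\<in>I. f i) = (\<Sum>i\<in>I. p_plethysm k (f i))"
  by (rule p_plethysm_eqI) (auto simp: mcoeff_p_plethysm_0)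

lemma size_repeat_mset: "size (repeat_mset k N) = k * size N"
  by (induction k) simp_all

lemma p_plethysm_one: "k > 0 \<Longrightarrow> p_plethysm k 1 = 1"
proof (rule p_plethysm_eqI)
  fix M :: "nat multiset" assume "\<And>N. M \<noteq> repeat_mset k N"
  from this[of "{#}"] show "mcoeff 1 M = 0" by (simp add: mcoeff_one)
qed (auto simp: mcoeff_one size_repeat_mset simp flip: size_eq_0_iff_empty)

text \<open>Splittings of \<open>repeat_mset k N\<close> contribute only if both pieces are
  multiples of \<open>k\<close>, and those are exactly the images of the splittings of
  \<open>N\<close>.\<close>

lemma p_plethysm_mult:
  assumes k: "k > 0"
  shows "p_plethysm k (f * g) = p_plethysm k f * p_plethysm k g"
proof (rule p_plethysm_eqI[OF k])
  fix N
  let ?h = "map_prod (repeat_mset k) (repeat_mset k)"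
  have inj: "inj (repeat_mset k :: nat multiset \<Rightarrow> _)"
    using k by (auto simp: inj_on_def repeat_mset_cancel1)
  have "mcoeff (p_plethysm k f * p_plethysm k g) (repeat_mset k N)
     = (\<Sum>(A, B)\<in>?h ` {(A, B). A + B = N}. mcoeff (p_plethysm k f) A * mcoeff (p_plethysm k g) B)"
    unfolding mcoeff_times
  proof (rule sum.mono_neutral_right[OF finite_mset_splits])
    show "?h ` {(A, B). A + B = N} \<subseteq> {(A, B). A + B = repeat_mset k N}"
      by auto
    show "\<forall>p\<in>{(A, B). A + B = repeat_mset k N} - ?h ` {(A, B). A + B = N}.
       (case p of (A, B) \<Rightarrow> mcoeff (p_plethysm k f) A * mcoeff (p_plethysm k g) B) = 0"
    proof
      fix p assume "p \<in> {(A, B). A + B = repeat_mset k N} - ?h ` {(A, B). A + B = N}"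
      then obtain A B where p: "p = (A, B)" "A + B = repeat_mset k N" "(A, B) \<notin> ?h ` {(A, B). A + B = N}"
        by auto
      have False if "A = repeat_mset k A'" "B = repeat_mset k B'" for A' B'
      proof -
        have "repeat_mset k (A' + B') = repeat_mset k N" using p(2) that by simp
        then have "A' + B' = N" using inj by (metis injD)
        then have "(A, B) \<in> ?h ` {(A, B). A + B = N}"
          by (intro image_eqI[of _ _ "(A', B')"]) (auto simp: that)
        with p(3) show False by blast
      qed
      then have "(\<forall>A'. A \<noteq> repeat_mset k A') \<or> (\<forall>B'. B \<noteq> repeat_mset k B')" by blast
      then show "(case p of (A, B) \<Rightarrow> mcoeff (p_plethysm k f) A * mcoeff (p_plethysm k g) B) = 0"
        using p(1) mcoeff_p_plethysm_0[of A k] mcoeff_p_plethysm_0[of B k] by auto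
    qed
  qed
  also have "\<dots> = mcoeff (f * g) N"
    unfolding mcoeff_times using inj_on_subset[OF prod.inj_map[OF inj inj]] k
    by (subst sum.reindex) (auto intro!: sum.cong)
  finally show "mcoeff (p_plethysm k f * p_plethysm k g) (repeat_mset k N) = mcoeff (f * g) N" .
next
  fix M :: "nat multiset" assume M: "\<And>N. M \<noteq> repeat_mset k N"
  have "mcoeff (p_plethysm k f) A * mcoeff (p_plethysm k g) B = 0" if "A + B = M" for A B
  proof (rule ccontr)
    assume *: "mcoeff (p_plethysm k f) A * mcoeff (p_plethysm k g) B \<noteq> 0"
    obtain A' where "A = repeat_mset k A'"
      using * mcoeff_p_plethysm_0[of A k f] by fastforce
    moreover obtain B' where "B = repeat_mset k B'"
      using * mcoeff_p_plethysm_0[of B k g] by fastforce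
    ultimately have "M = repeat_mset k (A' + B')" using that by simp
    with M show False by blast
  qed
  then show "mcoeff (p_plethysm k f * p_plethysm k g) M = 0"
    unfolding mcoeff_times by (intro sum.neutral) auto
qed

lemma p_plethysm_power: "k > 0 \<Longrightarrow> p_plethysm k (f ^ n) = p_plethysm k f ^ n"
  by (induction n) (simp_all add: p_plethysm_one p_plethysm_mult)

lemma replicate_mset_mult: "replicate_mset (k * j) i = repeat_mset k (replicate_mset j i)"
  by (auto simp: multiset_eq_iff)

lemma p_plethysm_sym_p: "k > 0 \<Longrightarrow> p_plethysm k (sym_p j) = sym_p (k * j)"
proof (rule p_plethysm_eqI)
  fix N :: "nat multiset" assume k: "k > 0"
  have "(\<exists>i. repeat_mset k N = replicate_mset (k * j) i) \<longleftrightarrow> (\<exists>i. N = replicate_mset j i)"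
    using k by (simp add: repeat_mset_cancel1 replicate_mset_mult)
  then show "mcoeff (sym_p (k * j)) (repeat_mset k N) = mcoeff (sym_p j) N"
    by (simp add: mcoeff_sym_p)
next
  fix M :: "nat multiset" assume "\<And>N. M \<noteq> repeat_mset k N"
  then show "mcoeff (sym_p (k * j)) M = 0"
    by (auto simp: mcoeff_sym_p replicate_mset_mult)
qed

lemma p_plethysm_p_plethysm:
  assumes "j > 0" "k > 0"
  shows "p_plethysm j (p_plethysm k f) = p_plethysm (j * k) f"
proof (rule p_plethysm_eqI)
  fix N
  show "mcoeff (p_plethysm (j * k) f) (repeat_mset j N) = mcoeff (p_plethysm k f) N"
  proof (cases "\<exists>N'. N = repeat_mset k N'")
    case True
    then obtain N' where "N = repeat_mset k N'" ..
    then show ?thesis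
      using assms mcoeff_p_plethysm_repeat[of "j * k" f N'] by simp
  next
    case False
    have "repeat_mset j N \<noteq> repeat_mset (j * k) N'" for N'
      using False assms by (auto simp: repeat_mset_cancel1 simp flip: repeat_mset_right)
    then show ?thesis using False by (simp add: mcoeff_p_plethysm_0)
  qed
next
  fix M :: "nat multiset" assume "\<And>N. M \<noteq> repeat_mset j N"
  then have "M \<noteq> repeat_mset (j * k) N" for N
    by (simp flip: repeat_mset_right)
  then show "mcoeff (p_plethysm (j * k) f) M = 0" by (rule mcoeff_p_plethysm_0)
qed (use assms in auto)

lemma p_plethysm_Suc_0: "p_plethysm (Suc 0) f = f"
  by (rule p_plethysm_eqI) auto

text \<open>Raising the variables to the power \<open>k\<close> multiplies degrees by
  \<open>k\<close>. This chain-rule factor later cancels the 1/k in the exponent of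
  \<open>pleth_exp\<close>.\<close>

lemma p_plethysm_euler: "k > 0 \<Longrightarrow> euler (p_plethysm k f) = scale (of_nat k) (p_plethysm k (euler f))"
proof (rule symfun_eqI)
  fix M assume "k > 0"
  then show "mcoeff (euler (p_plethysm k f)) M = mcoeff (scale (of_nat k) (p_plethysm k (euler f))) M"
    by (cases "\<exists>N. M = repeat_mset k N") (auto simp: mcoeff_p_plethysm_0 size_repeat_mset)
qed

lemma p_plethysm_hom_component:
  assumes "k > 0"
  shows "hom_component n (p_plethysm k f) =
    (if k dvd n then p_plethysm k (hom_component (n div k) f) else 0)"
proof (rule symfun_eqI)
  fix M
  show "mcoeff (hom_component n (p_plethysm k f)) M =
      mcoeff (if k dvd n then p_plethysm k (hom_component (n div k) f) else 0) M"
    using assms by (cases "\<exists>N. M = repeat_mset k N") (auto simp: mcoeff_p_plethysm_0 size_repeat_mset)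
qed

lemma mcoeff_p_plethysm_empty [simp]: "k > 0 \<Longrightarrow> mcoeff (p_plethysm k f) {#} = mcoeff f {#}"
  using mcoeff_p_plethysm_repeat[of k f "{#}"] by simp

text \<open>A lower bound for the order of a series; such bounds add under products, which limits
  the terms that can reach a given degree.\<close>

definition vanishes_below :: "nat \<Rightarrow> symfun \<Rightarrow> bool" where
  "vanishes_below d f \<longleftrightarrow> (\<forall>M. size M < d \<longrightarrow> mcoeff f M = 0)"

lemma vanishes_below_0 [simp]: "vanishes_below 0 f"
  by (simp add: vanishes_below_def)

lemma vanishes_below_scale: "vanishes_below d f \<Longrightarrow> vanishes_below d (scale c f)"
  by (simp add: vanishes_below_def)

lemma vanishes_below_sum: "(\<And>i. i \<in> I \<Longrightarrow> vanishes_below d (f i)) \<Longrightarrow> vanishes_below d (\<Sum>i\<in>I. f i)"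
  by (simp add: vanishes_below_def)

lemma vanishes_below_mult:
  assumes "vanishes_below d f" "vanishes_below e g"
  shows "vanishes_below (d + e) (f * g)"
  unfolding vanishes_below_def mcoeff_times
proof (intro allI impI sum.neutral ballI, clarify)
  fix A B :: "nat multiset" assume "size (A + B) < d + e"
  then have "size A < d \<or> size B < e" by auto
  with assms show "mcoeff f A * mcoeff g B = 0" by (auto simp: vanishes_below_def)
qed

lemma vanishes_below_prod_mset:
  "(\<And>k. k \<in># lam \<Longrightarrow> vanishes_below k (g k)) \<Longrightarrow> vanishes_below (\<Sum>\<^sub># lam) (\<Prod>k\<in>#lam. g k)"
  by (induction lam) (auto intro: vanishes_below_mult)

lemma vanishes_below_p_plethysm:
  assumes "mcoeff f {#} = 0" "k > 0"
  shows "vanishes_below k (p_plethysm k f)"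
  unfolding vanishes_below_def
proof (intro allI impI)
  fix M :: "nat multiset" assume M: "size M < k"
  show "mcoeff (p_plethysm k f) M = 0"
  proof (cases "\<exists>N. M = repeat_mset k N")
    case True
    then obtain N where N: "M = repeat_mset k N" ..
    with M have "N = {#}" by (auto simp: size_repeat_mset)
    with N assms show ?thesis by simp
  qed (auto simp: mcoeff_p_plethysm_0)
qed

lemma vanishes_below_cycle_index:
  assumes "\<And>k. k > 0 \<Longrightarrow> vanishes_below k (g k)"
  shows "vanishes_below m (cycle_index m g)"
  unfolding cycle_index_def
proof (intro vanishes_below_sum vanishes_below_scale)
  fix lam assume lam: "lam \<in> partitions_of m"
  then show "vanishes_below m (\<Prod>k\<in>#lam. g k)"
    using vanishes_below_prod_mset[of lam g] assms all_partitions_pos by (auto simp: partitions_of_iff)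
qed

text \<open>Applied to \<open>euler f\<close> this is the logarithmic derivative of
  \<open>pleth_exp a f\<close>, which is why it carries no factor 1/k.\<close>

definition pleth_sum :: "(nat \<Rightarrow> complex) \<Rightarrow> symfun \<Rightarrow> symfun" where
  "pleth_sum a f = formal_sum (\<lambda>k. scale (a k) (p_plethysm k f)) {1..}"

text \<open>This is \<open>exp (\<Sum>k. a k / k * p\<^sub>k[f])\<close>; it is \<open>H[f]\<close> for \<open>a k = 1\<close> and \<open>E[f]\<close> for
  \<open>a k = (-1) ^ (k - 1)\<close>.\<close>

definition pleth_exp :: "(nat \<Rightarrow> complex) \<Rightarrow> symfun \<Rightarrow> symfun" where
  "pleth_exp a f = formal_sum (\<lambda>lam. scale (1 / zee lam) (\<Prod>k\<in>#lam. scale (a k) (p_plethysm k f)))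
     all_partitions"

lemma agree_upto_pleth_sum:
  assumes "mcoeff f {#} = 0"
  shows "agree_upto N (pleth_sum a f) (\<Sum>k=1..N. scale (a k) (p_plethysm k f))"
  unfolding agree_upto_def
proof (intro allI impI)
  fix M :: "nat multiset" assume M: "size M \<le> N"
  have "mcoeff (pleth_sum a f) M = (\<Sum>k=1..N. mcoeff (scale (a k) (p_plethysm k f)) M)"
    unfolding pleth_sum_def
  proof (rule mcoeff_formal_sum)
    fix k :: nat assume k: "k \<in> {1..}" "mcoeff (scale (a k) (p_plethysm k f)) M \<noteq> 0"
    then have "\<not> size M < k"
      using vanishes_below_p_plethysm[OF assms, of k] by (auto simp: vanishes_below_def)
    with M k show "k \<in> {1..N}" by simp
  qed auto
  then show "mcoeff (pleth_sum a f) M = mcoeff (\<Sum>k=1..N. scale (a k) (p_plethysm k f)) M"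
    by simp
qed

lemma agree_upto_pleth_exp:
  assumes "mcoeff f {#} = 0"
  shows "agree_upto N (pleth_exp a f) (\<Sum>m\<le>N. cycle_index m (\<lambda>k. scale (a k) (p_plethysm k f)))"
  unfolding pleth_exp_def cycle_index_def
proof (rule agree_upto_formal_sum_partitions)
  fix lam M :: "nat multiset" assume "lam \<in> all_partitions" "size M < \<Sum>\<^sub># lam"
  moreover have "vanishes_below (\<Sum>\<^sub># lam) (\<Prod>k\<in>#lam. scale (a k) (p_plethysm k f))"
    using calculation(1) assms all_partitions_pos
    by (intro vanishes_below_prod_mset vanishes_below_scale vanishes_below_p_plethysm) auto
  ultimately show "mcoeff (scale (1 / zee lam) (\<Prod>k\<in>#lam. scale (a k) (p_plethysm k f))) M = 0"
    by (simp add: vanishes_below_def)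
qed

lemma mcoeff_pleth_exp_empty [simp]: "mcoeff f {#} = 0 \<Longrightarrow> mcoeff (pleth_exp a f) {#} = 1"
  using agree_upto_pleth_exp[of f 0 a] by (simp add: agree_upto_def mcoeff_one)

lemma mcoeff_pleth_sum_empty [simp]: "mcoeff f {#} = 0 \<Longrightarrow> mcoeff (pleth_sum a f) {#} = 0"
  using agree_upto_pleth_sum[of f 0 a] by (simp add: agree_upto_def)

lemma sum_diagonals:
  fixes F :: "nat \<Rightarrow> nat \<Rightarrow> 'a :: comm_monoid_add"
  shows "(\<Sum>m\<le>N. \<Sum>k=1..m. F k (m - k)) = (\<Sum>k=1..N. \<Sum>m\<le>N - k. F k m)"
proof -
  have "(\<Sum>m\<le>N. \<Sum>k=1..m. F k (m - k)) = (\<Sum>(m, k)\<in>Sigma {..N} (\<lambda>m. {1..m}). F k (m - k))"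
    by (rule sum.Sigma) auto
  also have "\<dots> = (\<Sum>(k, m)\<in>Sigma {1..N} (\<lambda>k. {..N - k}). F k m)"
    by (rule sum.reindex_bij_witness[of _ "\<lambda>(k, m). (m + k, k)" "\<lambda>(m, k). (k, m - k)"]) auto
  also have "\<dots> = (\<Sum>k=1..N. \<Sum>m\<le>N - k. F k m)"
    by (rule sum.Sigma[symmetric]) auto
  finally show ?thesis .
qed

lemma euler_pleth_exp:
  assumes f: "mcoeff f {#} = 0"
  shows "euler (pleth_exp a f) = pleth_sum a (euler f) * pleth_exp a f"
proof (rule agree_upto_eqI)
  fix N
  define g where "g k = scale (a k) (p_plethysm k f)" for k
  define G where "G k = scale (a k) (p_plethysm k (euler f))" for k
  have eg: "scale (1 / of_nat k) (euler (g k)) = G k" if "k > 0" for k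
    using that by (simp add: g_def G_def p_plethysm_euler)
  have low: "vanishes_below (k + m) (G k * cycle_index m g)" if "k > 0" for k m
    using that f unfolding G_def g_def
    by (intro vanishes_below_mult vanishes_below_scale vanishes_below_cycle_index vanishes_below_p_plethysm) auto
  have "agree_upto N (euler (pleth_exp a f)) (euler (\<Sum>m\<le>N. cycle_index m g))"
    unfolding g_def using f by (intro agree_upto_euler agree_upto_pleth_exp)
  also have "euler (\<Sum>m\<le>N. cycle_index m g) = (\<Sum>m\<le>N. \<Sum>k=1..m. G k * cycle_index (m - k) g)"
    unfolding euler_sum euler_cycle_index
    by (intro sum.cong refl) (simp add: eg[symmetric])
  also have "\<dots> = (\<Sum>k=1..N. \<Sum>m\<le>N - k. G k * cycle_index m g)"
    by (rule sum_diagonals)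
  \<comment> \<open>The triangle of indices may be filled up to a square, since the additional
    products have order at least \<open>k + m > N\<close>; the double sum then factors.\<close>
  also have "agree_upto N \<dots> (\<Sum>k=1..N. \<Sum>m\<le>N. G k * cycle_index m g)"
  proof (rule agree_upto_sum)
    fix k assume k: "k \<in> {1..N}"
    show "agree_upto N (\<Sum>m\<le>N - k. G k * cycle_index m g) (\<Sum>m\<le>N. G k * cycle_index m g)"
      unfolding agree_upto_def
    proof (intro allI impI)
      fix M :: "nat multiset" assume M: "size M \<le> N"
      have "mcoeff (G k * cycle_index m g) M = 0" if "m \<in> {..N} - {..N - k}" for m
        using low[of k m] that k M by (auto simp: vanishes_below_def)
      then show "mcoeff (\<Sum>m\<le>N - k. G k * cycle_index m g) M = mcoeff (\<Sum>m\<le>N. G k * cycle_index m g) M"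
        unfolding mcoeff_sum by (intro sum.mono_neutral_left) auto
    qed
  qed
  also have "(\<Sum>k=1..N. \<Sum>m\<le>N. G k * cycle_index m g) = (\<Sum>k=1..N. G k) * (\<Sum>m\<le>N. cycle_index m g)"
    by (simp add: sum_product)
  also have "agree_upto N \<dots> (pleth_sum a (euler f) * pleth_exp a f)"
    unfolding g_def G_def using f
    by (intro agree_upto_mult agree_upto_sym[OF agree_upto_pleth_sum] agree_upto_sym[OF agree_upto_pleth_exp]) auto
  finally show "agree_upto N (euler (pleth_exp a f)) (pleth_sum a (euler f) * pleth_exp a f)" .
qed

section \<open>Plethysm with H and E\<close>

lemma formal_sum_cong: "(\<And>i. i \<in> I \<Longrightarrow> f i = g i) \<Longrightarrow> formal_sum f I = formal_sum g I"
  by (rule symfun_eqI) (auto simp: formal_sum.rep_eq intro!: sum.cong)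

lemma mcoeff_H_series: "mcoeff H_series M = 1"
  unfolding H_series_def
  by (subst mcoeff_formal_sum[of "{size M}"]) (auto simp: sym_h.rep_eq split: if_splits)

lemma mcoeff_E_series: "mcoeff E_series M = (if \<forall>i. count M i \<le> 1 then 1 else 0)"
  unfolding E_series_def
  by (subst mcoeff_formal_sum[of "{size M}"]) (auto simp: sym_e.rep_eq split: if_splits)

lemma hom_component_H_series: "hom_component n H_series = sym_h n"
  by (rule symfun_eqI) (simp add: mcoeff_H_series sym_h.rep_eq)

lemma hom_component_E_series: "hom_component n E_series = sym_e n"
  by (rule symfun_eqI) (simp add: mcoeff_E_series sym_e.rep_eq)

lemma mcoeff_sym_p_empty [simp]: "k > 0 \<Longrightarrow> mcoeff (sym_p k) {#} = 0"
  by (auto simp: mcoeff_sym_p)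

lemma euler_sym_p: "euler (sym_p k) = scale (of_nat k) (sym_p k)"
  by (rule symfun_eqI) (auto simp: mcoeff_sym_p)

text \<open>The hypothesis on the coefficients is the Euler equation of the exponential written out
  monomial by monomial, so \<open>euler_unique\<close> identifies the two series.\<close>

lemma pleth_exp_sym_p_eqI:
  assumes "mcoeff f {#} = 1"
    "\<And>M. of_nat (size M) * mcoeff f M = (\<Sum>i\<in>set_mset M. \<Sum>k=1..count M i. a k * mcoeff f (M - replicate_mset k i))"
  shows "pleth_exp a (sym_p 1) = f"
proof -
  have "euler f = pleth_sum a (sym_p 1) * f"
  proof (rule symfun_eqI)
    fix M :: "nat multiset"
    let ?N = "size M"
    have cnt: "count M i \<le> ?N" for i
      by (rule count_le_size)
    have "agree_upto ?N (pleth_sum a (sym_p 1) * f) ((\<Sum>k=1..?N. scale (a k) (p_plethysm k (sym_p 1))) * f)"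
      by (intro agree_upto_mult agree_upto_pleth_sum) auto
    then have "mcoeff (pleth_sum a (sym_p 1) * f) M = mcoeff ((\<Sum>k=1..?N. scale (a k) (p_plethysm k (sym_p 1))) * f) M"
      by (simp add: agree_upto_def)
    also have "\<dots> = (\<Sum>k=1..?N. a k * mcoeff (sym_p k * f) M)"
      by (simp add: sum_distrib_right p_plethysm_sym_p)
    also have "\<dots> = (\<Sum>k=1..?N. \<Sum>i\<in>set_mset M. if k \<le> count M i then a k * mcoeff f (M - replicate_mset k i) else 0)"
      by (intro sum.cong refl) (auto simp: mcoeff_sym_p_mult sum_distrib_left sum.inter_filter intro!: sum.cong)
    also have "\<dots> = (\<Sum>i\<in>set_mset M. \<Sum>k=1..?N. if k \<le> count M i then a k * mcoeff f (M - replicate_mset k i) else 0)"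
      by (rule sum.swap)
    also have "\<dots> = (\<Sum>i\<in>set_mset M. \<Sum>k=1..count M i. a k * mcoeff f (M - replicate_mset k i))"
    proof (rule sum.cong[OF refl])
      fix i
      have "{k \<in> {1..?N}. k \<le> count M i} = {1..count M i}" using cnt[of i] by auto
      then show "(\<Sum>k=1..?N. if k \<le> count M i then a k * mcoeff f (M - replicate_mset k i) else 0)
          = (\<Sum>k=1..count M i. a k * mcoeff f (M - replicate_mset k i))"
        by (simp flip: sum.inter_filter)
    qed
    finally show "mcoeff (euler f) M = mcoeff (pleth_sum a (sym_p 1) * f) M"
      using assms(2)[of M] by simp
  qed
  moreover have "euler (pleth_exp a (sym_p 1)) = pleth_sum a (sym_p 1) * pleth_exp a (sym_p 1)"
    using euler_pleth_exp[of "sym_p 1" a] by (simp add: euler_sym_p)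
  ultimately have "f = pleth_exp a (sym_p 1)"
    by (rule euler_unique) (simp_all add: assms(1))
  then show ?thesis ..
qed

abbreviation sgn_wt :: "nat \<Rightarrow> complex" where
  "sgn_wt k \<equiv> (-1) ^ (k - 1)"

lemma pleth_exp_H: "pleth_exp (\<lambda>_. 1) (sym_p 1) = H_series"
proof (rule pleth_exp_sym_p_eqI)
  fix M :: "nat multiset"
  have "size M = (\<Sum>i\<in>set_mset M. count M i)" by (simp add: size_multiset_overloaded_eq)
  then show "of_nat (size M) * mcoeff H_series M =
      (\<Sum>i\<in>set_mset M. \<Sum>k=1..count M i. 1 * mcoeff H_series (M - replicate_mset k i))"
    by (simp add: mcoeff_H_series)
qed (simp add: mcoeff_H_series)

text \<open>Only the last two values of \<open>k\<close> survive, and they carry opposite signs; for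
  \<open>c = 1\<close> there is just one of them.\<close>

lemma alternating_tail_sum:
  "c > 0 \<Longrightarrow> (\<Sum>k=1..c. (-1) ^ (k - 1) * (if c - k \<le> 1 then 1 else 0)) = (if c = 1 then 1 else (0 :: complex))"
proof (cases c)
  case (Suc d)
  show ?thesis
  proof (cases d)
    case (Suc e)
    have "(\<Sum>k=1..e. (-1) ^ (k - 1) * (if c - k \<le> 1 then 1 else 0)) = (0 :: complex)"
      by (rule sum.neutral) (auto simp: \<open>c = Suc d\<close> Suc)
    then show ?thesis by (simp add: \<open>c = Suc d\<close> Suc)
  qed (simp add: Suc)
qed simp

text \<open>For each variable of \<open>M\<close> the inner sum is 1 or 0 according to whether
  \<open>M\<close> is squarefree, and a squarefree monomial has as many variables as its
  degree.\<close>

lemma pleth_exp_E: "pleth_exp sgn_wt (sym_p 1) = E_series"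
proof (rule pleth_exp_sym_p_eqI)
  fix M :: "nat multiset"
  let ?sf = "\<lambda>M. \<forall>i. count M i \<le> (1 :: nat)"
  have inner: "(\<Sum>k=1..count M i. sgn_wt k * mcoeff E_series (M - replicate_mset k i)) = (if ?sf M then 1 else 0)"
    if i: "i \<in># M" for i
  proof -
    have *: "?sf (M - replicate_mset k i) \<longleftrightarrow> (\<forall>j. j \<noteq> i \<longrightarrow> count M j \<le> 1) \<and> count M i - k \<le> 1"
      if "k \<le> count M i" for k
      by auto
    have "(\<Sum>k=1..count M i. sgn_wt k * mcoeff E_series (M - replicate_mset k i))
       = (\<Sum>k=1..count M i. (if \<forall>j. j \<noteq> i \<longrightarrow> count M j \<le> 1 then 1 else 0) *
            (sgn_wt k * (if count M i - k \<le> 1 then 1 else 0)))"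
    proof (rule sum.cong[OF refl])
      fix k assume "k \<in> {1..count M i}"
      then have "k \<le> count M i" by simp
      show "sgn_wt k * mcoeff E_series (M - replicate_mset k i) = (if \<forall>j. j \<noteq> i \<longrightarrow> count M j \<le> 1 then 1 else 0) *
            (sgn_wt k * (if count M i - k \<le> 1 then 1 else 0))"
        unfolding mcoeff_E_series *[OF \<open>k \<le> count M i\<close>] by auto
    qed
    also have "\<dots> = (if \<forall>j. j \<noteq> i \<longrightarrow> count M j \<le> 1 then 1 else 0) * (if count M i = 1 then 1 else 0)"
      using i by (simp only: sum_distrib_left[symmetric] alternating_tail_sum count_greater_zero_iff)
    also have "\<dots> = (if ?sf M then 1 else 0)"
    proof -
      have "count M i \<ge> 1" using i by simp
      then have "count M i = 1 \<longleftrightarrow> count M i \<le> 1" by linarith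
      then have "?sf M \<longleftrightarrow> (\<forall>j. j \<noteq> i \<longrightarrow> count M j \<le> 1) \<and> count M i = 1" by metis
      then show ?thesis by auto
    qed
    finally show ?thesis .
  qed
  have "of_nat (size M) * mcoeff E_series M = (\<Sum>i\<in>set_mset M. if ?sf M then 1 else 0)"
  proof (cases "?sf M")
    case True
    have "count M i = 1" if "i \<in># M" for i
    proof -
      have "count M i \<le> 1" "count M i > 0" using True that by auto
      then show ?thesis by linarith
    qed
    then have "size M = card (set_mset M)" by (simp add: size_multiset_overloaded_eq)
    with True show ?thesis by (simp add: mcoeff_E_series)
  next
    case False
    then show ?thesis unfolding mcoeff_E_series by (simp only: if_False if_not_P) simp
  qed
  then show "of_nat (size M) * mcoeff E_series M =
      (\<Sum>i\<in>set_mset M. \<Sum>k=1..count M i. sgn_wt k * mcoeff E_series (M - replicate_mset k i))"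
    using inner by simp
qed (simp add: mcoeff_E_series)

lemma p_coeffs_pleth_exp:
  assumes "lam \<in> all_partitions"
  shows "p_coeffs (pleth_exp a (sym_p 1)) lam = (\<Prod>k\<in>#lam. a k) / zee lam"
proof -
  have "scale (1 / zee lam) (\<Prod>k\<in>#lam. scale (a k) (p_plethysm k (sym_p 1)))
     = scale ((\<Prod>k\<in>#lam. a k) / zee lam) (sym_p_part lam)" if "lam \<in> all_partitions" for lam
  proof -
    have "(\<Prod>k\<in>#lam. scale (a k) (p_plethysm k (sym_p 1))) = (\<Prod>k\<in>#lam. scale (a k) (sym_p k))"
      using all_partitions_pos[OF that] by (intro arg_cong[of _ _ prod_mset] image_mset_cong) (simp add: p_plethysm_sym_p)
    then show ?thesis by (simp add: prod_mset_scale sym_p_part_def)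
  qed
  then have "pleth_exp a (sym_p 1) = p_series (\<lambda>lam. (\<Prod>k\<in>#lam. a k) / zee lam)"
    unfolding pleth_exp_def p_series_def by (rule formal_sum_cong)
  with assms show ?thesis by (simp add: p_coeffs_p_series)
qed

lemma plethysm_pleth_exp: "plethysm (pleth_exp a (sym_p 1)) f = pleth_exp a f"
  unfolding plethysm_def pleth_exp_def[of a f]
  by (rule formal_sum_cong) (simp add: p_coeffs_pleth_exp[simplified] prod_mset_scale)

lemma p_coeffs_hom_component:
  "p_coeffs (hom_component n f) lam = (if lam \<in> partitions_of n then p_coeffs f lam else 0)"
proof (cases "lam \<in> all_partitions")
  case True
  let ?c = "\<lambda>lam. if lam \<in> partitions_of n then p_coeffs f lam else 0"
  have "hom_component n f = p_series ?c"
  proof (rule symfun_eqI)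
    fix M
    have "mcoeff (p_series ?c) M = (\<Sum>lam\<in>partitions_of (size M). if size M = n then p_coeffs f lam * mcoeff (sym_p_part lam) M else 0)"
      unfolding mcoeff_p_series by (rule sum.cong) (auto simp: partitions_of_iff)
    also have "\<dots> = mcoeff (hom_component n (p_series (p_coeffs f))) M"
      by (simp only: mcoeff_hom_component mcoeff_p_series split: if_split) simp
    finally show "mcoeff (hom_component n f) M = mcoeff (p_series ?c) M" by simp
  qed
  then show ?thesis using True p_coeffs_p_series[of lam ?c] by simp
qed (simp add: p_coeffs_outside partitions_of_iff)

lemma plethysm_hom_component:
  "plethysm (hom_component n f) g = (\<Sum>lam\<in>partitions_of n. scale (p_coeffs f lam) (\<Prod>k\<in>#lam. p_plethysm k g))"
proof (rule symfun_eqI)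
  fix M
  have "mcoeff (plethysm (hom_component n f) g) M = (\<Sum>lam\<in>partitions_of n.
      mcoeff (scale (p_coeffs (hom_component n f) lam) (\<Prod>k\<in>#lam. p_plethysm k g)) M)"
    unfolding plethysm_def
    by (rule mcoeff_formal_sum) (auto simp: p_coeffs_hom_component partitions_of_iff split: if_splits)
  then show "mcoeff (plethysm (hom_component n f) g) M =
      mcoeff (\<Sum>lam\<in>partitions_of n. scale (p_coeffs f lam) (\<Prod>k\<in>#lam. p_plethysm k g)) M"
    by (simp add: p_coeffs_hom_component)
qed

lemma plethysm_hom_component_pleth_exp:
  "plethysm (hom_component n (pleth_exp a (sym_p 1))) g = cycle_index n (\<lambda>k. scale (a k) (p_plethysm k g))"
  unfolding plethysm_hom_component cycle_index_def
  by (rule sum.cong) (auto simp: p_coeffs_pleth_exp[simplified] prod_mset_scale partitions_of_iff)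

lemma plethysm_H_series: "plethysm H_series f = pleth_exp (\<lambda>_. 1) f"
  using plethysm_pleth_exp[of "\<lambda>_. 1" f] by (simp only: pleth_exp_H)

lemma plethysm_E_series: "plethysm E_series f = pleth_exp sgn_wt f"
  using plethysm_pleth_exp[of sgn_wt f] by (simp only: pleth_exp_E)

text \<open>The common form of \<open>H_part\<close> (weight 1) and \<open>E_part\<close> (weight
  \<open>sgn_wt\<close>), so that later arguments can run with a free weight
  \<open>a\<close>.\<close>

definition part_prod :: "(nat \<Rightarrow> complex) \<Rightarrow> (nat \<Rightarrow> symfun) \<Rightarrow> nat multiset \<Rightarrow> symfun" where
  "part_prod a q lam = (\<Prod>i\<in>set_mset lam. cycle_index (count lam i) (\<lambda>k. scale (a k) (p_plethysm k (q i))))"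

lemma H_part_eq: "H_part lam q = part_prod (\<lambda>_. 1) q lam"
  unfolding H_part_def part_prod_def hom_component_H_series[symmetric] pleth_exp_H[symmetric]
    plethysm_hom_component_pleth_exp ..

lemma E_part_eq: "E_part lam q = part_prod sgn_wt q lam"
  unfolding E_part_def part_prod_def hom_component_E_series[symmetric] pleth_exp_E[symmetric]
    plethysm_hom_component_pleth_exp ..

lemma pleth_sum_uminus:
  assumes "mcoeff f {#} = 0"
  shows "pleth_sum (\<lambda>k. - a k) f = - pleth_sum a f"
  by (rule symfun_eqI) (simp add: pleth_sum_def formal_sum.rep_eq sum_negf)

text \<open>The logarithmic derivatives cancel, so the product has derivative 0 and equals its
  constant term.\<close>

lemma pleth_exp_inverse:
  assumes f: "mcoeff f {#} = 0"
  shows "pleth_exp a f * pleth_exp (\<lambda>k. - a k) f = 1"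
proof (rule euler_unique[of _ 0])
  show "euler (pleth_exp a f * pleth_exp (\<lambda>k. - a k) f) = 0 * (pleth_exp a f * pleth_exp (\<lambda>k. - a k) f)"
    using f by (simp add: euler_mult euler_pleth_exp pleth_sum_uminus algebra_simps)
qed (use f in \<open>auto simp: mcoeff_one\<close>)

lemma p_plethysm_zero: "k > 0 \<Longrightarrow> p_plethysm k 0 = 0"
  using p_plethysm_scale[of k 0 0] by simp

lemma agree_upto_p_plethysm:
  assumes "agree_upto N f g" "k > 0"
  shows "agree_upto N (p_plethysm k f) (p_plethysm k g)"
  unfolding agree_upto_def
proof (intro allI impI)
  fix M :: "nat multiset" assume M: "size M \<le> N"
  show "mcoeff (p_plethysm k f) M = mcoeff (p_plethysm k g) M"
  proof (cases "\<exists>N. M = repeat_mset k N")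
    case True
    then obtain L where L: "M = repeat_mset k L" ..
    have "1 * size L \<le> k * size L" using assms(2) by (intro mult_right_mono) auto
    also have "\<dots> \<le> N" using M L by (simp add: size_repeat_mset)
    finally have "size L \<le> N" by simp
    then show ?thesis using assms L by (simp add: agree_upto_def)
  qed (auto simp: mcoeff_p_plethysm_0)
qed

text \<open>The weights 1 and \<open>sgn_wt\<close> differ by 2 exactly at the even indices, and
  p_(2k)[f] = p_2[p_k[f]].\<close>

lemma pleth_sum_one_sgn:
  assumes f: "mcoeff f {#} = 0"
  shows "pleth_sum (\<lambda>_. 1) f = pleth_sum sgn_wt f + scale 2 (p_plethysm 2 (pleth_sum (\<lambda>_. 1) f))"
proof (rule agree_upto_eqI)
  fix N
  \<comment> \<open>Cutting off at the even bound \<open>2 * n\<close> makes the even indices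
    correspond to \<open>1..n\<close>.\<close>
  have sum_eq: "(\<Sum>k=1..2 * n. scale 1 (p_plethysm k f)) = (\<Sum>k=1..2 * n. scale (sgn_wt k) (p_plethysm k f))
      + scale 2 (p_plethysm 2 (\<Sum>k=1..n. scale 1 (p_plethysm k f)))" for n
  proof (induction n)
    case (Suc n)
    have *: "scale 2 g = g + g" for g
      using scale_add_left[of 1 1 g] by simp
    have "p_plethysm 2 (p_plethysm (Suc n) f) = p_plethysm (2 * n + 2) f"
      by (simp add: p_plethysm_p_plethysm)
    with Suc show ?case by (simp add: p_plethysm_add * algebra_simps)
  qed (simp add: p_plethysm_zero)
  have "agree_upto (2 * N) (pleth_sum (\<lambda>_. 1) f) (\<Sum>k=1..2 * N. scale 1 (p_plethysm k f))"
       "agree_upto (2 * N) (pleth_sum sgn_wt f) (\<Sum>k=1..2 * N. scale (sgn_wt k) (p_plethysm k f))"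
    using f by (rule agree_upto_pleth_sum)+
  moreover have "agree_upto N (p_plethysm 2 (pleth_sum (\<lambda>_. 1) f)) (p_plethysm 2 (\<Sum>k=1..N. scale 1 (p_plethysm k f)))"
    by (intro agree_upto_p_plethysm agree_upto_pleth_sum f) auto
  ultimately show "agree_upto N (pleth_sum (\<lambda>_. 1) f)
      (pleth_sum sgn_wt f + scale 2 (p_plethysm 2 (pleth_sum (\<lambda>_. 1) f)))"
    unfolding agree_upto_def sum_eq by simp
qed

text \<open>In one variable this is 1/(1-x) = (1+x)/(1-x^2). In general the relation between the
  logarithmic derivatives is \<open>pleth_sum_one_sgn\<close>, whose factor 2 is the chain-rule
  factor of p_2.\<close>

lemma H_eq_E_times_pleth2_H:
  assumes f: "mcoeff f {#} = 0"
  shows "pleth_exp (\<lambda>_. 1) f = pleth_exp sgn_wt f * p_plethysm 2 (pleth_exp (\<lambda>_. 1) f)"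
proof (rule euler_unique)
  have ef: "mcoeff (euler f) {#} = 0" by simp
  show "euler (pleth_exp (\<lambda>_. 1) f) = pleth_sum (\<lambda>_. 1) (euler f) * pleth_exp (\<lambda>_. 1) f"
    using f by (rule euler_pleth_exp)
  show "euler (pleth_exp sgn_wt f * p_plethysm 2 (pleth_exp (\<lambda>_. 1) f)) =
      pleth_sum (\<lambda>_. 1) (euler f) * (pleth_exp sgn_wt f * p_plethysm 2 (pleth_exp (\<lambda>_. 1) f))"
    by (subst pleth_sum_one_sgn[OF ef])
      (simp add: euler_mult euler_pleth_exp[OF f] p_plethysm_euler p_plethysm_mult algebra_simps)
  show "mcoeff (pleth_exp (\<lambda>_. 1) f) {#} =
      mcoeff (pleth_exp sgn_wt f * p_plethysm 2 (pleth_exp (\<lambda>_. 1) f)) {#}"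
    using f by simp
  show "mcoeff (pleth_sum (\<lambda>_. 1) (euler f)) {#} = 0"
    using ef by simp
qed

lemma hom_component_agree: "agree_upto N f g \<Longrightarrow> n \<le> N \<Longrightarrow> hom_component n f = hom_component n g"
  by (rule symfun_eqI) (simp add: agree_upto_def)

lemma hom_component_pleth_sum:
  assumes f: "mcoeff f {#} = 0" and j: "j > 0"
  shows "hom_component j (pleth_sum a f) = (\<Sum>k | k dvd j. scale (a k) (p_plethysm k (hom_component (j div k) f)))"
proof -
  have sub: "{k. k dvd j} = {k \<in> {1..j}. k dvd j}"
    using j by (auto simp: dvd_imp_le intro!: Suc_leI gr0I)
  have "hom_component j (pleth_sum a f) = hom_component j (\<Sum>k=1..j. scale (a k) (p_plethysm k f))"
    using agree_upto_pleth_sum[OF f] by (rule hom_component_agree) simp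
  also have "\<dots> = (\<Sum>k=1..j. if k dvd j then scale (a k) (p_plethysm k (hom_component (j div k) f)) else 0)"
    unfolding hom_component_sum by (rule sum.cong) (auto simp: hom_component_scale p_plethysm_hom_component)
  also have "\<dots> = (\<Sum>k | k dvd j. scale (a k) (p_plethysm k (hom_component (j div k) f)))"
    unfolding sub by (rule sum.inter_filter[symmetric]) simp
  finally show ?thesis .
qed

lemma part_prod_superset:
  assumes "finite S" "set_mset lam \<subseteq> S"
  shows "part_prod a q lam = (\<Prod>i\<in>S. cycle_index (count lam i) (\<lambda>k. scale (a k) (p_plethysm k (q i))))"
  unfolding part_prod_def using assms by (intro prod.mono_neutral_left) (auto simp: not_in_iff)

text \<open>Writing \<open>n\<close> as the sum of i m_i, with m_i the multiplicity of the part i,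
  and applying \<open>cycle_index_newton\<close> to the factor of i in the i-th summand deletes
  \<open>k\<close> copies of the part i at a time.\<close>

lemma part_prod_newton:
  assumes "lam \<in> partitions_of n"
  shows "scale (of_nat n) (part_prod a q lam) = (\<Sum>i\<in>set_mset lam. \<Sum>k=1..count lam i.
     scale (of_nat i * a k) (p_plethysm k (q i)) * part_prod a q (lam - replicate_mset k i))"
proof -
  define g where "g i = (\<lambda>k. scale (a k) (p_plethysm k (q i)))" for i
  have "scale (of_nat (count lam i) * of_nat i) (part_prod a q lam) = (\<Sum>k=1..count lam i.
     scale (of_nat i * a k) (p_plethysm k (q i)) * part_prod a q (lam - replicate_mset k i))"
    if i: "i \<in># lam" for i
  proof -
    let ?R = "\<Prod>j\<in>set_mset lam - {i}. cycle_index (count lam j) (g j)"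
    have *: "part_prod a q (lam - replicate_mset k i) = cycle_index (count lam i - k) (g i) * ?R" for k
    proof -
      have "part_prod a q (lam - replicate_mset k i) =
          (\<Prod>j\<in>set_mset lam. cycle_index (count (lam - replicate_mset k i) j) (g j))"
        unfolding g_def by (rule part_prod_superset) (auto dest: in_diffD)
      also have "\<dots> = cycle_index (count lam i - k) (g i) *
          (\<Prod>j\<in>set_mset lam - {i}. cycle_index (count (lam - replicate_mset k i) j) (g j))"
        using i by (subst prod.remove[of _ i]) auto
      also have "(\<Prod>j\<in>set_mset lam - {i}. cycle_index (count (lam - replicate_mset k i) j) (g j)) = ?R"
        by (rule prod.cong) auto
      finally show ?thesis .
    qed
    have "scale (of_nat (count lam i) * of_nat i) (part_prod a q lam)
       = scale (of_nat i) (scale (of_nat (count lam i)) (cycle_index (count lam i) (g i)) * ?R)"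
      using *[of 0] by (simp add: mult.commute)
    also have "\<dots> = (\<Sum>k=1..count lam i.
       scale (of_nat i * a k) (p_plethysm k (q i)) * part_prod a q (lam - replicate_mset k i))"
      unfolding cycle_index_newton * by (simp add: sum_distrib_right scale_sum_right g_def mult.assoc)
    finally show ?thesis .
  qed
  then have "(\<Sum>i\<in>set_mset lam. scale (of_nat (count lam i) * of_nat i) (part_prod a q lam))
     = (\<Sum>i\<in>set_mset lam. \<Sum>k=1..count lam i.
     scale (of_nat i * a k) (p_plethysm k (q i)) * part_prod a q (lam - replicate_mset k i))"
    by (rule sum.cong[OF refl])
  moreover have "(\<Sum>i\<in>set_mset lam. scale (of_nat (count lam i) * of_nat i) (part_prod a q lam))
     = scale (of_nat n) (part_prod a q lam)"
    unfolding scale_sum_left[symmetric] sum_mset_set_mset using assms by (simp only: partitions_of_iff)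
  ultimately show ?thesis by simp
qed

text \<open>Collecting the deletions by the removed degree \<open>j = i * k\<close> turns the
  coefficients into components of a logarithmic derivative. The result is the recursion that the
  components of \<open>pleth_exp\<close> satisfy as well.\<close>

lemma part_prod_sum_newton:
  "scale (of_nat n) (\<Sum>lam\<in>partitions_of n. part_prod a q lam) =
    (\<Sum>j=1..n. (\<Sum>k | k dvd j. scale (a k) (p_plethysm k (scale (of_nat (j div k)) (q (j div k))))) *
       (\<Sum>lam\<in>partitions_of (n - j). part_prod a q lam))"
proof -
  let ?X = "\<lambda>i k. scale (of_nat i * a k) (p_plethysm k (q i))"
  let ?I = "\<lambda>lam. Sigma (set_mset lam) (\<lambda>i. {1..count lam i})"
  let ?J = "Sigma {1..n} (\<lambda>j. {k. k dvd j})"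
  have fin: "finite {k. k dvd j}" if "j \<in> {1..n}" for j using that by simp
  have "scale (of_nat n) (\<Sum>lam\<in>partitions_of n. part_prod a q lam) = (\<Sum>lam\<in>partitions_of n.
      \<Sum>(i, k)\<in>?I lam. ?X i k * part_prod a q (lam - replicate_mset k i))"
    unfolding scale_sum_right by (intro sum.cong refl) (simp add: part_prod_newton sum.Sigma)
  also have "\<dots> = (\<Sum>(lam, i, k)\<in>Sigma (partitions_of n) ?I. ?X i k * part_prod a q (lam - replicate_mset k i))"
    by (subst sum.Sigma) auto
  also have "\<dots> = (\<Sum>((j, k), mu)\<in>Sigma ?J (\<lambda>(j, k). partitions_of (n - j)).
      ?X (j div k) k * part_prod a q mu)"
  proof (rule sum.reindex_bij_witness[where
        i = "\<lambda>((j, k), mu). (mu + replicate_mset k (j div k), j div k, k)"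
        and j = "\<lambda>(lam, i, k). ((i * k, k), lam - replicate_mset k i)"], goal_cases)
    case (1 p)
    then obtain lam i k where p: "p = (lam, i, k)" "lam \<in> partitions_of n" "i \<in># lam" "1 \<le> k" "k \<le> count lam i"
      by (cases p) simp
    then show ?case
      by (auto simp: multiset_eq_iff)
  next
    case (2 p)
    then obtain lam i k where p: "p = (lam, i, k)" "lam \<in> partitions_of n" "i \<in># lam" "1 \<le> k" "k \<le> count lam i"
      by (cases p) simp
    define mu where "mu = lam - replicate_mset k i"
    have lam: "lam = mu + replicate_mset k i"
      using p(5) by (auto simp: mu_def multiset_eq_iff)
    have "lam \<in> all_partitions" "\<Sum>\<^sub># lam = n" using p(2) by (simp_all add: partitions_of_iff)
    then have "mu \<in> all_partitions" "\<Sum>\<^sub># mu + i * k = n" "i > 0"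
      using all_partitions_pos[OF \<open>lam \<in> all_partitions\<close> p(3)] by (simp_all add: lam mult.commute)
    then show ?case using p(4) by (simp add: p(1) mu_def[symmetric] partitions_of_iff)
  next
    case (3 p)
    then obtain j k mu where p: "p = ((j, k), mu)" "1 \<le> j" "j \<le> n" "k dvd j" "mu \<in> partitions_of (n - j)"
      by (cases p) auto
    then show ?case by simp
  next
    case (4 p)
    then obtain j k mu where p: "p = ((j, k), mu)" "1 \<le> j" "j \<le> n" "k dvd j" "mu \<in> partitions_of (n - j)"
      by (cases p) auto
    then obtain i where i: "j = k * i" by (elim dvdE)
    with p have "k > 0" "i > 0" by (auto intro: gr0I)
    moreover have "replicate_mset k i \<in> all_partitions"
      using \<open>i > 0\<close> by (auto simp: all_partitions_def)
    ultimately show ?case using p i by (simp add: partitions_of_iff Suc_le_eq)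
  next
    case (5 p)
    then obtain lam i k where p: "p = (lam, i, k)" "lam \<in> partitions_of n" "i \<in># lam" "1 \<le> k" "k \<le> count lam i"
      by (cases p) simp
    then show ?case by simp
  qed
  also have "\<dots> = (\<Sum>(j, k)\<in>?J. \<Sum>mu\<in>partitions_of (n - j). ?X (j div k) k * part_prod a q mu)"
    by (subst sum.Sigma[symmetric]) (auto simp: case_prod_beta)
  also have "\<dots> = (\<Sum>j=1..n. \<Sum>k | k dvd j. \<Sum>mu\<in>partitions_of (n - j). ?X (j div k) k * part_prod a q mu)"
    by (subst sum.Sigma[symmetric]) auto
  also have "\<dots> = (\<Sum>j=1..n. (\<Sum>k | k dvd j. scale (a k) (p_plethysm k (scale (of_nat (j div k)) (q (j div k))))) *
       (\<Sum>lam\<in>partitions_of (n - j). part_prod a q lam))"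
  proof (rule sum.cong[OF refl])
    fix j assume j: "j \<in> {1..n}"
    have "scale (a k) (p_plethysm k (scale (of_nat (j div k)) (q (j div k)))) = ?X (j div k) k" if "k dvd j" for k
      using that j by (subst p_plethysm_scale) (auto intro!: gr0I simp: mult.commute)
    then show "(\<Sum>k | k dvd j. \<Sum>mu\<in>partitions_of (n - j). ?X (j div k) k * part_prod a q mu) =
      (\<Sum>k | k dvd j. scale (a k) (p_plethysm k (scale (of_nat (j div k)) (q (j div k))))) *
       (\<Sum>lam\<in>partitions_of (n - j). part_prod a q lam)"
      by (simp add: sum_product)
  qed
  finally show ?thesis .
qed

lemma scale_cancel: "c \<noteq> 0 \<Longrightarrow> scale c f = scale c g \<Longrightarrow> f = g"
  by (metis scale_scale scale_one left_inverse)

text \<open>Morally the exponential of \<open>f\<close> is the product of the exponentials of its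
  homogeneous parts. The infinite product is avoided: both sides satisfy the recursion of
  \<open>part_prod_sum_newton\<close>, in which \<open>n\<close> can be divided out.\<close>

lemma hom_component_pleth_exp:
  assumes f: "mcoeff f {#} = 0" and q: "\<And>i. i > 0 \<Longrightarrow> hom_component i f = q i"
  shows "hom_component n (pleth_exp a f) = (\<Sum>lam\<in>partitions_of n. part_prod a q lam)"
proof (induction n rule: less_induct)
  case (less n)
  show ?case
  proof (cases "n = 0")
    case True
    with f show ?thesis by (simp add: hom_component_0 part_prod_def)
  next
    case False
    have "scale (of_nat n) (hom_component n (pleth_exp a f)) = hom_component n (pleth_sum a (euler f) * pleth_exp a f)"
      by (simp add: hom_component_euler flip: euler_pleth_exp[OF f])
    also have "\<dots> = (\<Sum>j=0..n. hom_component j (pleth_sum a (euler f)) * hom_component (n - j) (pleth_exp a f))"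
      by (simp add: hom_component_mult atMost_atLeast0)
    \<comment> \<open>The term \<open>j = 0\<close> drops because the logarithmic derivative has no
      constant term; only components of the exponential of degree below \<open>n\<close>
      remain.\<close>
    also have "\<dots> = (\<Sum>j=1..n. hom_component j (pleth_sum a (euler f)) * hom_component (n - j) (pleth_exp a f))"
      by (subst sum.atLeast_Suc_atMost) (auto simp: hom_component_0)
    also have "\<dots> = (\<Sum>j=1..n. (\<Sum>k | k dvd j. scale (a k) (p_plethysm k (scale (of_nat (j div k)) (q (j div k))))) *
       (\<Sum>lam\<in>partitions_of (n - j). part_prod a q lam))"
    proof (intro sum.cong refl arg_cong2[of _ _ _ _ "(*)"])
      fix j assume j: "j \<in> {1..n}"
      then show "hom_component (n - j) (pleth_exp a f) = (\<Sum>lam\<in>partitions_of (n - j). part_prod a q lam)"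
        by (intro less) auto
      have "hom_component (j div k) (euler f) = scale (of_nat (j div k)) (q (j div k))" if "k dvd j" for k
        using that j by (subst hom_component_euler, subst q) (auto intro!: gr0I dest: dvd_div_eq_0_iff)
      then show "hom_component j (pleth_sum a (euler f)) =
          (\<Sum>k | k dvd j. scale (a k) (p_plethysm k (scale (of_nat (j div k)) (q (j div k)))))"
        using j by (subst hom_component_pleth_sum) auto
    qed
    also have "\<dots> = scale (of_nat n) (\<Sum>lam\<in>partitions_of n. part_prod a q lam)"
      by (rule part_prod_sum_newton[symmetric])
    finally show ?thesis using False scale_cancel[of "of_nat n"] by simp
  qed
qed

section \<open>The involution\<close>

definition cont_linear :: "(symfun \<Rightarrow> symfun) \<Rightarrow> bool" where
  "cont_linear w \<longleftrightarrow> (\<forall>f g. w (f + g) = w f + w g) \<and> (\<forall>c f. w (scale c f) = scale c (w f)) \<and>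
     (\<forall>N f g. agree_upto N f g \<longrightarrow> agree_upto N (w f) (w g))"

lemma cont_linearD:
  assumes "cont_linear w"
  shows "w (f + g) = w f + w g" "w (scale c f) = scale c (w f)"
    "agree_upto N f g \<Longrightarrow> agree_upto N (w f) (w g)" "w 0 = 0" "w (- f) = - w f"
proof -
  show *: "w (f + g) = w f + w g" "w (scale c f) = scale c (w f)"
    "agree_upto N f g \<Longrightarrow> agree_upto N (w f) (w g)" for f c
    using assms by (simp_all add: cont_linear_def)
  show "w 0 = 0" using *(2)[of 0 0] by simp
  show "w (- f) = - w f" using *(2)[of "- 1" f] by simp
qed

lemma cont_linear_sum: "cont_linear w \<Longrightarrow> w (\<Sum>i\<in>I. f i) = (\<Sum>i\<in>I. w (f i))"
  by (induction I rule: infinite_finite_induct) (simp_all add: cont_linearD)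

lemma cont_linear_eqI:
  assumes v: "cont_linear v" and w: "cont_linear w"
    and eq: "\<And>lam. lam \<in> all_partitions \<Longrightarrow> v (sym_p_part lam) = w (sym_p_part lam)"
  shows "v f = w f"
proof (rule agree_upto_eqI)
  fix N
  let ?g = "\<Sum>n\<le>N. \<Sum>lam\<in>partitions_of n. scale (p_coeffs f lam) (sym_p_part lam)"
  have g: "agree_upto N f ?g" using agree_upto_p_series[of N "p_coeffs f"] by simp
  have "agree_upto N (v f) (v ?g)" using v g by (rule cont_linearD)
  also have "v ?g = w ?g"
    unfolding cont_linear_sum[OF v] cont_linear_sum[OF w] cont_linearD(2)[OF v] cont_linearD(2)[OF w]
    by (intro sum.cong refl arg_cong2[of _ _ _ _ scale] eq) (simp add: partitions_of_iff)
  also have "agree_upto N (w ?g) (w f)" using w agree_upto_sym[OF g] by (rule cont_linearD)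
  finally show "agree_upto N (v f) (w f)" .
qed

definition cont_hom :: "(symfun \<Rightarrow> symfun) \<Rightarrow> bool" where
  "cont_hom w \<longleftrightarrow> cont_linear w \<and> w 1 = 1 \<and> (\<forall>f g. w (f * g) = w f * w g)"

lemma cont_homD:
  assumes "cont_hom w"
  shows "cont_linear w" "w 1 = 1" "w (f * g) = w f * w g"
  using assms by (auto simp: cont_hom_def)

lemma cont_hom_prod_mset: "cont_hom w \<Longrightarrow> w (\<Prod>k\<in>#lam. g k) = (\<Prod>k\<in>#lam. w (g k))"
  by (induction lam) (simp_all add: cont_homD)

lemma cont_hom_sym_p_part:
  "cont_hom w \<Longrightarrow> w (sym_p_part lam) = (\<Prod>k\<in>#lam. w (sym_p k))"
  unfolding sym_p_part_def by (rule cont_hom_prod_mset)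

lemma cont_linear_comp: "cont_linear v \<Longrightarrow> cont_linear w \<Longrightarrow> cont_linear (\<lambda>f. v (w f))"
  by (simp add: cont_linear_def)

lemma cont_hom_comp: "cont_hom v \<Longrightarrow> cont_hom w \<Longrightarrow> cont_hom (\<lambda>f. v (w f))"
  by (simp add: cont_hom_def cont_linear_comp)

lemma cont_hom_eqI:
  assumes "cont_hom v" "cont_hom w" "\<And>k. k > 0 \<Longrightarrow> v (sym_p k) = w (sym_p k)"
  shows "v f = w f"
proof (rule cont_linear_eqI[where v = v and w = w])
  fix lam assume "lam \<in> all_partitions"
  then show "v (sym_p_part lam) = w (sym_p_part lam)"
    unfolding cont_hom_sym_p_part[OF assms(1)] cont_hom_sym_p_part[OF assms(2)]
    by (intro arg_cong[of _ _ prod_mset] image_mset_cong assms(3)) (rule all_partitions_pos)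
qed (use assms cont_homD in auto)

lemma cycle_index_cong: "(\<And>k. k > 0 \<Longrightarrow> f k = g k) \<Longrightarrow> cycle_index m f = cycle_index m g"
  unfolding cycle_index_def
proof (rule sum.cong[OF refl])
  fix lam assume "\<And>k. k > 0 \<Longrightarrow> f k = g k" "lam \<in> partitions_of m"
  then have "(\<Prod>k\<in>#lam. f k) = (\<Prod>k\<in>#lam. g k)"
    by (intro arg_cong[of _ _ prod_mset] image_mset_cong) (metis all_partitions_pos partitions_of_iff)
  then show "scale (1 / zee lam) (\<Prod>k\<in>#lam. f k) = scale (1 / zee lam) (\<Prod>k\<in>#lam. g k)"
    by simp
qed

lemma cont_hom_cycle_index: "cont_hom w \<Longrightarrow> w (cycle_index m g) = cycle_index m (\<lambda>k. w (g k))"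
  unfolding cycle_index_def
  by (simp add: cont_linear_sum cont_homD(1) cont_linearD(2) cont_hom_prod_mset)

text \<open>Only the product of weight and plethysm enters the exponential; allowing two weights
  lets a sign pass from the argument to the weight.\<close>

lemma cont_hom_pleth_exp:
  assumes w: "cont_hom w" and f: "mcoeff f {#} = 0" and g: "mcoeff g {#} = 0"
    and eq: "\<And>k. k > 0 \<Longrightarrow> scale (a k) (w (p_plethysm k f)) = scale (b k) (p_plethysm k g)"
  shows "w (pleth_exp a f) = pleth_exp b g"
proof (rule agree_upto_eqI)
  fix N
  note wl = cont_homD(1)[OF w]
  have "agree_upto N (w (pleth_exp a f)) (w (\<Sum>m\<le>N. cycle_index m (\<lambda>k. scale (a k) (p_plethysm k f))))"
    by (intro cont_linearD(3)[OF wl] agree_upto_pleth_exp f)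
  also have "w (\<Sum>m\<le>N. cycle_index m (\<lambda>k. scale (a k) (p_plethysm k f)))
     = (\<Sum>m\<le>N. cycle_index m (\<lambda>k. scale (b k) (p_plethysm k g)))"
    unfolding cont_linear_sum[OF wl] cont_hom_cycle_index[OF w] cont_linearD(2)[OF wl]
    using eq by (intro sum.cong refl cycle_index_cong)
  also have "agree_upto N \<dots> (pleth_exp b g)"
    by (intro agree_upto_sym[OF agree_upto_pleth_exp] g)
  finally show "agree_upto N (w (pleth_exp a f)) (pleth_exp b g)" .
qed

lemma cont_hom_p_plethysm: "k > 0 \<Longrightarrow> cont_hom (p_plethysm k)"
  by (simp add: cont_hom_def cont_linear_def p_plethysm_add p_plethysm_scale p_plethysm_mult
      p_plethysm_one agree_upto_p_plethysm)

lemma p_coeffs_p_series_eq: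
  "(\<And>lam. lam \<notin> all_partitions \<Longrightarrow> c lam = 0) \<Longrightarrow> p_coeffs (p_series c) = c"
  by (rule ext) (metis p_coeffs_p_series p_coeffs_outside)

lemma p_coeffs_add: "p_coeffs (f + g) lam = p_coeffs f lam + p_coeffs g lam"
proof -
  have "f + g = p_series (\<lambda>lam. p_coeffs f lam + p_coeffs g lam)"
    by (rule symfun_eqI, subst (1 2) p_series_p_coeffs[symmetric])
       (simp only: mcoeff_add mcoeff_p_series sum.distrib distrib_right)
  then have "p_coeffs (f + g) = (\<lambda>lam. p_coeffs f lam + p_coeffs g lam)"
    by (simp add: p_coeffs_p_series_eq p_coeffs_outside)
  then show ?thesis by simp
qed

lemma p_coeffs_scale: "p_coeffs (scale c f) lam = c * p_coeffs f lam"
proof -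
  have "scale c f = p_series (\<lambda>lam. c * p_coeffs f lam)"
    by (rule symfun_eqI, subst (1) p_series_p_coeffs[symmetric])
       (simp only: mcoeff_scale mcoeff_p_series sum_distrib_left mult.assoc)
  then have "p_coeffs (scale c f) = (\<lambda>lam. c * p_coeffs f lam)"
    by (simp add: p_coeffs_p_series_eq p_coeffs_outside)
  then show ?thesis by simp
qed

lemma p_coeffs_agree:
  assumes "agree_upto N f g" "\<Sum>\<^sub># lam \<le> N"
  shows "p_coeffs f lam = p_coeffs g lam"
proof (cases "lam \<in> all_partitions")
  case True
  then have "lam \<in> partitions_of (\<Sum>\<^sub># lam)" by (simp add: partitions_of_iff)
  then show ?thesis
    using p_coeffs_hom_component[of "\<Sum>\<^sub># lam" f lam] p_coeffs_hom_component[of "\<Sum>\<^sub># lam" g lam]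
      hom_component_agree[OF assms] by simp
qed (simp add: p_coeffs_outside)

lemma p_coeffs_sym_p_part:
  assumes "lam \<in> all_partitions"
  shows "p_coeffs (sym_p_part lam) = (\<lambda>mu. if mu = lam then 1 else 0)"
proof -
  have "p_series (\<lambda>mu. if mu = lam then 1 else 0) = sym_p_part lam"
  proof (rule symfun_eqI)
    fix M
    have "mcoeff (p_series (\<lambda>mu. if mu = lam then 1 else 0)) M
       = (\<Sum>mu\<in>partitions_of (size M). if mu = lam then mcoeff (sym_p_part mu) M else 0)"
      unfolding mcoeff_p_series by (rule sum.cong) auto
    also have "\<dots> = mcoeff (sym_p_part lam) M"
      using assms mcoeff_sym_p_part_eq_0[of M lam] by (auto simp: partitions_of_iff)
    finally show "mcoeff (p_series (\<lambda>mu. if mu = lam then 1 else 0)) M = mcoeff (sym_p_part lam) M" .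
  qed
  then show ?thesis
    using p_coeffs_p_series_eq[of "\<lambda>mu. if mu = lam then 1 else 0"] assms by fastforce
qed

text \<open>The continuous algebra endomorphism sending each \<open>p\<^sub>k\<close> to \<open>- p\<^sub>k\<close>. It differs from \<open>omega\<close>
  by the sign \<open>(-1) ^ n\<close> in degree \<open>n\<close>, but unlike \<open>omega\<close> it commutes with \<open>p_plethysm\<close>.\<close>

definition p_negate :: "symfun \<Rightarrow> symfun" where
  "p_negate f = p_series (\<lambda>lam. (-1) ^ size lam * p_coeffs f lam)"

lemma cont_linear_p_negate: "cont_linear p_negate"
  unfolding cont_linear_def
proof (intro conjI allI impI)
  fix f g :: symfun and c N
  show "p_negate (f + g) = p_negate f + p_negate g"
    by (rule symfun_eqI) (simp add: p_negate_def mcoeff_p_series p_coeffs_add sum.distrib algebra_simps)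
  show "p_negate (scale c f) = scale c (p_negate f)"
    by (rule symfun_eqI) (simp add: p_negate_def mcoeff_p_series p_coeffs_scale sum_distrib_left algebra_simps)
  assume "agree_upto N f g"
  then show "agree_upto N (p_negate f) (p_negate g)"
    unfolding agree_upto_def[of N "p_negate f"]
    by (auto simp: p_negate_def mcoeff_p_series partitions_of_iff p_coeffs_agree intro!: sum.cong)
qed

lemma p_negate_sym_p_part:
  assumes "lam \<in> all_partitions"
  shows "p_negate (sym_p_part lam) = scale ((-1) ^ size lam) (sym_p_part lam)"
proof -
  have "p_negate (sym_p_part lam) = p_series (p_coeffs (scale ((-1) ^ size lam) (sym_p_part lam)))"
    unfolding p_negate_def by (rule arg_cong[of _ _ p_series]) (auto simp: p_coeffs_scale p_coeffs_sym_p_part[OF assms])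
  then show ?thesis by simp
qed

lemma p_negate_sym_p: "k > 0 \<Longrightarrow> p_negate (sym_p k) = - sym_p k"
  using p_negate_sym_p_part[of "{#k#}"] by simp

lemma cont_linear_mult_right: "cont_linear (\<lambda>f. f * g)"
  by (simp add: cont_linear_def algebra_simps agree_upto_mult)

lemma cont_linear_mult_left: "cont_linear (\<lambda>f. g * f)"
  by (simp add: cont_linear_def algebra_simps agree_upto_mult)

text \<open>Both sides are continuous and linear in each variable separately, so first
  \<open>f\<close> and then \<open>g\<close> may be taken to be a power sum product, where the signs
  multiply.\<close>

lemma p_negate_mult: "p_negate (f * g) = p_negate f * p_negate g"
proof (rule cont_linear_eqI[of "\<lambda>f. p_negate (f * g)" "\<lambda>f. p_negate f * p_negate g"])
  show "cont_linear (\<lambda>f. p_negate (f * g))"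
    by (intro cont_linear_comp[OF cont_linear_p_negate] cont_linear_mult_right)
  show "cont_linear (\<lambda>f. p_negate f * p_negate g)"
    by (intro cont_linear_comp[OF cont_linear_mult_right] cont_linear_p_negate)
  fix lam assume lam: "lam \<in> all_partitions"
  show "p_negate (sym_p_part lam * g) = p_negate (sym_p_part lam) * p_negate g"
  proof (rule cont_linear_eqI[of "\<lambda>g. p_negate (sym_p_part lam * g)" "\<lambda>g. p_negate (sym_p_part lam) * p_negate g"])
    show "cont_linear (\<lambda>g. p_negate (sym_p_part lam * g))"
      by (intro cont_linear_comp[OF cont_linear_p_negate] cont_linear_mult_left)
    show "cont_linear (\<lambda>g. p_negate (sym_p_part lam) * p_negate g)"
      by (intro cont_linear_comp[OF cont_linear_mult_left] cont_linear_p_negate)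
    fix mu assume mu: "mu \<in> all_partitions"
    then have "p_negate (sym_p_part (lam + mu)) = p_negate (sym_p_part lam) * p_negate (sym_p_part mu)"
      using lam by (subst p_negate_sym_p_part) (simp_all add: p_negate_sym_p_part power_add mult.commute)
    then show "p_negate (sym_p_part lam * sym_p_part mu) = p_negate (sym_p_part lam) * p_negate (sym_p_part mu)"
      by simp
  qed
qed

lemma cont_hom_p_negate: "cont_hom p_negate"
  using p_negate_sym_p_part[of "{#}"] by (simp add: cont_hom_def cont_linear_p_negate p_negate_mult)

lemma p_negate_involution [simp]: "p_negate (p_negate f) = f"
proof -
  have "cont_hom (\<lambda>f. f)" by (simp add: cont_hom_def cont_linear_def)
  moreover have "cont_hom (\<lambda>f. p_negate (p_negate f))" by (rule cont_hom_comp[OF cont_hom_p_negate cont_hom_p_negate])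
  ultimately show ?thesis
    by (rule cont_hom_eqI[symmetric]) (simp add: p_negate_sym_p cont_linearD[OF cont_linear_p_negate])
qed

text \<open>Both composites are continuous homomorphisms sending p_j to -p_(kj).\<close>

lemma p_negate_p_plethysm: "k > 0 \<Longrightarrow> p_negate (p_plethysm k f) = p_plethysm k (p_negate f)"
  by (rule cont_hom_eqI[of "\<lambda>f. p_negate (p_plethysm k f)" "\<lambda>f. p_plethysm k (p_negate f)"])
    (simp_all add: cont_hom_comp cont_hom_p_negate cont_hom_p_plethysm p_plethysm_sym_p p_negate_sym_p p_plethysm_uminus)

lemma hom_component_p_negate: "hom_component n (p_negate f) = p_negate (hom_component n f)"
proof (rule symfun_eqI)
  fix M :: "nat multiset"
  have "p_coeffs (hom_component n f) lam = (if size M = n then p_coeffs f lam else 0)" 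
    if "lam \<in> partitions_of (size M)" for lam
    using that by (simp add: p_coeffs_hom_component partitions_of_iff)
  then show "mcoeff (hom_component n (p_negate f)) M = mcoeff (p_negate (hom_component n f)) M"
    by (auto simp: p_negate_def mcoeff_p_series intro!: sum.cong sum.neutral)
qed

lemma mcoeff_p_negate_empty [simp]: "mcoeff (p_negate f) {#} = mcoeff f {#}"
proof -
  have "agree_upto 0 f (scale (mcoeff f {#}) 1)"
    by (simp add: agree_upto_def mcoeff_one)
  then have "agree_upto 0 (p_negate f) (p_negate (scale (mcoeff f {#}) 1))"
    by (rule cont_linearD(3)[OF cont_linear_p_negate])
  then show ?thesis
    by (simp add: agree_upto_def cont_linearD[OF cont_linear_p_negate] cont_homD[OF cont_hom_p_negate] mcoeff_one)
qed

text \<open>Plethysm by p_k commutes with negation and with \<open>p_negate\<close>, so the outer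
  minus sign can be moved into the weight.\<close>

lemma pleth_exp_p_negate:
  assumes "mcoeff f {#} = 0"
  shows "pleth_exp a (- p_negate f) = p_negate (pleth_exp (\<lambda>k. - a k) f)"
  using assms
  by (intro cont_hom_pleth_exp[symmetric] cont_hom_p_negate)
    (simp_all add: p_negate_p_plethysm p_plethysm_uminus)

text \<open>Substitution of -x_i for every variable x_i.\<close>

lift_definition degree_sign :: "symfun \<Rightarrow> symfun" is "\<lambda>f M. (-1) ^ size M * f M" by simp

lemma mcoeff_degree_sign [simp]: "mcoeff (degree_sign f) M = (-1) ^ size M * mcoeff f M"
  by (simp add: degree_sign.rep_eq)

lemma degree_sign_homogeneous: "homogeneous n f \<Longrightarrow> degree_sign f = scale ((-1) ^ n) f"
  by (rule symfun_eqI) (auto simp: homogeneous_def)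

lemma cont_hom_degree_sign: "cont_hom degree_sign"
  unfolding cont_hom_def cont_linear_def
proof (intro conjI allI impI)
  fix f g
  show "degree_sign (f * g) = degree_sign f * degree_sign g"
    by (rule symfun_eqI) (auto simp: mcoeff_times sum_distrib_left power_add intro!: sum.cong)
qed (auto intro!: symfun_eqI simp: agree_upto_def mcoeff_one algebra_simps)

lemma sym_h_eq_cycle_index: "sym_h n = cycle_index n sym_p"
  unfolding hom_component_H_series[symmetric] pleth_exp_H[symmetric] cycle_index_def
  by (subst p_series_p_coeffs[symmetric], subst hom_component_p_series)
    (auto simp: p_coeffs_pleth_exp[simplified] partitions_of_iff sym_p_part_def intro!: sum.cong)

lemma sym_e_eq_cycle_index: "sym_e n = cycle_index n (\<lambda>k. scale (sgn_wt k) (sym_p k))"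
  unfolding hom_component_E_series[symmetric] pleth_exp_E[symmetric] cycle_index_def
  by (subst p_series_p_coeffs[symmetric], subst hom_component_p_series)
    (auto simp: p_coeffs_pleth_exp[simplified] partitions_of_iff sym_p_part_def prod_mset_scale intro!: sum.cong)

text \<open>The composite sends p_k to (-1)^(k-1) p_k and therefore, by the cycle index formulas,
  h_n to e_n. It is the only candidate: a map with the described properties is continuous and has
  prescribed values on all p_k.\<close>

lemma omega_eq: "omega f = degree_sign (p_negate f)"
proof -
  let ?P = "\<lambda>w. w 1 = 1 \<and>
     (\<forall>f g. w (f + g) = w f + w g) \<and>
     (\<forall>f g. w (f * g) = w f * w g) \<and>
     (\<forall>c f. w (scale c f) = scale c (w f)) \<and>
     (\<forall>n. w (sym_h n) = sym_e n) \<and>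
     (\<forall>n f. w (hom_component n f) = hom_component n (w f))"
  let ?w = "\<lambda>f. degree_sign (p_negate f)"
  have hom: "cont_hom ?w" by (rule cont_hom_comp[OF cont_hom_degree_sign cont_hom_p_negate])
  have P: "?P ?w"
  proof (intro conjI allI)
    fix n f
    have "?w (sym_h n) = cycle_index n (\<lambda>k. ?w (sym_p k))"
      unfolding sym_h_eq_cycle_index by (rule cont_hom_cycle_index[OF hom])
    also have "\<dots> = sym_e n"
      unfolding sym_e_eq_cycle_index
    proof (rule cycle_index_cong)
      fix k :: nat assume "k > 0"
      then have "- ((-1) ^ k) = (sgn_wt k :: complex)" by (cases k) auto
      then show "?w (sym_p k) = scale (sgn_wt k) (sym_p k)"
        using \<open>k > 0\<close> by (simp add: p_negate_sym_p degree_sign_homogeneous[of k] homogeneous_uminus flip: scale_minus_left)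
    qed
    finally show "?w (sym_h n) = sym_e n" .
    show "?w (hom_component n f) = hom_component n (?w f)"
      by (rule symfun_eqI) (simp flip: hom_component_p_negate)
  qed (simp_all add: cont_homD[OF cont_hom_p_negate] cont_homD[OF cont_hom_degree_sign]
      cont_linearD[OF cont_linear_p_negate] cont_linearD[OF cont_homD(1)[OF cont_hom_degree_sign]])
  moreover have "w = ?w" if w: "?P w" for w
  proof
    fix f
    \<comment> \<open>Compatibility with \<open>hom_component\<close> is what yields
      continuity.\<close>
    have "agree_upto N (w f) (w g)" if "agree_upto N f g" for N f g
      unfolding agree_upto_def
    proof (intro allI impI)
      fix M :: "nat multiset" assume "size M \<le> N"
      then have "hom_component (size M) f = hom_component (size M) g"
        by (rule hom_component_agree[OF that])
      then have "hom_component (size M) (w f) = hom_component (size M) (w g)"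
        using w by metis
      then show "mcoeff (w f) M = mcoeff (w g) M"
        by (metis mcoeff_hom_component)
    qed
    then have w': "cont_hom w" using w by (auto simp: cont_hom_def cont_linear_def)
    have "w (sym_p k) = ?w (sym_p k)" if "k > 0" for k
      using that
    proof (induction k rule: less_induct)
      case (less n)
      \<comment> \<open>Newton's identity can be solved for p_n, whose coefficient is h_0 = 1;
        inductively, the values on the h_k determine the value on p_n.\<close>
      have "scale (of_nat n) (sym_h n) = (\<Sum>k=1..n. sym_p k * sym_h (n - k))"
        unfolding sym_h_eq_cycle_index by (rule cycle_index_newton)
      also have "{1..n} = insert n {1..<n}" using less.prems by auto
      also have "(\<Sum>k\<in>\<dots>. sym_p k * sym_h (n - k)) = sym_p n + (\<Sum>k=1..<n. sym_p k * sym_h (n - k))"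
        by (simp add: sym_h_eq_cycle_index)
      finally have p: "sym_p n = scale (of_nat n) (sym_h n) + - (\<Sum>k=1..<n. sym_p k * sym_h (n - k))"
        by simp
      have "v (sym_p n) = scale (of_nat n) (sym_e n) + - (\<Sum>k=1..<n. v (sym_p k) * sym_e (n - k))"
        if v: "cont_hom v" "\<forall>n. v (sym_h n) = sym_e n" for v
        by (subst p) (simp only: cont_linearD[OF cont_homD(1)[OF v(1)]] cont_homD(3)[OF v(1)]
            cont_linear_sum[OF cont_homD(1)[OF v(1)]] v(2)[rule_format])
      from this[OF w'] this[OF hom] w P show ?case
        using less.IH by simp
    qed
    then show "w f = ?w f" by (rule cont_hom_eqI[OF w' hom])
  qed
  ultimately have "(THE w. ?P w) = ?w" by (rule the_equality)
  then show ?thesis unfolding omega_def by metis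
qed

section \<open>Equivalence of the identities\<close>

lemma hom_component_formal_sum:
  assumes "\<And>i. i \<ge> 1 \<Longrightarrow> homogeneous i (q i)"
  shows "hom_component n (formal_sum q {1..}) = (if n = 0 then 0 else q n)"
proof (rule symfun_eqI)
  fix M :: "nat multiset"
  have "mcoeff (formal_sum q {1..}) M = (\<Sum>i\<in>{size M} \<inter> {1..}. mcoeff (q i) M)"
    using assms by (intro mcoeff_formal_sum) (auto simp: homogeneous_def)
  moreover have "mcoeff (q n) M = 0" if "n > 0" "size M \<noteq> n"
    using assms[of n] that by (auto simp: homogeneous_def)
  ultimately show "mcoeff (hom_component n (formal_sum q {1..})) M = mcoeff (if n = 0 then 0 else q n) M"
    by (cases n) auto
qed

lemma mcoeff_formal_sum_empty:
  assumes "\<And>i. i \<ge> 1 \<Longrightarrow> homogeneous i (q i)"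
  shows "mcoeff (formal_sum q {1..}) {#} = 0"
  using hom_component_formal_sum[OF assms, of 0] mcoeff_hom_component[of 0 "formal_sum q {1..}" "{#}"] by simp

lemma hom_component_times_p1:
  "hom_component n (f * sym_p 1) = (if n = 0 then 0 else hom_component (n - 1) f * sym_p 1)"
proof -
  have p1: "hom_component m (sym_p 1) = (if m = 1 then sym_p 1 else 0)" for m
    by (rule hom_component_homogeneous) simp
  show ?thesis
  proof (cases n)
    case (Suc m)
    have "hom_component n (f * sym_p 1) = (\<Sum>j\<le>n. if j = m then hom_component j f * sym_p 1 else 0)"
      unfolding hom_component_mult p1 by (rule sum.cong) (auto simp: Suc)
    then show ?thesis by (simp add: Suc)
  qed (simp add: hom_component_mult p1[simplified])
qed

text \<open>In each degree the product with 1 - p_1 gives the recursion f_n = f_(n-1) p_1, with f_0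
  = 1.\<close>

lemma geometric_iff:
  "f * (1 - sym_p 1) = 1 \<longleftrightarrow> (\<forall>n. hom_component n f = sym_p 1 ^ n)"
proof -
  have one: "hom_component n 1 = (if n = 0 then 1 else 0)" for n
    by (rule hom_component_homogeneous) simp
  have c: "hom_component n (f * (1 - sym_p 1))
     = (if n = 0 then hom_component 0 f else hom_component n f - hom_component (n - 1) f * sym_p 1)" for n
    by (simp add: right_diff_distrib hom_component_diff hom_component_times_p1[simplified])
  show ?thesis
  proof
    assume *: "f * (1 - sym_p 1) = 1"
    show "\<forall>n. hom_component n f = sym_p 1 ^ n"
    proof
      fix n show "hom_component n f = sym_p 1 ^ n"
      proof (induction n)
        case 0
        then show ?case using c[of 0] * one[of 0] by simp
      next
        case (Suc n)
        then show ?case using c[of "Suc n"] * one[of "Suc n"] by (simp add: mult.commute)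
      qed
    qed
  next
    assume *: "\<forall>n. hom_component n f = sym_p 1 ^ n"
    show "f * (1 - sym_p 1) = 1"
    proof (rule hom_component_eqI)
      fix n show "hom_component n (f * (1 - sym_p 1)) = hom_component n 1"
        unfolding c one using * by (cases n) (auto simp: mult.commute)
    qed
  qed
qed

text \<open>The coefficient at a nonconstant monomial is 0 unless the monomial is a square, and then
  it equals the coefficient at the square root, which has smaller degree. Descent on the degree
  leaves only the constant term.\<close>

lemma p_plethysm_fixed:
  assumes "p_plethysm 2 f = f" "mcoeff f {#} = 1"
  shows "f = 1"
proof (rule symfun_eqI)
  fix M show "mcoeff f M = mcoeff 1 M"
  proof (induction "size M" arbitrary: M rule: less_induct)
    case less
    show ?case
    proof (cases "M = {#}")
      case False
      show ?thesis
      proof (cases "\<exists>N. M = repeat_mset 2 N")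
        case True
        then obtain N where N: "M = repeat_mset 2 N" ..
        with False have "N \<noteq> {#}" "size N < size M"
          by (auto simp: size_repeat_mset nonempty_has_size)
        moreover have "mcoeff f M = mcoeff f N"
          using mcoeff_p_plethysm_repeat[of 2 f N] assms(1) N by simp
        ultimately show ?thesis using less[of N] False by (simp add: mcoeff_one)
      next
        case no: False
        then show ?thesis
          using mcoeff_p_plethysm_0[of M 2 f] assms(1) False by (auto simp: mcoeff_one)
      qed
    qed (simp add: assms mcoeff_one)
  qed
qed

lemma part_prod_cong: "(\<And>k. k > 0 \<Longrightarrow> a k = b k) \<Longrightarrow> part_prod a q lam = part_prod b q lam"
  unfolding part_prod_def by (intro prod.cong refl cycle_index_cong) simp

lemma cycle_index_scale_power:
  "cycle_index m (\<lambda>k. scale (c ^ k) (g k)) = scale (c ^ m) (cycle_index m g)"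
proof -
  have "(\<Prod>k\<in>#lam. c ^ k) = c ^ \<Sum>\<^sub># lam" for lam
    by (induction lam) (simp_all add: power_add)
  then show ?thesis
    unfolding cycle_index_def scale_sum_right
    by (intro sum.cong refl) (simp add: prod_mset_scale partitions_of_iff)
qed

text \<open>The sign given by the number of parts is spread over the factors according to
  multiplicities and enters the weights through \<open>cycle_index_scale_power\<close>. The
  truncated subtraction is harmless, a partition of \<open>n\<close> having at most \<open>n\<close>
  parts.\<close>

lemma neg_one_power_part_prod:
  assumes "lam \<in> partitions_of n"
  shows "(-1) ^ (n - size lam) * part_prod b q lam = scale ((-1) ^ n) (part_prod (\<lambda>k. (-1) ^ k * b k) q lam)"
proof -
  have len: "size lam \<le> n"
    using assms size_le_sum_mset[of lam] by (auto simp: partitions_of_iff all_partitions_def)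
  have "part_prod (\<lambda>k. (-1) ^ k * b k) q lam
     = (\<Prod>i\<in>set_mset lam. scale ((-1) ^ count lam i) (cycle_index (count lam i) (\<lambda>k. scale (b k) (p_plethysm k (q i)))))"
    unfolding part_prod_def by (simp flip: cycle_index_scale_power)
  also have "\<dots> = scale ((-1) ^ size lam) (part_prod b q lam)"
    unfolding prod_scale part_prod_def by (simp add: size_multiset_overloaded_eq power_sum)
  finally have *: "part_prod (\<lambda>k. (-1) ^ k * b k) q lam = scale ((-1) ^ size lam) (part_prod b q lam)" .
  have "(-1) ^ (n - size lam) = ((-1) ^ n * (-1) ^ size lam :: complex)"
    using len by (auto simp: minus_one_power_iff)
  then show ?thesis by (simp add: * neg_one_power_symfun)
qed

definition power2_partitions :: "nat \<Rightarrow> nat multiset set" where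
  "power2_partitions n = {lam \<in> partitions_of n. \<forall>i\<in>#lam. \<exists>k. i = 2 ^ k}"

lemma finite_power2_partitions [simp]: "finite (power2_partitions n)"
  by (simp add: power2_partitions_def)

text \<open>The expansion of the product over all j of 1/(1 - p_(2^j)).\<close>

definition power2_series :: symfun where
  "power2_series = p_series (\<lambda>lam. if \<forall>i\<in>#lam. \<exists>k. i = 2 ^ k then 1 else 0)"

lemma hom_component_power2_series:
  "hom_component n power2_series = (\<Sum>lam\<in>power2_partitions n. sym_p_part lam)"
  unfolding power2_series_def hom_component_p_series power2_partitions_def
  by (subst sum.inter_filter) (simp_all add: if_distrib[of "\<lambda>c. scale c _"] cong: if_cong)

lemma p_plethysm_sym_p_part: "k > 0 \<Longrightarrow> p_plethysm k (sym_p_part lam) = sym_p_part (image_mset ((*) k) lam)"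
  by (induction lam) (simp_all add: p_plethysm_one p_plethysm_mult p_plethysm_sym_p)

lemma image_mset_double_half:
  assumes "lam \<in> power2_partitions n" "1 \<notin># lam"
  shows "image_mset ((*) 2) (image_mset (\<lambda>i. i div 2) lam) = lam"
    "image_mset (\<lambda>i. i div 2) lam \<in> power2_partitions (n div 2)" "even n"
proof -
  have half: "even i \<and> (\<exists>k. i div 2 = 2 ^ k)" if i: "i \<in># lam" for i
  proof -
    obtain k where k: "i = 2 ^ k" using assms(1) i by (auto simp: power2_partitions_def)
    with assms(2) i have "k \<noteq> 0" by (metis power_0)
    then obtain l where "k = Suc l" using not0_implies_Suc by blast
    then show ?thesis using k by auto
  qed
  show *: "image_mset ((*) 2) (image_mset (\<lambda>i. i div 2) lam) = lam"
    unfolding multiset.map_comp using half by (intro multiset.map_ident_strong) simp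
  have "lam \<in> partitions_of n" using assms(1) by (simp add: power2_partitions_def)
  then have "n = \<Sum>\<^sub># lam" "0 \<notin># lam" by (simp_all add: partitions_of_iff all_partitions_def)
  then have n: "n = 2 * \<Sum>\<^sub># (image_mset (\<lambda>i. i div 2) lam)"
    using sum_mset_distrib_left[of 2 "\<lambda>i. i" "image_mset (\<lambda>i. i div 2) lam"] * by simp
  then show "even n" by simp
  have "0 \<notin># image_mset (\<lambda>i. i div 2) lam"
  proof
    assume "0 \<in># image_mset (\<lambda>i. i div 2) lam"
    then obtain i where "i \<in># lam" "i div 2 = 0" by auto
    with half show False by (metis power_not_zero zero_neq_numeral)
  qed
  then show "image_mset (\<lambda>i. i div 2) lam \<in> power2_partitions (n div 2)"
    using n half by (simp add: power2_partitions_def partitions_of_iff all_partitions_def)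
qed

text \<open>Plethysm by p_2 doubles all parts, and doubling is a bijection from the partitions into
  powers of 2 onto those without a part 1.\<close>

lemma hom_component_pleth2_power2_series:
  "hom_component n (p_plethysm 2 power2_series) = (\<Sum>lam | lam \<in> power2_partitions n \<and> 1 \<notin># lam. sym_p_part lam)"
proof (cases "even n")
  case True
  then have "hom_component n (p_plethysm 2 power2_series) =
      (\<Sum>lam\<in>power2_partitions (n div 2). sym_p_part (image_mset ((*) 2) lam))"
    by (simp add: p_plethysm_hom_component hom_component_power2_series p_plethysm_sum p_plethysm_sym_p_part)
  also have "\<dots> = (\<Sum>lam | lam \<in> power2_partitions n \<and> 1 \<notin># lam. sym_p_part lam)"
  proof (rule sum.reindex_bij_witness[of _ "image_mset (\<lambda>i. i div 2)" "image_mset ((*) 2)"])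
    fix lam assume lam: "lam \<in> power2_partitions (n div 2)"
    show "image_mset (\<lambda>i. i div 2) (image_mset ((*) 2) lam) = lam"
      by (simp add: multiset.map_comp comp_def)
    have "\<exists>l. 2 * 2 ^ k = (2 ^ l :: nat)" for k
      by (rule exI[of _ "Suc k"]) simp
    moreover have "\<Sum>\<^sub># (image_mset ((*) 2) lam) = n"
      using lam True sum_mset_distrib_left[of 2 "\<lambda>i. i" lam] by (simp add: power2_partitions_def partitions_of_iff)
    ultimately show "image_mset ((*) 2) lam \<in> {lam. lam \<in> power2_partitions n \<and> 1 \<notin># lam}"
      using lam by (auto simp: power2_partitions_def partitions_of_iff all_partitions_def)
  qed (use image_mset_double_half in auto)
  finally show ?thesis .
next
  case False
  then have "{lam. lam \<in> power2_partitions n \<and> 1 \<notin># lam} = {}"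
    using image_mset_double_half(3) by auto
  with False show ?thesis by (simp only: p_plethysm_hom_component sum.empty) simp
qed

text \<open>In product form both sides lack the factor 1/(1 - p_1); combinatorially, multiplication
  by 1 - p_1 cancels the partitions that have a part 1.\<close>

lemma power2_series_eq: "power2_series * (1 - sym_p 1) = p_plethysm 2 power2_series"
proof (rule hom_component_eqI)
  fix n
  show "hom_component n (power2_series * (1 - sym_p 1)) = hom_component n (p_plethysm 2 power2_series)"
  proof (cases n)
    case 0
    have "{lam. lam \<in> power2_partitions 0 \<and> 1 \<notin># lam} = power2_partitions 0"
      by (auto simp: power2_partitions_def)
    then show ?thesis unfolding hom_component_pleth2_power2_series
      by (simp add: 0 right_diff_distrib hom_component_diff hom_component_times_p1[simplified] hom_component_power2_series)
  next
    case (Suc m)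
    have "hom_component m power2_series * sym_p 1 = (\<Sum>lam\<in>power2_partitions m. sym_p_part (add_mset 1 lam))"
      by (simp add: hom_component_power2_series sum_distrib_right) (simp add: mult.commute)
    also have "\<dots> = (\<Sum>lam | lam \<in> power2_partitions n \<and> 1 \<in># lam. sym_p_part lam)"
    proof (rule sum.reindex_bij_witness[of _ "\<lambda>lam. lam - {#1#}" "add_mset 1"])
      fix lam assume "lam \<in> power2_partitions m"
      then show "add_mset 1 lam \<in> {lam. lam \<in> power2_partitions n \<and> 1 \<in># lam}"
        by (auto simp: power2_partitions_def partitions_of_iff Suc intro: exI[of _ 0])
    next
      fix lam assume "lam \<in> {lam. lam \<in> power2_partitions n \<and> 1 \<in># lam}"
      then have lam: "lam \<in> power2_partitions n" "1 \<in># lam" by auto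
      obtain mu where mu: "lam = add_mset 1 mu" using multi_member_split[OF lam(2)] by blast
      show "lam - {#1#} \<in> power2_partitions m" "add_mset 1 (lam - {#1#}) = lam"
        using lam by (simp_all add: mu power2_partitions_def partitions_of_iff Suc)
    qed simp_all
    finally have *: "hom_component m power2_series * sym_p 1 = \<dots>" .
    have "(\<Sum>lam\<in>power2_partitions n. sym_p_part lam) =
        (\<Sum>lam | lam \<in> power2_partitions n \<and> 1 \<in># lam. sym_p_part lam) +
        (\<Sum>lam | lam \<in> power2_partitions n \<and> 1 \<notin># lam. sym_p_part lam)"
      by (subst sum.union_disjoint[symmetric]) (auto intro!: sum.cong)
    then show ?thesis
      using * unfolding hom_component_pleth2_power2_series right_diff_distrib hom_component_diff hom_component_times_p1
      by (simp add: Suc hom_component_power2_series)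
  qed
qed

section \<open>The four identities for a general sequence starting with p_1\<close>

context
  fixes q :: "nat \<Rightarrow> symfun" and Q :: symfun
  assumes hq: "\<And>i. i \<ge> 1 \<Longrightarrow> homogeneous i (q i)" and q1: "q 1 = sym_p 1"
  defines "Q \<equiv> formal_sum q {1..}"
begin

lemma constant_term_Q: "mcoeff Q {#} = 0"
  unfolding Q_def by (rule mcoeff_formal_sum_empty[OF hq])

lemma sum_part_prod: "(\<Sum>lam\<in>partitions_of n. part_prod a q lam) = hom_component n (pleth_exp a Q)"
  by (rule hom_component_pleth_exp[symmetric, OF constant_term_Q])
    (simp add: Q_def hom_component_formal_sum[OF hq, simplified])

lemma hom_component_pleth_exp_0: "hom_component 0 (pleth_exp a Q) = 1"
  by (simp add: hom_component_0 constant_term_Q)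

lemma hom_component_pleth_exp_1: "hom_component (Suc 0) (pleth_exp a Q) = scale (a (Suc 0)) (sym_p 1)"
  using q1 by (simp add: partitions_of_1 part_prod_def cycle_index_1 p_plethysm_Suc_0 flip: sum_part_prod)

lemma powers_iff:
  "(\<forall>n\<ge>1. (\<Sum>lam\<in>partitions_of n. part_prod a q lam) = sym_p 1 ^ n) \<longleftrightarrow> pleth_exp a Q * (1 - sym_p 1) = 1"
proof -
  have "(\<forall>n\<ge>1. hom_component n (pleth_exp a Q) = sym_p 1 ^ n) \<longleftrightarrow>
      (\<forall>n. hom_component n (pleth_exp a Q) = sym_p 1 ^ n)"
    by (metis hom_component_pleth_exp_0 less_one linorder_not_le power_0)
  then show ?thesis unfolding sum_part_prod geometric_iff .
qed

lemma inverse_iff: "pleth_exp a Q * (1 - sym_p 1) = 1 \<longleftrightarrow> pleth_exp (\<lambda>k. - a k) Q = 1 - sym_p 1"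
proof
  assume *: "pleth_exp a Q * (1 - sym_p 1) = 1"
  have "pleth_exp (\<lambda>k. - a k) Q = pleth_exp (\<lambda>k. - a k) Q * (pleth_exp a Q * (1 - sym_p 1))"
    unfolding * by simp
  also have "\<dots> = (pleth_exp a Q * pleth_exp (\<lambda>k. - a k) Q) * (1 - sym_p 1)"
    by (simp only: mult_ac)
  finally show "pleth_exp (\<lambda>k. - a k) Q = 1 - sym_p 1"
    by (simp add: pleth_exp_inverse constant_term_Q)
qed (use pleth_exp_inverse[OF constant_term_Q, of a] in simp)

text \<open>In degree n, \<open>omega\<close> is (-1)^n times \<open>p_negate\<close>, so the
  prescribed signs leave a uniform minus and the argument becomes \<open>- p_negate Q\<close>. Then
  \<open>pleth_exp_p_negate\<close> applies, and \<open>p_negate\<close> is injective as an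
  involution.\<close>

lemma omega_iff:
  "pleth_exp a (formal_sum (\<lambda>n. (-1) ^ (n - 1) * omega (q n)) {1..}) = 1 + sym_p 1 \<longleftrightarrow>
     pleth_exp (\<lambda>k. - a k) Q = 1 - sym_p 1"
proof -
  have om: "(-1) ^ (n - 1) * omega (q n) = - p_negate (q n)" if "n \<ge> 1" for n
  proof -
    have "homogeneous n (p_negate (q n))"
      using hq[OF that] by (simp add: homogeneous_iff hom_component_p_negate)
    then have "omega (q n) = scale ((-1) ^ n) (p_negate (q n))"
      by (simp add: omega_eq degree_sign_homogeneous)
    with that show ?thesis
      by (cases n) (simp_all add: neg_one_power_symfun flip: power_mult_distrib)
  qed
  have "formal_sum (\<lambda>n. (-1) ^ (n - 1) * omega (q n)) {1..} = - p_negate Q"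
  proof (rule hom_component_eqI)
    fix n
    have "homogeneous i ((-1) ^ (i - 1) * omega (q i))" if "i \<ge> 1" for i
      using hq[OF that] unfolding om[OF that]
      by (intro homogeneous_uminus) (simp add: homogeneous_iff hom_component_p_negate)
    then show "hom_component n (formal_sum (\<lambda>n. (-1) ^ (n - 1) * omega (q n)) {1..}) = hom_component n (- p_negate Q)"
      by (subst hom_component_formal_sum)
        (auto simp: hom_component_uminus hom_component_p_negate Q_def hom_component_formal_sum[OF hq, simplified]
          om[simplified] Suc_le_eq cont_linearD[OF cont_linear_p_negate])
  qed
  then have "pleth_exp a (formal_sum (\<lambda>n. (-1) ^ (n - 1) * omega (q n)) {1..}) = p_negate (pleth_exp (\<lambda>k. - a k) Q)"
    by (simp add: pleth_exp_p_negate constant_term_Q)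
  moreover have "1 + sym_p 1 = p_negate (1 - sym_p 1)"
    using cont_linearD(1)[OF cont_linear_p_negate, of 1 "- sym_p 1"]
    by (simp add: cont_linearD(5)[OF cont_linear_p_negate] cont_homD(2)[OF cont_hom_p_negate] p_negate_sym_p)
  ultimately show ?thesis by (metis p_negate_involution)
qed

text \<open>Meant for \<open>a\<close> and \<open>b\<close> equal to 1 and \<open>sgn_wt\<close> in
  either order: the signs turn the weight \<open>b\<close> into \<open>- a\<close>. Degrees 0 and 1,
  on which the left side is silent, are settled by \<open>constant_term_Q\<close>, \<open>q1\<close>
  and \<open>a 1 = 1\<close>.\<close>

lemma signed_sum_iff:
  assumes ab: "\<And>k. k > 0 \<Longrightarrow> (-1) ^ k * b k = - a k" and a1: "a 1 = 1"
  shows "(\<forall>n\<ge>2. (\<Sum>lam\<in>partitions_of n. (-1) ^ (n - size lam) * part_prod b q lam) = 0) \<longleftrightarrow>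
     pleth_exp (\<lambda>k. - a k) Q = 1 - sym_p 1"
proof -
  have "(\<Sum>lam\<in>partitions_of n. (-1) ^ (n - size lam) * part_prod b q lam) =
      scale ((-1) ^ n) (hom_component n (pleth_exp (\<lambda>k. - a k) Q))" for n
  proof -
    have "(\<Sum>lam\<in>partitions_of n. (-1) ^ (n - size lam) * part_prod b q lam)
      = (\<Sum>lam\<in>partitions_of n. scale ((-1) ^ n) (part_prod (\<lambda>k. - a k) q lam))"
      using ab by (intro sum.cong refl) (simp add: neg_one_power_part_prod cong: part_prod_cong)
    then show ?thesis by (simp add: sum_part_prod flip: scale_sum_right)
  qed
  moreover have "scale ((-1) ^ n) f = 0 \<longleftrightarrow> f = 0" for n f
    by (metis scale_cancel scale_zero_right power_not_zero zero_neq_neg_one)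
  moreover have "(\<forall>n\<ge>2. hom_component n f = 0) \<longleftrightarrow> f = 1 - sym_p 1"
    if "hom_component 0 f = 1" "hom_component (Suc 0) f = - sym_p 1" for f
  proof -
    have c: "hom_component n (1 - sym_p 1) = (if n = 0 then 1 else if n = 1 then - sym_p 1 else 0)" for n
      by (simp add: hom_component_diff hom_component_homogeneous[of 0] hom_component_homogeneous[of 1, simplified])
    show ?thesis
    proof
      assume *: "\<forall>n\<ge>2. hom_component n f = 0"
      show "f = 1 - sym_p 1"
      proof (rule hom_component_eqI)
        fix n
        consider "n = 0" | "n = Suc 0" | "n \<ge> 2" by linarith
        then show "hom_component n f = hom_component n (1 - sym_p 1)"
          by cases (use * that in \<open>simp_all add: c[simplified]\<close>)
      qed
    qed (simp add: c[simplified])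
  qed
  ultimately show ?thesis
    using a1 by (simp add: hom_component_pleth_exp_0 hom_component_pleth_exp_1)
qed

lemma p_sq_minus_p2: "2 * sym_e 2 = sym_p 1 * sym_p 1 - sym_p 2"
proof -
  have "scale 2 (sym_e 2) = sym_p 1 * sym_p 1 - sym_p 2"
    using cycle_index_newton[of 2 "\<lambda>k. scale (sgn_wt k) (sym_p k)"]
    by (simp add: sym_e_eq_cycle_index numeral_2_eq_2 cycle_index_1)
  then show ?thesis
    using scale_add_left[of 1 1 "sym_e 2"] by simp
qed

text \<open>Since 2 e_2 = p_1^2 - p_2, the family of identities says that E[Q] (1 - p_1) = 1 - p_2.
  The factorisation H = E p_2[H] ties this to H[Q].\<close>

lemma E_sum_iff:
  "(\<forall>n\<ge>2. (\<Sum>lam\<in>partitions_of n. part_prod sgn_wt q lam) = 2 * sym_e 2 * sym_p 1 ^ (n - 2)) \<longleftrightarrow>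
     pleth_exp (\<lambda>_. 1) Q * (1 - sym_p 1) = 1"
proof -
  let ?H = "pleth_exp (\<lambda>_. 1) Q" and ?E = "pleth_exp sgn_wt Q"
  have HE: "?H = ?E * p_plethysm 2 ?H" by (rule H_eq_E_times_pleth2_H[OF constant_term_Q])
  have c: "hom_component n (?E * (1 - sym_p 1)) = 
     (if n = 0 then 1 else hom_component n ?E - hom_component (n - 1) ?E * sym_p 1)" for n
    by (simp add: right_diff_distrib hom_component_diff hom_component_times_p1[simplified] hom_component_pleth_exp_0)
  have d: "hom_component n (1 - sym_p 2) = (if n = 0 then 1 else if n = 2 then - sym_p 2 else 0)" for n
    by (simp add: hom_component_diff hom_component_homogeneous[of 0] hom_component_homogeneous[of 2])
  have "(\<forall>n\<ge>2. hom_component n ?E = 2 * sym_e 2 * sym_p 1 ^ (n - 2)) \<longleftrightarrow> ?E * (1 - sym_p 1) = 1 - sym_p 2"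
  proof
    assume *: "\<forall>n\<ge>2. hom_component n ?E = 2 * sym_e 2 * sym_p 1 ^ (n - 2)"
    show "?E * (1 - sym_p 1) = 1 - sym_p 2"
    proof (rule hom_component_eqI)
      fix n
      consider "n = 0" | "n = Suc 0" | "n = 2" | m where "n = Suc (Suc (Suc m))"
        by (metis One_nat_def Suc_1 not0_implies_Suc)
      then show "hom_component n (?E * (1 - sym_p 1)) = hom_component n (1 - sym_p 2)"
      proof cases
        case 3
        then show ?thesis unfolding c d using *
          by (simp add: hom_component_pleth_exp_1 p_sq_minus_p2)
      next
        case (4 m)
        then show ?thesis unfolding c d using * by (simp add: mult_ac)
      qed (simp_all add: c[simplified] d hom_component_pleth_exp_0 hom_component_pleth_exp_1)
    qed
  next
    assume *: "?E * (1 - sym_p 1) = 1 - sym_p 2"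
    have step: "hom_component (Suc n) ?E = hom_component n ?E * sym_p 1 + hom_component (Suc n) (1 - sym_p 2)" for n
      using c[of "Suc n"] * by simp
    have "hom_component (n + 2) ?E = 2 * sym_e 2 * sym_p 1 ^ n" for n
    proof (induction n)
      case 0
      have "hom_component 2 ?E = hom_component 1 ?E * sym_p 1 + hom_component 2 (1 - sym_p 2)"
        using step[of 1] by (simp only: Suc_1)
      then show ?case
        unfolding add_0 by (simp add: d hom_component_pleth_exp_1 p_sq_minus_p2[simplified])
    next
      case (Suc n)
      then show ?case using step[of "n + 2"] by (simp add: d mult_ac)
    qed
    then show "\<forall>n\<ge>2. hom_component n ?E = 2 * sym_e 2 * sym_p 1 ^ (n - 2)"
      by (metis le_add_diff_inverse2)
  qed
  also have "\<dots> \<longleftrightarrow> ?H * (1 - sym_p 1) = 1"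
  proof
    \<comment> \<open>Here H (1 - p_1) turns out to be fixed by plethysm with p_2, hence equal to
      1.\<close>
    assume E: "?E * (1 - sym_p 1) = 1 - sym_p 2"
    have "?H * (1 - sym_p 1) = (?E * (1 - sym_p 1)) * p_plethysm 2 ?H"
      by (subst HE) (simp only: mult_ac)
    also have "\<dots> = p_plethysm 2 (?H * (1 - sym_p 1))"
      unfolding E by (simp add: p_plethysm_mult p_plethysm_diff p_plethysm_one p_plethysm_sym_p mult.commute)
    finally show "?H * (1 - sym_p 1) = 1"
      by (intro p_plethysm_fixed) (simp_all add: constant_term_Q mcoeff_one)
  next
    assume H: "?H * (1 - sym_p 1) = 1"
    then have "p_plethysm 2 (?H * (1 - sym_p 1)) = 1" by (simp add: p_plethysm_one)
    then have H2: "p_plethysm 2 ?H * (1 - sym_p 2) = 1"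
      by (simp add: p_plethysm_mult p_plethysm_diff p_plethysm_one p_plethysm_sym_p)
    \<comment> \<open>Inserting the factor p_2[H] (1 - p_2) = 1 completes E to H.\<close>
    have "?E * (1 - sym_p 1) = (?E * p_plethysm 2 ?H) * (1 - sym_p 1) * (1 - sym_p 2)"
      using H2 by (metis (no_types, lifting) mult.assoc mult.commute mult_1_right)
    also have "\<dots> = 1 - sym_p 2" by (simp only: HE[symmetric] H mult_1_left)
    finally show "?E * (1 - sym_p 1) = 1 - sym_p 2" .
  qed
  finally show ?thesis unfolding sum_part_prod .
qed

text \<open>The series P of \<open>power2_series\<close> solves P (1 - p_1) = p_2[P]. If E = 1/(1 -
  p_1), then H solves the same equation because H = E p_2[H], and the quotient of two such solutions
  is fixed by plethysm with p_2.\<close>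

lemma H_sum_iff:
  "(\<forall>n\<ge>2. (\<Sum>lam\<in>partitions_of n. part_prod (\<lambda>_. 1) q lam) = (\<Sum>lam\<in>power2_partitions n. sym_p_part lam)) \<longleftrightarrow>
     pleth_exp sgn_wt Q * (1 - sym_p 1) = 1"
proof -
  let ?H = "pleth_exp (\<lambda>_. 1) Q" and ?E = "pleth_exp sgn_wt Q" and ?P = power2_series
  let ?I = "pleth_exp (\<lambda>k. - 1) Q"
  have HE: "?H = ?E * p_plethysm 2 ?H" by (rule H_eq_E_times_pleth2_H[OF constant_term_Q])
  have HI: "?H * ?I = 1" by (rule pleth_exp_inverse[OF constant_term_Q])
  have P0: "hom_component 0 ?P = 1"
  proof -
    have "power2_partitions 0 = {{#}}" by (auto simp: power2_partitions_def)
    then show ?thesis by (simp add: hom_component_power2_series)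
  qed
  have "{lam \<in> {{#Suc 0#}}. \<forall>i\<in>#lam. \<exists>k. i = 2 ^ k} = {{#Suc 0#}}"
    by (auto intro: exI[of _ 0])
  then have P1: "hom_component (Suc 0) ?P = sym_p (Suc 0)"
    by (simp add: hom_component_power2_series power2_partitions_def partitions_of_1)
  have "(\<forall>n\<ge>2. hom_component n ?H = hom_component n ?P) \<longleftrightarrow> ?H = ?P"
  proof
    assume *: "\<forall>n\<ge>2. hom_component n ?H = hom_component n ?P"
    show "?H = ?P"
    proof (rule hom_component_eqI)
      fix n
      consider "n = 0" | "n = Suc 0" | "n \<ge> 2" by linarith
      then show "hom_component n ?H = hom_component n ?P"
        by cases (use * in \<open>simp_all add: P0 P1 hom_component_pleth_exp_0 hom_component_pleth_exp_1\<close>)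
    qed
  qed simp
  also have "\<dots> \<longleftrightarrow> ?E * (1 - sym_p 1) = 1"
  proof
    assume HP: "?H = ?P"
    \<comment> \<open>As \<open>?I\<close> is the inverse of \<open>?H\<close>, which is now
      \<open>?P\<close>, this prepares a division by \<open>?P\<close>.\<close>
    have "?E * (1 - sym_p 1) = ?E * (1 - sym_p 1) * (?P * ?I)"
      using HI unfolding HP by simp
    also have "\<dots> = ?E * (?P * (1 - sym_p 1)) * ?I"
      by (simp only: mult_ac)
    also have "\<dots> = ?H * ?I"
      using HE unfolding power2_series_eq HP by simp
    finally show "?E * (1 - sym_p 1) = 1" by (simp add: HI)
  next
    assume E: "?E * (1 - sym_p 1) = 1"
    have H1: "?H * (1 - sym_p 1) = p_plethysm 2 ?H"
    proof -
      have "?H * (1 - sym_p 1) = (?E * (1 - sym_p 1)) * p_plethysm 2 ?H"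
        by (subst HE) (simp only: mult_ac)
      then show ?thesis by (simp only: E mult_1_left)
    qed
    have HI2: "p_plethysm 2 ?H * p_plethysm 2 ?I = 1"
      using HI by (simp add: p_plethysm_one flip: p_plethysm_mult)
    \<comment> \<open>The quotient P/H is written \<open>?P * ?I\<close>; the trailing factor
      \<open>?H * ?I\<close> is a 1 inserted so that \<open>H1\<close> can be used.\<close>
    have "p_plethysm 2 (?P * ?I) = ?P * (1 - sym_p 1) * p_plethysm 2 ?I * (?H * ?I)"
      unfolding power2_series_eq HI by (simp add: p_plethysm_mult)
    also have "\<dots> = ?P * ?I * ((?H * (1 - sym_p 1)) * p_plethysm 2 ?I)"
      by (simp only: mult_ac)
    also have "\<dots> = ?P * ?I"
      unfolding H1 HI2 by simp
    finally have "?P * ?I = 1"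
    proof (rule p_plethysm_fixed)
      have "mcoeff ?P {#} = 1" using P0 by (metis hom_component_0 mcoeff_one mcoeff_scale mult_1_right)
      then show "mcoeff (?P * ?I) {#} = 1" by (simp add: constant_term_Q)
    qed
    then have "?H = ?H * (?P * ?I)" by simp
    also have "\<dots> = ?P * (?H * ?I)" by (simp only: mult_ac)
    finally show "?H = ?P" by (simp add: HI)
  qed
  finally show ?thesis unfolding sum_part_prod hom_component_power2_series .
qed

end

section \<open>Characters induced from the cyclic subgroup\<close>

lemma scale_sum_const: "(\<Sum>i\<in>I. f) = scale (of_nat (card I)) f"
  by (simp add: of_nat_symfun)

lemma finite_carrier_sym_group: "finite (carrier (sym_group n))"
  using finite_permutations[of "{1..n}"] by (simp add: sym_group_def)

lemma card_carrier_sym_group: "card (carrier (sym_group n)) = fact n"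
  using card_permutations[of "{1..n}" n] by (simp add: sym_group_def)

lemma conj_funpow:
  assumes "bij x"
  shows "((x \<circ> g \<circ> inv' x) ^^ k) (x i) = x ((g ^^ k) i)"
  by (induction k) (simp_all add: bij_is_inj[OF assms])

lemma cycle_type_conj:
  assumes x: "x permutes {1..n}"
  shows "cycle_type n (x \<circ> g \<circ> inv' x) = cycle_type n g"
proof -
  have bij: "bij x" using x by (rule permutes_bij)
  have orb: "Orbits.orbit (x \<circ> g \<circ> inv' x) (x i) = x ` Orbits.orbit g i" for i
    unfolding orbit_altdef using conj_funpow[OF bij] by (auto simp: image_iff)
  have "Orbits.orbit (x \<circ> g \<circ> inv' x) ` {1..n} = Orbits.orbit (x \<circ> g \<circ> inv' x) ` (x ` {1..n})"
    using permutes_image[OF x] by simp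
  also have "\<dots> = (`) x ` (Orbits.orbit g ` {1..n})"
    by (simp add: image_image orb)
  finally have "mset_set (Orbits.orbit (x \<circ> g \<circ> inv' x) ` {1..n}) = image_mset ((`) x) (mset_set (Orbits.orbit g ` {1..n}))"
    by (subst image_mset_mset_set) (simp_all add: inj_on_def inj_image_eq_iff[OF bij_is_inj[OF bij]])
  then show ?thesis
    unfolding cycle_type_def using bij
    by (simp add: multiset.map_comp comp_def card_image inj_on_subset[OF bij_is_inj[OF bij]])
qed

text \<open>Substituting s = x g x^(-1) lets x run freely over the whole group. The cycle type is
  invariant under conjugation, so the sum over x contributes only the factor n!, which the
  normalisation cancels.\<close>

lemma frobenius_ch_induced_char:
  assumes K: "K \<subseteq> carrier (sym_group n)"
  shows "frobenius_ch n (induced_char (sym_group n) K \<chi>) =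
    scale (1 / of_nat (card K)) (\<Sum>g\<in>K. scale (\<chi> g) (sym_p_part (cycle_type n g)))"
proof -
  let ?G = "carrier (sym_group n)"
  have finK: "finite K" using K finite_carrier_sym_group finite_subset by blast
  have per: "x permutes {1..n}" if "x \<in> ?G" for x using that by (simp add: sym_group_carrier)
  define T where "T s = {x \<in> ?G. inv' x \<circ> s \<circ> x \<in> K}" for s
  have ind: "induced_char (sym_group n) K \<chi> s = (\<Sum>x\<in>T s. \<chi> (inv' x \<circ> s \<circ> x)) / of_nat (card K)" for s
  proof -
    have "{x \<in> ?G. inv\<^bsub>sym_group n\<^esub> x \<otimes>\<^bsub>sym_group n\<^esub> s \<otimes>\<^bsub>sym_group n\<^esub> x \<in> K} = T s"
      by (auto simp: T_def sym_group_mult)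
    then show ?thesis
      unfolding induced_char_def by (auto simp: sym_group_mult T_def intro!: sum.cong)
  qed
  have finT: "finite (T s)" for s
    unfolding T_def using finite_carrier_sym_group by simp
  have "(\<Sum>s\<in>?G. scale (induced_char (sym_group n) K \<chi> s) (sym_p_part (cycle_type n s)))
     = scale (1 / of_nat (card K)) (\<Sum>s\<in>?G. \<Sum>x\<in>T s. scale (\<chi> (inv' x \<circ> s \<circ> x)) (sym_p_part (cycle_type n s)))"
    by (simp add: ind scale_sum_right scale_sum_left sum_divide_distrib)
  also have "(\<Sum>s\<in>?G. \<Sum>x\<in>T s. scale (\<chi> (inv' x \<circ> s \<circ> x)) (sym_p_part (cycle_type n s)))
     = (\<Sum>(s, x)\<in>Sigma ?G T. scale (\<chi> (inv' x \<circ> s \<circ> x)) (sym_p_part (cycle_type n s)))"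
    using finite_carrier_sym_group finT by (intro sum.Sigma) auto
  also have "\<dots> = (\<Sum>(x, g)\<in>?G \<times> K. scale (\<chi> g) (sym_p_part (cycle_type n g)))"
  proof (rule sum.reindex_bij_witness[of _ "\<lambda>(x, g). (x \<circ> g \<circ> inv' x, x)" "\<lambda>(s, x). (x, inv' x \<circ> s \<circ> x)"], goal_cases)
    case (1 p)
    then obtain s x where p: "p = (s, x)" "x permutes {1..n}" by (auto simp: T_def sym_group_carrier)
    then show ?case
      by (simp add: fun_eq_iff permutes_inverses)
  next
    case (2 p)
    then show ?case by (auto simp: T_def)
  next
    case (3 p)
    then obtain x g where p: "p = (x, g)" "x permutes {1..n}" by (auto simp: sym_group_carrier)
    then show ?case
      by (simp add: fun_eq_iff permutes_inverses)
  next
    case (4 p)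
    then obtain x g where p: "p = (x, g)" "x \<in> ?G" "x permutes {1..n}" "g \<in> K" by (auto simp: sym_group_carrier)
    have "x \<circ> g \<circ> inv' x permutes {1..n}"
      using p K per by (intro permutes_compose permutes_inv) auto
    moreover have "inv' x \<circ> (x \<circ> g \<circ> inv' x) \<circ> x = g"
      using p(3) by (simp add: fun_eq_iff permutes_inverses)
    ultimately show ?case using p by (simp add: T_def sym_group_carrier)
  next
    case (5 p)
    then obtain s x where p: "p = (s, x)" "x permutes {1..n}" by (auto simp: T_def sym_group_carrier)
    have "x \<circ> (inv' x \<circ> s \<circ> x) \<circ> inv' x = s"
      using p(2) by (simp add: fun_eq_iff permutes_inverses)
    then have "cycle_type n (inv' x \<circ> s \<circ> x) = cycle_type n s"
      using cycle_type_conj[OF p(2), of "inv' x \<circ> s \<circ> x"] by simp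
    then show ?case by (simp add: p(1))
  qed
  also have "\<dots> = scale (fact n) (\<Sum>g\<in>K. scale (\<chi> g) (sym_p_part (cycle_type n g)))"
    by (simp add: sum.cartesian_product[symmetric] scale_sum_const card_carrier_sym_group del: sum_constant)
  finally show ?thesis
    by (simp add: frobenius_ch_def)
qed

lemma long_cycle_permutes: "long_cycle n permutes {1..n}"
  using cycle_permutes[of "[1..<Suc n]"] by (simp add: long_cycle_def atLeastLessThanSuc_atLeastAtMost del: upt_Suc)

text \<open>Points are numbered from 1 and residues from 0, whence the \<open>Suc\<close> on both
  sides.\<close>

lemma long_cycle_funpow:
  assumes "i < n"
  shows "(long_cycle n ^^ j) (Suc i) = Suc ((i + j) mod n)"
proof -
  have "map (long_cycle n ^^ j) [1..<Suc n] ! i = rotate j [1..<Suc n] ! i"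
    unfolding long_cycle_def by (subst cyclic_rotation) auto
  then show ?thesis
    using assms by (simp add: nth_rotate add.commute del: upt_Suc)
qed

lemma long_cycle_funpow_eq_iff:
  assumes "n > 0"
  shows "long_cycle n ^^ j = long_cycle n ^^ k \<longleftrightarrow> j mod n = k mod n"
proof
  assume "long_cycle n ^^ j = long_cycle n ^^ k"
  then have "(long_cycle n ^^ j) (Suc 0) = (long_cycle n ^^ k) (Suc 0)" by simp
  then show "j mod n = k mod n" using assms by (simp add: long_cycle_funpow)
next
  assume jk: "j mod n = k mod n"
  show "long_cycle n ^^ j = long_cycle n ^^ k"
  proof
    fix x
    show "(long_cycle n ^^ j) x = (long_cycle n ^^ k) x"
    proof (cases "x \<in> {1..n}")
      case True
      then obtain i where "x = Suc i" "i < n" by (cases x) auto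
      then show ?thesis using jk by (simp add: long_cycle_funpow) (metis mod_add_right_eq)
    next
      case False
      have "(long_cycle n ^^ j) x = x" for j
        using permutes_funpow[OF long_cycle_permutes[of n], of j] False by (simp add: permutes_def)
      then show ?thesis by simp
    qed
  qed
qed

lemma long_cycle_pow: "long_cycle n [^]\<^bsub>sym_group n\<^esub> (j :: nat) = long_cycle n ^^ j"
proof -
  interpret group "sym_group n" by (rule sym_group_is_group)
  show ?thesis
    by (induction j) (simp_all add: sym_group_mult sym_group_one funpow_swap1 fun_eq_iff)
qed

lemma cyclic_subgroup_eq:
  assumes "n > 0"
  shows "cyclic_subgroup n = (\<lambda>j. long_cycle n ^^ j) ` {..<n}"
proof -
  interpret group "sym_group n" by (rule sym_group_is_group)
  have "cyclic_subgroup n = {long_cycle n [^]\<^bsub>sym_group n\<^esub> j |j. j \<in> (UNIV :: nat set)}"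
    unfolding cyclic_subgroup_def
    using long_cycle_permutes by (intro generate_pow_on_finite_carrier finite_carrier_sym_group) (simp add: sym_group_carrier)
  also have "\<dots> = (\<lambda>j. long_cycle n ^^ j) ` {..<n}"
  proof -
    have "long_cycle n ^^ j \<in> (\<lambda>j. long_cycle n ^^ j) ` {..<n}" for j
      using assms by (intro image_eqI[of _ _ "j mod n"]) (simp_all add: long_cycle_funpow_eq_iff)
    then show ?thesis by (auto simp: long_cycle_pow)
  qed
  finally show ?thesis .
qed

lemma inj_on_long_cycle_pow: "n > 0 \<Longrightarrow> inj_on (\<lambda>j. long_cycle n ^^ j) {..<n}"
  by (auto simp: inj_on_def long_cycle_funpow_eq_iff)

lemma cyclic_char_pow:
  assumes "j < n"
  shows "cyclic_char n z (long_cycle n ^^ j) = z ^ j"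
proof -
  have "(LEAST k. long_cycle n ^^ j = long_cycle n ^^ k) = j"
    using assms by (intro Least_equality) (auto simp: long_cycle_funpow_eq_iff)
  then show ?thesis by (simp add: cyclic_char_def long_cycle_pow)
qed

text \<open>On residues the power is translation by \<open>j\<close>. With g = gcd n j all orbits
  have size n/g, and since they partition the n points, there are g of them.\<close>

lemma cycle_type_long_cycle_pow:
  assumes n: "n > 0"
  shows "cycle_type n (long_cycle n ^^ j) = replicate_mset (gcd n j) (n div gcd n j)"
proof -
  define g where "g = gcd n j"
  let ?f = "long_cycle n ^^ j"
  let ?C = "Orbits.orbit ?f ` {1..n}"
  have g: "g > 0" using n by (simp add: g_def)
  obtain m j' where n_eq: "n = m * g" and j_eq: "j = j' * g" and cop: "coprime m j'"
    using gcd_coprime_exists[of n j] g unfolding g_def by blast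
  have m: "m > 0" using n n_eq by (intro gr0I) simp
  have pow: "(?f ^^ k) (Suc i) = Suc ((i + j * k) mod n)" if "i < n" for i k
    unfolding funpow_mult long_cycle_funpow[OF that] by (simp only: mult.commute)
  \<comment> \<open>With \<open>j = j' * g\<close> and \<open>j'\<close> coprime to
    \<open>m\<close>, where \<open>n = m * g\<close>, the residue of \<open>j * k\<close> modulo
    \<open>n\<close> determines and is determined by that of \<open>k\<close> modulo
    \<open>m\<close>.\<close>
  have cong_iff: "(i + j * k) mod n = (i + j * l) mod n \<longleftrightarrow> k mod m = l mod m" for i k l
  proof -
    have mod_iff: "a mod d = b mod d \<longleftrightarrow> int d dvd int a - int b" for a b d :: nat
      unfolding mod_eq_dvd_iff[symmetric] of_nat_mod[symmetric] of_nat_eq_iff ..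
    have "(i + j * k) mod n = (i + j * l) mod n \<longleftrightarrow> int n dvd int j * (int k - int l)"
      unfolding mod_iff by (simp add: algebra_simps)
    also have "\<dots> \<longleftrightarrow> int g * int m dvd int g * (int j' * (int k - int l))"
      by (simp add: n_eq j_eq mult_ac)
    also have "\<dots> \<longleftrightarrow> int m dvd int j' * (int k - int l)"
      using g by simp
    also have "\<dots> \<longleftrightarrow> int m dvd int k - int l"
      using cop by (intro coprime_dvd_mult_right_iff) simp
    finally show ?thesis by (simp add: mod_iff)
  qed
  have orb: "Orbits.orbit ?f (Suc i) = (\<lambda>k. Suc ((i + j * k) mod n)) ` {..<m}" if i: "i < n" for i
  proof (intro equalityI subsetI)
    fix x assume "x \<in> Orbits.orbit ?f (Suc i)"
    then obtain k where "x = Suc ((i + j * k) mod n)"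
      unfolding orbit_altdef pow[OF i] by blast
    then have "x = Suc ((i + j * (k mod m)) mod n)" using cong_iff[of i k "k mod m"] by simp
    then show "x \<in> (\<lambda>k. Suc ((i + j * k) mod n)) ` {..<m}"
      using m by (intro image_eqI[of _ _ "k mod m"]) simp_all
  next
    fix x assume "x \<in> (\<lambda>k. Suc ((i + j * k) mod n)) ` {..<m}"
    then obtain k where "x = Suc ((i + j * k) mod n)" by blast
    \<comment> \<open>Orbits consist of positive iterates, so \<open>k\<close> is shifted by the
      period \<open>m\<close> to avoid the exponent 0.\<close>
    then have "x = Suc ((i + j * (k + m)) mod n)" using cong_iff[of i k "k + m"] by simp
    moreover have "k + m > 0" using m by linarith
    ultimately show "x \<in> Orbits.orbit ?f (Suc i)"
      unfolding orbit_altdef pow[OF i] by blast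
  qed
  have card_orb: "card c = m" if c: "c \<in> ?C" for c
  proof -
    obtain x where "x \<in> {1..n}" "c = Orbits.orbit ?f x" using c by auto
    then obtain i where "c = Orbits.orbit ?f (Suc i)" "i < n" by (cases x) auto
    then show ?thesis
      using orb[of i] by (simp add: card_image inj_on_def cong_iff)
  qed
  have per: "?f permutes {1..n}" by (rule permutes_funpow[OF long_cycle_permutes])
  then have perm: "permutation ?f" by (rule permutes_imp_permutation[OF finite_atLeastAtMost])
  have UC: "\<Union> ?C = {1..n}"
  proof (intro equalityI subsetI)
    fix y assume "y \<in> \<Union> ?C"
    then obtain x where "x \<in> {1..n}" "y \<in> Orbits.orbit ?f x" by blast
    then show "y \<in> {1..n}" using permutes_orbit_subset[OF per, of x] by blast
  next
    fix y assume "y \<in> {1..n}"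
    then show "y \<in> \<Union> ?C" using permutation_self_in_orbit[OF perm, of y] by blast
  qed
  have "m * card ?C = card (\<Union> ?C)"
  proof (rule card_partition)
    show "finite (\<Union> ?C)"
      unfolding UC by simp
    fix c d assume "c \<in> ?C" "d \<in> ?C" "c \<noteq> d"
    then obtain x y where xy: "c = Orbits.orbit ?f x" "d = Orbits.orbit ?f y" by blast
    show "c \<inter> d = {}"
    proof (rule ccontr)
      assume "c \<inter> d \<noteq> {}"
      then obtain z where "z \<in> Orbits.orbit ?f x" "z \<in> Orbits.orbit ?f y" using xy by blast
      note this[THEN orbit_cyclic_eq3[OF cyclic_on_orbit[OF per finite_atLeastAtMost]]]
      with \<open>c \<noteq> d\<close> show False unfolding xy by simp
    qed
  qed (simp, rule card_orb)
  then have "m * card ?C = m * g" unfolding UC using n_eq by simp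
  then have card_C: "card ?C = g" using m by simp
  have "n div g = m" using g n_eq by simp
  have "image_mset card (mset_set ?C) = image_mset (\<lambda>_. m) (mset_set ?C)"
    using card_orb by (intro image_mset_cong) auto
  then show ?thesis
    unfolding cycle_type_def g_def[symmetric] \<open>n div g = m\<close>
    by (simp add: image_mset_const_eq card_C[simplified])
qed

lemma sym_p_part_replicate: "sym_p_part (replicate_mset g m) = sym_p m ^ g"
  by (induction g) simp_all

lemma frobenius_ch_cyclic:
  assumes n: "n > 0"
  shows "frobenius_ch n (induced_char (sym_group n) (cyclic_subgroup n) (cyclic_char n z)) =
    scale (1 / of_nat n) (\<Sum>j<n. scale (z ^ j) (sym_p (n div gcd n j) ^ gcd n j))"
proof -
  have "cyclic_subgroup n \<subseteq> carrier (sym_group n)"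
    unfolding cyclic_subgroup_eq[OF n] using permutes_funpow[OF long_cycle_permutes] by (auto simp: sym_group_carrier simp del: One_nat_def)
  moreover have "card (cyclic_subgroup n) = n"
    unfolding cyclic_subgroup_eq[OF n] by (simp add: card_image inj_on_long_cycle_pow[OF n])
  ultimately show ?thesis
    using inj_on_long_cycle_pow[OF n]
    by (simp add: frobenius_ch_induced_char)
      (simp add: cyclic_subgroup_eq[OF n] sum.reindex cyclic_char_pow cycle_type_long_cycle_pow[OF n] sym_p_part_replicate)
qed

section \<open>Ramanujan sums and the functions Lie and Lie2\<close>

lemma sum_by_gcd:
  fixes F :: "nat \<Rightarrow> nat \<Rightarrow> 'a :: comm_monoid_add"
  assumes n: "n > 0"
  shows "(\<Sum>j<n. F (n div gcd n j) (j div gcd n j)) = (\<Sum>d | d dvd n. \<Sum>u | u < d \<and> coprime u d. F d u)"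
proof -
  have "(\<Sum>j<n. F (n div gcd n j) (j div gcd n j)) =
      (\<Sum>(d, u)\<in>Sigma {d. d dvd n} (\<lambda>d. {u. u < d \<and> coprime u d}). F d u)"
  proof (rule sum.reindex_bij_witness[of _ "\<lambda>(d, u). u * (n div d)" "\<lambda>j. (n div gcd n j, j div gcd n j)"])
    fix j assume j: "j \<in> {..<n}"
    define g where "g = gcd n j"
    have g: "g > 0" using n by (simp add: g_def)
    obtain m j' where mj: "n = m * g" "j = j' * g" "coprime m j'"
      using gcd_coprime_exists[of n j] g unfolding g_def by blast
    have div: "n div g = m" "j div g = j'" using mj(1,2) g by simp_all
    have "m > 0" using n mj(1) by (intro gr0I) simp
    then have "n div m = g" using mj(1) by simp
    then show "(case (n div gcd n j, j div gcd n j) of (d, u) \<Rightarrow> u * (n div d)) = j"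
      unfolding g_def[symmetric] div using mj(2) by simp
    have "j' * g < m * g" using j unfolding mj(1,2)[symmetric] by simp
    then have "j' < m" by simp
    moreover have "m dvd n" using mj(1) by simp
    ultimately show "(n div gcd n j, j div gcd n j) \<in> Sigma {d. d dvd n} (\<lambda>d. {u. u < d \<and> coprime u d})"
      using mj(3) unfolding g_def[symmetric] div by (simp add: coprime_commute)
    show "(case (n div gcd n j, j div gcd n j) of (d, u) \<Rightarrow> F d u) = F (n div gcd n j) (j div gcd n j)"
      by simp
  next
    fix p assume "p \<in> Sigma {d. d dvd n} (\<lambda>d. {u. u < d \<and> coprime u d})"
    then obtain d u where p: "p = (d, u)" "d dvd n" "u < d" "coprime u d" by auto
    then obtain e where e: "n = d * e" by (elim dvdE)
    have "d > 0" "e > 0" using n e by auto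
    have "gcd n (u * e) = e"
      using p(4) unfolding e by (simp add: gcd_mult_right gcd_mult_distrib_nat[symmetric] coprime_iff_gcd_eq_1 gcd.commute)
    moreover have "n div d = e" "n div e = d" using e \<open>d > 0\<close> \<open>e > 0\<close> by simp_all
    ultimately show "(case p of (d, u) \<Rightarrow> u * (n div d)) \<in> {..<n}"
      "(n div gcd n (case p of (d, u) \<Rightarrow> u * (n div d)), (case p of (d, u) \<Rightarrow> u * (n div d)) div
         gcd n (case p of (d, u) \<Rightarrow> u * (n div d))) = p"
      using p e \<open>e > 0\<close> by simp_all
  qed
  also have "\<dots> = (\<Sum>d | d dvd n. \<Sum>u | u < d \<and> coprime u d. F d u)"
    using n by (intro sum.Sigma[symmetric]) auto
  finally show ?thesis .
qed

text \<open>The sum of the \<open>w\<close>-th powers of the primitive \<open>d\<close>-th roots of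
  unity; for \<open>w = 1\<close> it is the Moebius function at \<open>d\<close>.\<close>

definition ramanujan_sum :: "nat \<Rightarrow> nat \<Rightarrow> complex" where
  "ramanujan_sum d w = (\<Sum>u | u < d \<and> coprime u d. cis (2 * pi * w / d) ^ u)"

lemma cis_pow_reduce:
  assumes "n > 0"
  shows "cis (2 * pi * real w / real n) ^ j =
    cis (2 * pi * real w / real (n div gcd n j)) ^ (j div gcd n j)"
proof -
  define g where "g = gcd n j"
  have g: "g > 0" using assms by (simp add: g_def)
  obtain m j' where mj: "n = m * g" "j = j' * g"
    using gcd_coprime_exists[of n j] g unfolding g_def by blast
  have div: "n div g = m" "j div g = j'" using mj g by simp_all
  have "real j * (2 * pi * real w / real n) = real j' * (2 * pi * real w / real m)"
    using g by (simp add: mj)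
  then show ?thesis unfolding g_def[symmetric] div DeMoivre by simp
qed

lemma cis_eq_1_iff_dvd:
  assumes n: "n > 0"
  shows "cis (2 * pi * real w / real n) = 1 \<longleftrightarrow> n dvd w"
proof -
  let ?r = "w mod n"
  have inj: "inj_on (\<lambda>k. cis (2 * pi * real k / real n)) {..<n}"
    using bij_betw_roots_unity[OF n] by (rule bij_betw_imp_inj_on)
  have "real w = real n * real (w div n) + real ?r"
    by (simp flip: of_nat_mult of_nat_add)
  then have "2 * pi * real w / real n = 2 * pi * real (w div n) + 2 * pi * real ?r / real n"
    using n by (simp add: field_simps)
  then have "cis (2 * pi * real w / real n) = cis (2 * pi * real ?r / real n)"
    by (simp add: cis_multiple_2pi flip: cis_mult)
  also have "\<dots> = 1 \<longleftrightarrow> ?r = 0"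
    using inj_on_eq_iff[OF inj, of ?r 0] n by simp
  finally show ?thesis by (simp add: dvd_eq_mod_eq_0)
qed

text \<open>The primitive d-th roots of unity, for all d dividing \<open>n\<close>, together are all
  n-th roots of unity, so a geometric sum results.\<close>

lemma sum_ramanujan_sum:
  assumes n: "n > 0"
  shows "(\<Sum>d | d dvd n. ramanujan_sum d w) = (if n dvd w then of_nat n else 0)"
proof -
  let ?z = "cis (2 * pi * real w / real n)"
  have "(\<Sum>d | d dvd n. ramanujan_sum d w) = (\<Sum>j<n. ?z ^ j)"
    unfolding ramanujan_sum_def sum_by_gcd[OF n, symmetric]
    by (rule sum.cong[OF refl]) (simp add: cis_pow_reduce[OF n])
  also have "\<dots> = (if n dvd w then of_nat n else 0)"
  proof (cases "n dvd w")
    case True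
    then have "?z = 1" by (simp add: cis_eq_1_iff_dvd[OF n])
    then show ?thesis using True by simp
  next
    case False
    have "?z ^ n = cis (2 * pi * real w)" using n by (simp add: DeMoivre)
    then have "?z ^ n = 1" by (simp add: cis_multiple_2pi)
    moreover have "?z \<noteq> 1" using False by (simp add: cis_eq_1_iff_dvd[OF n])
    ultimately have "(\<Sum>j<n. ?z ^ j) = 0" using geometric_sum[of ?z n] by simp
    with False show ?thesis by simp
  qed
  finally show ?thesis .
qed

lemma frobenius_ch_cyclic_ramanujan:
  assumes n: "n > 0"
  shows "scale (of_nat n) (frobenius_ch n (induced_char (sym_group n) (cyclic_subgroup n)
      (cyclic_char n (cis (2 * pi * real w / real n))))) =
    (\<Sum>d | d dvd n. scale (ramanujan_sum d w) (sym_p d ^ (n div d)))"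
proof -
  have "scale (of_nat n) (frobenius_ch n (induced_char (sym_group n) (cyclic_subgroup n)
      (cyclic_char n (cis (2 * pi * real w / real n))))) =
    (\<Sum>j<n. scale (cis (2 * pi * real w / real n) ^ j) (sym_p (n div gcd n j) ^ gcd n j))"
    using n by (simp add: frobenius_ch_cyclic)
  also have "\<dots> = (\<Sum>j<n. scale (cis (2 * pi * real w / real (n div gcd n j)) ^ (j div gcd n j))
      (sym_p (n div gcd n j) ^ (n div (n div gcd n j))))"
  proof (rule sum.cong[OF refl])
    fix j
    have "n div (n div gcd n j) = gcd n j"
      using n by (intro div_div_eq_right[THEN trans] ) auto
    then show "scale (cis (2 * pi * real w / real n) ^ j) (sym_p (n div gcd n j) ^ gcd n j) =
        scale (cis (2 * pi * real w / real (n div gcd n j)) ^ (j div gcd n j))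
      (sym_p (n div gcd n j) ^ (n div (n div gcd n j)))"
      by (simp only: cis_pow_reduce[OF n])
  qed
  also have "\<dots> = (\<Sum>d | d dvd n. \<Sum>u | u < d \<and> coprime u d.
      scale (cis (2 * pi * real w / real d) ^ u) (sym_p d ^ (n div d)))"
    by (rule sum_by_gcd[OF n])
  also have "\<dots> = (\<Sum>d | d dvd n. scale (ramanujan_sum d w) (sym_p d ^ (n div d)))"
    by (simp add: ramanujan_sum_def scale_sum_left)
  finally show ?thesis .
qed

lemma dvd_two_power_iff: "d dvd 2 ^ K \<longleftrightarrow> d = 2 ^ multiplicity 2 d \<and> multiplicity 2 d \<le> K" for d :: nat
proof
  assume "d dvd 2 ^ K"
  then obtain i where "i \<le> K" "d = 2 ^ i"
    using divides_primepow_nat[OF two_is_prime_nat] by blast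
  then show "d = 2 ^ multiplicity 2 d \<and> multiplicity 2 d \<le> K"
    by (simp add: multiplicity_same_power)
next
  assume d: "d = 2 ^ multiplicity 2 d \<and> multiplicity 2 d \<le> K"
  then have "(2 :: nat) ^ multiplicity 2 d dvd 2 ^ K" by (intro le_imp_power_dvd) simp
  then show "d dvd 2 ^ K" using d by metis
qed

text \<open>Divisor sums determine Ramanujan sums recursively. By \<open>sum_ramanujan_sum\<close>
  the divisor sum at \<open>d\<close> only asks whether \<open>d\<close> divides 2^K, and the answer
  is the same for all \<open>K\<close> from the 2-adic valuation of \<open>d\<close> on.\<close>

lemma ramanujan_sum_two_power:
  "d > 0 \<Longrightarrow> multiplicity 2 d \<le> K \<Longrightarrow> multiplicity 2 d \<le> L \<Longrightarrow>
     ramanujan_sum d (2 ^ K) = ramanujan_sum d (2 ^ L)"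
proof (induction d rule: less_induct)
  case (less d)
  have split: "(\<Sum>e | e dvd d. ramanujan_sum e w) = ramanujan_sum d w + (\<Sum>e\<in>{e. e dvd d} - {d}. ramanujan_sum e w)" for w
    using less.prems(1) by (intro sum.remove) auto
  have "(\<Sum>e\<in>{e. e dvd d} - {d}. ramanujan_sum e (2 ^ K)) = (\<Sum>e\<in>{e. e dvd d} - {d}. ramanujan_sum e (2 ^ L))"
  proof (rule sum.cong[OF refl])
    fix e assume "e \<in> {e. e dvd d} - {d}"
    then have e: "e dvd d" "e \<noteq> d" by auto
    then have "multiplicity 2 e \<le> multiplicity 2 d"
      using less.prems(1) by (intro dvd_imp_multiplicity_le) auto
    moreover have "e > 0" "e < d"
      using e less.prems(1) dvd_pos_nat[of d e] dvd_imp_le[of e d] by auto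
    ultimately show "ramanujan_sum e (2 ^ K) = ramanujan_sum e (2 ^ L)"
      using less.prems by (intro less.IH) auto
  qed
  moreover have "d dvd 2 ^ K \<longleftrightarrow> d dvd 2 ^ L"
    using less.prems unfolding dvd_two_power_iff by blast
  ultimately show ?case
    using split[of "2 ^ K"] split[of "2 ^ L"] sum_ramanujan_sum[OF less.prems(1), of "2 ^ K"]
      sum_ramanujan_sum[OF less.prems(1), of "2 ^ L"] by simp
qed

text \<open>The stable value of the Ramanujan sums at 2^K for large K: a function of
  \<open>d\<close> alone, although the character behind \<open>Lie2 n\<close> involves the valuation
  of \<open>n\<close>.\<close>

definition lie2_coeff :: "nat \<Rightarrow> complex" where
  "lie2_coeff d = ramanujan_sum d (2 ^ multiplicity 2 d)"

lemma ramanujan_sum_lie2_coeff: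
  "n > 0 \<Longrightarrow> d dvd n \<Longrightarrow> ramanujan_sum d (2 ^ multiplicity 2 n) = lie2_coeff d"
  unfolding lie2_coeff_def
  by (rule ramanujan_sum_two_power) (auto intro: dvd_pos_nat dvd_imp_multiplicity_le)

lemma sum_lie2_coeff:
  assumes "n > 0"
  shows "(\<Sum>d | d dvd n. lie2_coeff d) = (if n = 2 ^ multiplicity 2 n then of_nat n else 0)"
  using sum_ramanujan_sum[OF assms, of "2 ^ multiplicity 2 n"] assms
  by (simp add: ramanujan_sum_lie2_coeff dvd_two_power_iff)

lemma sum_divisors_swap:
  assumes "n > (0 :: nat)"
  shows "(\<Sum>d | d dvd n. F (n div d)) = (\<Sum>d | d dvd n. F d)"
  using assms by (intro sum.reindex_bij_witness[of _ "\<lambda>d. n div d" "\<lambda>d. n div d"]) auto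

text \<open>Moebius inversion: the Dirichlet convolution of the constant 1 with the Moebius
  function.\<close>

lemma lie_conv:
  assumes "e > 0"
  shows "(\<Sum>k | k dvd e. 1 * ramanujan_sum (e div k) 1) = (if e = 1 then 1 else 0)"
  using sum_divisors_swap[OF assms, of "\<lambda>d. ramanujan_sum d 1"] sum_ramanujan_sum[OF assms, of 1] by simp

text \<open>As \<open>sgn_wt\<close> is 1 minus 2 at even arguments, the sum is S(e) - 2 S(e/2), the
  second term being absent for odd e. Here S(n) is the divisor sum of \<open>lie2_coeff\<close>,
  namely n for a power of 2 and 0 otherwise. Since S(2f) = 2 S(f), all even e give 0, and among odd
  e only 1 is a power of 2.\<close>

lemma lie2_conv:
  assumes e: "e > 0"
  shows "(\<Sum>k | k dvd e. sgn_wt k * lie2_coeff (e div k)) = (if e = 1 then 1 else 0)"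
proof -
  let ?S = "\<lambda>n. \<Sum>d | d dvd n. lie2_coeff d"
  have fin: "finite {k. k dvd e}" using e by simp
  have sgn: "sgn_wt k = 1 - (if even k then 2 else 0)" if "k dvd e" for k
    using that e by (cases k) auto
  have "(\<Sum>k | k dvd e. sgn_wt k * lie2_coeff (e div k)) =
      (\<Sum>k | k dvd e. lie2_coeff (e div k)) - 2 * (\<Sum>k | k dvd e. if even k then lie2_coeff (e div k) else 0)"
    unfolding sum_distrib_left sum_subtractf[symmetric]
    by (rule sum.cong[OF refl]) (simp add: sgn[simplified])
  also have "(\<Sum>k | k dvd e. if even k then lie2_coeff (e div k) else 0) = (\<Sum>k | k dvd e \<and> even k. lie2_coeff (e div k))"
    using fin by (simp add: sum.inter_filter[symmetric])
  also have "\<dots> = (if even e then ?S (e div 2) else 0)"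
  proof (cases "even e")
    case True
    then obtain f where f: "e = 2 * f" by (elim evenE)
    with e have "f > 0" by simp
    have "(\<Sum>k | k dvd e \<and> even k. lie2_coeff (e div k)) = (\<Sum>k | k dvd f. lie2_coeff (f div k))"
      by (rule sum.reindex_bij_witness[of _ "\<lambda>k. 2 * k" "\<lambda>k. k div 2"]) (auto simp: f)
    also have "\<dots> = ?S f" using \<open>f > 0\<close> by (rule sum_divisors_swap)
    finally show ?thesis using True by (simp add: f)
  next
    case False
    then have "{k. k dvd e \<and> even k} = {}" using dvd_trans by blast
    with False show ?thesis by (simp only: sum.empty if_False)
  qed
  also have "(\<Sum>k | k dvd e. lie2_coeff (e div k)) = ?S e" using e by (rule sum_divisors_swap)
  also have "?S e - 2 * (if even e then ?S (e div 2) else 0) = (if e = 1 then 1 else 0)"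
  proof (cases "even e")
    case True
    then obtain f where f: "e = 2 * f" by (elim evenE)
    with e have f0: "f > 0" by simp
    have "multiplicity 2 e = Suc (multiplicity 2 f)"
      using f0 by (simp add: f multiplicity_times_same)
    then have "e = 2 ^ multiplicity 2 e \<longleftrightarrow> f = 2 ^ multiplicity 2 f" by (simp add: f)
    then show ?thesis using f f0 e by (simp add: sum_lie2_coeff)
  next
    case False
    then have "multiplicity 2 e = 0" by (simp add: not_dvd_imp_multiplicity_0)
    then show ?thesis using False e by (simp add: sum_lie2_coeff)
  qed
  finally show ?thesis .
qed

section \<open>Sequences whose divisor coefficients are Dirichlet inverse to the weight\<close>

context
  fixes a :: "nat \<Rightarrow> complex" and \<nu> :: "nat \<Rightarrow> complex" and q :: "nat \<Rightarrow> symfun"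
  assumes q: "\<And>n. n > 0 \<Longrightarrow> scale (of_nat n) (q n) = (\<Sum>d | d dvd n. scale (\<nu> d) (sym_p d ^ (n div d)))"
    and conv: "\<And>e. e > 0 \<Longrightarrow> (\<Sum>k | k dvd e. a k * \<nu> (e div k)) = (if e = 1 then 1 else 0)"
    and a1: "a 1 = 1"
begin

lemma divisor_sum_homogeneous: "i \<ge> 1 \<Longrightarrow> homogeneous i (q i)"
proof -
  assume i: "i \<ge> 1"
  have "homogeneous i (scale (of_nat i) (q i))"
    unfolding q[OF less_le_trans[OF zero_less_one i]]
  proof (intro homogeneous_sum homogeneous_scale)
    fix d assume "d \<in> {d. d dvd i}"
    then show "homogeneous i (sym_p d ^ (i div d))"
      using homogeneous_power[OF homogeneous_sym_p, of d "i div d"] by simp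
  qed
  then have "homogeneous i (scale (1 / of_nat i) (scale (of_nat i) (q i)))"
    by (rule homogeneous_scale)
  with i show ?thesis by simp
qed

lemma divisor_sum_degree_one: "q 1 = sym_p 1"
  using q[of 1] conv[of 1] a1 by simp

text \<open>The degree N part of the logarithmic derivative is a sum over e dividing N of p_e^(N/e),
  weighted by the Dirichlet convolution of \<open>a\<close> and \<open>\<nu>\<close> at e, so only e
  = 1 remains. The total p_1 + p_1^2 + ... is the logarithmic derivative of 1/(1 - p_1).\<close>

lemma pleth_exp_geometric: "pleth_exp a (formal_sum q {1..}) * (1 - sym_p 1) = 1"
proof -
  let ?Q = "formal_sum q {1..}"
  let ?A = "pleth_sum a (euler ?Q)"
  have Q0: "mcoeff ?Q {#} = 0" by (rule mcoeff_formal_sum_empty[OF divisor_sum_homogeneous])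
  have A: "hom_component N ?A = sym_p 1 ^ N" if N: "N > 0" for N
  proof -
    have "hom_component N ?A = (\<Sum>k | k dvd N. scale (a k) (p_plethysm k (scale (of_nat (N div k)) (q (N div k)))))"
    proof (subst hom_component_pleth_sum)
      show "(\<Sum>k | k dvd N. scale (a k) (p_plethysm k (hom_component (N div k) (euler ?Q)))) =
        (\<Sum>k | k dvd N. scale (a k) (p_plethysm k (scale (of_nat (N div k)) (q (N div k)))))"
        using N by (intro sum.cong refl)
          (auto simp: hom_component_euler hom_component_formal_sum[OF divisor_sum_homogeneous, simplified] elim!: dvdE)
    qed (use N in auto)
    also have "\<dots> = (\<Sum>k | k dvd N. \<Sum>d | d dvd N div k. scale (a k * \<nu> d) (sym_p (k * d) ^ (N div (k * d))))"
    proof (rule sum.cong[OF refl])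
      fix k assume "k \<in> {k. k dvd N}"
      then have k: "k > 0" "N div k > 0" using N by (auto simp: div_greater_zero_iff dvd_imp_le intro: dvd_pos_nat)
      show "scale (a k) (p_plethysm k (scale (of_nat (N div k)) (q (N div k)))) =
          (\<Sum>d | d dvd N div k. scale (a k * \<nu> d) (sym_p (k * d) ^ (N div (k * d))))"
        unfolding q[OF k(2)] using k(1)
        by (simp add: p_plethysm_sum p_plethysm_scale p_plethysm_power p_plethysm_sym_p scale_sum_right div_mult2_eq)
    qed
    also have "\<dots> = (\<Sum>(k, d)\<in>Sigma {k. k dvd N} (\<lambda>k. {d. d dvd N div k}). scale (a k * \<nu> d) (sym_p (k * d) ^ (N div (k * d))))"
      using N by (intro sum.Sigma) (auto simp: dvd_div_eq_0_iff)
    \<comment> \<open>Regrouping by the product \<open>e = k * d\<close> produces the Dirichlet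
      convolution.\<close>
    also have "\<dots> = (\<Sum>(e, k)\<in>Sigma {e. e dvd N} (\<lambda>e. {k. k dvd e}). scale (a k * \<nu> (e div k)) (sym_p e ^ (N div e)))"
      using N by (intro sum.reindex_bij_witness[of _ "\<lambda>(e, k). (k, e div k)" "\<lambda>(k, d). (k * d, k)"])
        (auto elim!: dvdE)
    also have "\<dots> = (\<Sum>e | e dvd N. \<Sum>k | k dvd e. scale (a k * \<nu> (e div k)) (sym_p e ^ (N div e)))"
      using N by (intro sum.Sigma[symmetric]) (auto intro: dvd_pos_nat)
    also have "\<dots> = (\<Sum>e | e dvd N. if e = 1 then sym_p 1 ^ N else 0)"
    proof (rule sum.cong[OF refl])
      fix e assume "e \<in> {e. e dvd N}"
      then have "e > 0" using N by (auto intro: dvd_pos_nat)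
      then show "(\<Sum>k | k dvd e. scale (a k * \<nu> (e div k)) (sym_p e ^ (N div e))) = (if e = 1 then sym_p 1 ^ N else 0)"
        unfolding scale_sum_left[symmetric] conv[OF \<open>e > 0\<close>] by simp
    qed
    also have "\<dots> = sym_p 1 ^ N" using N by simp
    finally show ?thesis .
  qed
  \<comment> \<open>The series \<open>?A\<close> starts in degree 1; the added 1 supplies the term
    of degree 0 that \<open>geometric_iff\<close> expects.\<close>
  have "(?A + 1) * (1 - sym_p 1) = 1"
    unfolding geometric_iff
  proof
    fix n
    have "hom_component n 1 = (if n = 0 then 1 else 0)"
      by (rule hom_component_homogeneous) simp
    then show "hom_component n (?A + 1) = sym_p 1 ^ n"
      using A[of n] by (cases n) (simp_all add: hom_component_add hom_component_0)
  qed
  then have A1: "?A * (1 - sym_p 1) = sym_p 1" by (simp add: algebra_simps)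
  show ?thesis
  proof (rule euler_unique[of _ 0])
    have e: "euler (1 - sym_p 1) = - sym_p 1"
      by (rule symfun_eqI) (auto simp: mcoeff_one mcoeff_sym_p)
    have "euler (pleth_exp a ?Q * (1 - sym_p 1)) = (?A * (1 - sym_p 1)) * pleth_exp a ?Q - pleth_exp a ?Q * sym_p 1"
      unfolding euler_mult e euler_pleth_exp[OF Q0] by (simp add: algebra_simps)
    also have "\<dots> = 0" unfolding A1 by simp
    finally show "euler (pleth_exp a ?Q * (1 - sym_p 1)) = 0 * (pleth_exp a ?Q * (1 - sym_p 1))" by simp
  qed (simp_all add: Q0[simplified] mcoeff_one)
qed

end

lemma Lie_ramanujan:
  assumes "n > 0"
  shows "scale (of_nat n) (Lie n) = (\<Sum>d | d dvd n. scale (ramanujan_sum d 1) (sym_p d ^ (n div d)))"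
proof -
  have "exp (2 * of_real pi * \<i> / of_nat n) = cis (2 * pi * real 1 / real n)"
    by (simp add: cis_conv_exp mult_ac)
  then show ?thesis
    unfolding Lie_def by (simp only: frobenius_ch_cyclic_ramanujan[OF assms])
qed

lemma Lie2_ramanujan:
  assumes "n > 0"
  shows "scale (of_nat n) (Lie2 n) = (\<Sum>d | d dvd n. scale (lie2_coeff d) (sym_p d ^ (n div d)))"
proof -
  have "exp (2 * of_real pi * \<i> / of_nat n * 2 ^ multiplicity 2 n) = cis (2 * pi * real (2 ^ multiplicity 2 n) / real n)"
    by (simp add: cis_conv_exp mult_ac)
  then show ?thesis
    unfolding Lie2_def using assms
    by (simp only: frobenius_ch_cyclic_ramanujan[OF assms]) (simp add: ramanujan_sum_lie2_coeff)
qed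

text \<open>Each identity is compared with one pivot, that the exponential is 1/(1 - p_1). The pivot
  yields the mutual equivalences for general \<open>q\<close> and, through
  \<open>pleth_exp_geometric\<close>, the truth of all four for \<open>Lie\<close>.\<close>

lemma identities_iff_H:
  assumes q: "\<And>i. i \<ge> 1 \<Longrightarrow> homogeneous i (q i)" "q 1 = sym_p 1"
  shows "(\<forall>n\<ge>1. (\<Sum>lam\<in>partitions_of n. H_part lam q) = sym_p 1 ^ n) \<longleftrightarrow>
      pleth_exp (\<lambda>_. 1) (formal_sum q {1..}) * (1 - sym_p 1) = 1"
    "plethysm H_series (formal_sum (\<lambda>n. (-1) ^ (n - 1) * omega (q n)) {1..}) = 1 + sym_p 1 \<longleftrightarrow>
      pleth_exp (\<lambda>_. 1) (formal_sum q {1..}) * (1 - sym_p 1) = 1"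
    "(\<forall>n\<ge>2. (\<Sum>lam\<in>partitions_of n. (-1) ^ (n - size lam) * E_part lam q) = 0) \<longleftrightarrow>
      pleth_exp (\<lambda>_. 1) (formal_sum q {1..}) * (1 - sym_p 1) = 1"
    "(\<forall>n\<ge>2. (\<Sum>lam\<in>partitions_of n. E_part lam q) = 2 * sym_e 2 * sym_p 1 ^ (n - 2)) \<longleftrightarrow>
      pleth_exp (\<lambda>_. 1) (formal_sum q {1..}) * (1 - sym_p 1) = 1"
proof -
  have inv: "pleth_exp (\<lambda>_. 1) (formal_sum q {1..}) * (1 - sym_p 1) = 1 \<longleftrightarrow>
      pleth_exp (\<lambda>k. - 1) (formal_sum q {1..}) = 1 - sym_p 1"
    by (rule inverse_iff[OF q])
  have "(-1) ^ k * sgn_wt k = - 1" if "k > 0" for k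
    using that by (cases k) (simp_all flip: power_mult_distrib)
  note signed = signed_sum_iff[OF q this]
  show "(\<forall>n\<ge>1. (\<Sum>lam\<in>partitions_of n. H_part lam q) = sym_p 1 ^ n) \<longleftrightarrow>
      pleth_exp (\<lambda>_. 1) (formal_sum q {1..}) * (1 - sym_p 1) = 1"
    unfolding H_part_eq by (rule powers_iff[OF q])
  show "plethysm H_series (formal_sum (\<lambda>n. (-1) ^ (n - 1) * omega (q n)) {1..}) = 1 + sym_p 1 \<longleftrightarrow>
      pleth_exp (\<lambda>_. 1) (formal_sum q {1..}) * (1 - sym_p 1) = 1"
    unfolding plethysm_H_series inv by (rule omega_iff[OF q])
  show "(\<forall>n\<ge>2. (\<Sum>lam\<in>partitions_of n. (-1) ^ (n - size lam) * E_part lam q) = 0) \<longleftrightarrow>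
      pleth_exp (\<lambda>_. 1) (formal_sum q {1..}) * (1 - sym_p 1) = 1"
    unfolding E_part_eq inv by (rule signed) simp_all
  show "(\<forall>n\<ge>2. (\<Sum>lam\<in>partitions_of n. E_part lam q) = 2 * sym_e 2 * sym_p 1 ^ (n - 2)) \<longleftrightarrow>
      pleth_exp (\<lambda>_. 1) (formal_sum q {1..}) * (1 - sym_p 1) = 1"
    unfolding E_part_eq by (rule E_sum_iff[OF q])
qed

text \<open>The same pivot with the weight \<open>sgn_wt\<close>; H and E trade places, and the last
  identity takes its other form.\<close>

lemma identities_iff_E:
  assumes q: "\<And>i. i \<ge> 1 \<Longrightarrow> homogeneous i (q i)" "q 1 = sym_p 1"
  shows "(\<forall>n\<ge>1. (\<Sum>lam\<in>partitions_of n. E_part lam q) = sym_p 1 ^ n) \<longleftrightarrow>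
      pleth_exp sgn_wt (formal_sum q {1..}) * (1 - sym_p 1) = 1"
    "plethysm E_series (formal_sum (\<lambda>n. (-1) ^ (n - 1) * omega (q n)) {1..}) = 1 + sym_p 1 \<longleftrightarrow>
      pleth_exp sgn_wt (formal_sum q {1..}) * (1 - sym_p 1) = 1"
    "(\<forall>n\<ge>2. (\<Sum>lam\<in>partitions_of n. (-1) ^ (n - size lam) * H_part lam q) = 0) \<longleftrightarrow>
      pleth_exp sgn_wt (formal_sum q {1..}) * (1 - sym_p 1) = 1"
    "(\<forall>n\<ge>2. (\<Sum>lam\<in>partitions_of n. H_part lam q) =
        (\<Sum>lam\<in>{lam \<in> partitions_of n. \<forall>i\<in>#lam. \<exists>k. i = 2 ^ k}. sym_p_part lam)) \<longleftrightarrow>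
      pleth_exp sgn_wt (formal_sum q {1..}) * (1 - sym_p 1) = 1"
proof -
  have inv: "pleth_exp sgn_wt (formal_sum q {1..}) * (1 - sym_p 1) = 1 \<longleftrightarrow>
      pleth_exp (\<lambda>k. - sgn_wt k) (formal_sum q {1..}) = 1 - sym_p 1"
    by (rule inverse_iff[OF q])
  have "(-1) ^ k * 1 = - sgn_wt k" if "k > 0" for k
    using that by (cases k) simp_all
  note signed = signed_sum_iff[OF q this]
  show "(\<forall>n\<ge>1. (\<Sum>lam\<in>partitions_of n. E_part lam q) = sym_p 1 ^ n) \<longleftrightarrow>
      pleth_exp sgn_wt (formal_sum q {1..}) * (1 - sym_p 1) = 1"
    unfolding E_part_eq by (rule powers_iff[OF q])
  show "plethysm E_series (formal_sum (\<lambda>n. (-1) ^ (n - 1) * omega (q n)) {1..}) = 1 + sym_p 1 \<longleftrightarrow>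
      pleth_exp sgn_wt (formal_sum q {1..}) * (1 - sym_p 1) = 1"
    unfolding plethysm_E_series inv by (rule omega_iff[OF q])
  show "(\<forall>n\<ge>2. (\<Sum>lam\<in>partitions_of n. (-1) ^ (n - size lam) * H_part lam q) = 0) \<longleftrightarrow>
      pleth_exp sgn_wt (formal_sum q {1..}) * (1 - sym_p 1) = 1"
    unfolding H_part_eq inv by (rule signed) simp_all
  show "(\<forall>n\<ge>2. (\<Sum>lam\<in>partitions_of n. H_part lam q) =
        (\<Sum>lam\<in>{lam \<in> partitions_of n. \<forall>i\<in>#lam. \<exists>k. i = 2 ^ k}. sym_p_part lam)) \<longleftrightarrow>
      pleth_exp sgn_wt (formal_sum q {1..}) * (1 - sym_p 1) = 1"
    unfolding H_part_eq power2_partitions_def[symmetric] by (rule H_sum_iff[OF q])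
qed

text \<open>Statements that hold are trivially equivalent, so the equivalences are claimed for every
  sequence of homogeneous functions q_i with q_1 = p_1. The condition on q_1 lets the last two
  identities, which only begin in degree 2, imply the first two.\<close>

theorem theorem2p3:
  shows
    "((\<forall>n\<ge>1. (\<Sum>lam \<in> partitions_of n. H_part lam Lie) = sym_p 1 ^ n) \<and>
      (\<forall>n\<ge>1. (\<Sum>lam \<in> partitions_of n. E_part lam Lie2) = sym_p 1 ^ n)) \<and>
     (plethysm H_series (formal_sum (\<lambda>n. (-1) ^ (n - 1) * omega (Lie n)) {1..}) = 1 + sym_p 1 \<and>
      plethysm E_series (formal_sum (\<lambda>n. (-1) ^ (n - 1) * omega (Lie2 n)) {1..}) = 1 + sym_p 1) \<and>
     ((\<forall>n\<ge>2. (\<Sum>lam \<in> partitions_of n. (-1) ^ (n - size lam) * E_part lam Lie) = 0) \<and>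
      (\<forall>n\<ge>2. (\<Sum>lam \<in> partitions_of n. (-1) ^ (n - size lam) * H_part lam Lie2) = 0)) \<and>
     ((\<forall>n\<ge>2. (\<Sum>lam \<in> partitions_of n. E_part lam Lie) = 2 * sym_e 2 * sym_p 1 ^ (n - 2)) \<and>
      (\<forall>n\<ge>2. (\<Sum>lam \<in> partitions_of n. H_part lam Lie2) =
         (\<Sum>lam \<in> {lam \<in> partitions_of n. \<forall>i \<in># lam. \<exists>k. i = 2 ^ k}. sym_p_part lam))) \<and>
     (\<forall>q. (\<forall>i\<ge>1. homogeneous i (q i)) \<and> q 1 = sym_p 1 \<longrightarrow>
       (let I1 = (\<forall>n\<ge>1. (\<Sum>lam \<in> partitions_of n. H_part lam q) = sym_p 1 ^ n);
            I2 = (plethysm H_series (formal_sum (\<lambda>n. (-1) ^ (n - 1) * omega (q n)) {1..})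
                    = 1 + sym_p 1);
            I3 = (\<forall>n\<ge>2. (\<Sum>lam \<in> partitions_of n. (-1) ^ (n - size lam) * E_part lam q) = 0);
            I4 = (\<forall>n\<ge>2. (\<Sum>lam \<in> partitions_of n. E_part lam q) =
                    2 * sym_e 2 * sym_p 1 ^ (n - 2))
        in (I1 \<longleftrightarrow> I2) \<and> (I2 \<longleftrightarrow> I3) \<and> (I3 \<longleftrightarrow> I4))) \<and>
     (\<forall>q. (\<forall>i\<ge>1. homogeneous i (q i)) \<and> q 1 = sym_p 1 \<longrightarrow>
       (let I1 = (\<forall>n\<ge>1. (\<Sum>lam \<in> partitions_of n. E_part lam q) = sym_p 1 ^ n);
            I2 = (plethysm E_series (formal_sum (\<lambda>n. (-1) ^ (n - 1) * omega (q n)) {1..})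
                    = 1 + sym_p 1);
            I3 = (\<forall>n\<ge>2. (\<Sum>lam \<in> partitions_of n. (-1) ^ (n - size lam) * H_part lam q) = 0);
            I4 = (\<forall>n\<ge>2. (\<Sum>lam \<in> partitions_of n. H_part lam q) =
                    (\<Sum>lam \<in> {lam \<in> partitions_of n. \<forall>i \<in># lam. \<exists>k. i = 2 ^ k}. sym_p_part lam))
        in (I1 \<longleftrightarrow> I2) \<and> (I2 \<longleftrightarrow> I3) \<and> (I3 \<longleftrightarrow> I4)))"
proof (intro conjI)
  have Lie_hom: "homogeneous i (Lie i)" if "i \<ge> 1" for i
    by (rule divisor_sum_homogeneous[of Lie "\<lambda>d. ramanujan_sum d 1" "\<lambda>_. 1", OF Lie_ramanujan lie_conv]) (use that in simp_all)
  have Lie_1: "Lie 1 = sym_p 1"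
    by (rule divisor_sum_degree_one[of Lie "\<lambda>d. ramanujan_sum d 1" "\<lambda>_. 1", OF Lie_ramanujan lie_conv]) simp_all
  have Lie_geo: "pleth_exp (\<lambda>_. 1) (formal_sum Lie {1..}) * (1 - sym_p 1) = 1"
    by (rule pleth_exp_geometric[of Lie "\<lambda>d. ramanujan_sum d 1" "\<lambda>_. 1", OF Lie_ramanujan lie_conv]) simp_all
  have Lie2_hom: "homogeneous i (Lie2 i)" if "i \<ge> 1" for i
    by (rule divisor_sum_homogeneous[of Lie2 "lie2_coeff" "sgn_wt", OF Lie2_ramanujan lie2_conv]) (use that in simp_all)
  have Lie2_1: "Lie2 1 = sym_p 1"
    by (rule divisor_sum_degree_one[of Lie2 "lie2_coeff" "sgn_wt", OF Lie2_ramanujan lie2_conv]) simp_all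
  have Lie2_geo: "pleth_exp sgn_wt (formal_sum Lie2 {1..}) * (1 - sym_p 1) = 1"
    by (rule pleth_exp_geometric[of Lie2 "lie2_coeff" "sgn_wt", OF Lie2_ramanujan lie2_conv]) simp_all
  show "\<forall>n\<ge>1. (\<Sum>lam \<in> partitions_of n. H_part lam Lie) = sym_p 1 ^ n"
    by (rule identities_iff_H(1)[THEN iffD2]) (rule Lie_hom Lie_1 Lie_geo | assumption)+
  show "\<forall>n\<ge>1. (\<Sum>lam \<in> partitions_of n. E_part lam Lie2) = sym_p 1 ^ n"
    by (rule identities_iff_E(1)[THEN iffD2]) (rule Lie2_hom Lie2_1 Lie2_geo | assumption)+
  show "plethysm H_series (formal_sum (\<lambda>n. (-1) ^ (n - 1) * omega (Lie n)) {1..}) = 1 + sym_p 1"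
    by (rule identities_iff_H(2)[THEN iffD2]) (rule Lie_hom Lie_1 Lie_geo | assumption)+
  show "plethysm E_series (formal_sum (\<lambda>n. (-1) ^ (n - 1) * omega (Lie2 n)) {1..}) = 1 + sym_p 1"
    by (rule identities_iff_E(2)[THEN iffD2]) (rule Lie2_hom Lie2_1 Lie2_geo | assumption)+
  show "\<forall>n\<ge>2. (\<Sum>lam \<in> partitions_of n. (-1) ^ (n - size lam) * E_part lam Lie) = 0"
    by (rule identities_iff_H(3)[THEN iffD2]) (rule Lie_hom Lie_1 Lie_geo | assumption)+
  show "\<forall>n\<ge>2. (\<Sum>lam \<in> partitions_of n. (-1) ^ (n - size lam) * H_part lam Lie2) = 0"
    by (rule identities_iff_E(3)[THEN iffD2]) (rule Lie2_hom Lie2_1 Lie2_geo | assumption)+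
  show "\<forall>n\<ge>2. (\<Sum>lam \<in> partitions_of n. E_part lam Lie) = 2 * sym_e 2 * sym_p 1 ^ (n - 2)"
    by (rule identities_iff_H(4)[THEN iffD2]) (rule Lie_hom Lie_1 Lie_geo | assumption)+
  show "\<forall>n\<ge>2. (\<Sum>lam \<in> partitions_of n. H_part lam Lie2) =
         (\<Sum>lam \<in> {lam \<in> partitions_of n. \<forall>i \<in># lam. \<exists>k. i = 2 ^ k}. sym_p_part lam)"
    by (rule identities_iff_E(4)[THEN iffD2]) (rule Lie2_hom Lie2_1 Lie2_geo | assumption)+
next
  show "\<forall>q. (\<forall>i\<ge>1. homogeneous i (q i)) \<and> q 1 = sym_p 1 \<longrightarrow>
       (let I1 = (\<forall>n\<ge>1. (\<Sum>lam \<in> partitions_of n. H_part lam q) = sym_p 1 ^ n);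
            I2 = (plethysm H_series (formal_sum (\<lambda>n. (-1) ^ (n - 1) * omega (q n)) {1..})
                    = 1 + sym_p 1);
            I3 = (\<forall>n\<ge>2. (\<Sum>lam \<in> partitions_of n. (-1) ^ (n - size lam) * E_part lam q) = 0);
            I4 = (\<forall>n\<ge>2. (\<Sum>lam \<in> partitions_of n. E_part lam q) =
                    2 * sym_e 2 * sym_p 1 ^ (n - 2))
        in (I1 \<longleftrightarrow> I2) \<and> (I2 \<longleftrightarrow> I3) \<and> (I3 \<longleftrightarrow> I4))"
    using identities_iff_H unfolding Let_def by simp
  show "\<forall>q. (\<forall>i\<ge>1. homogeneous i (q i)) \<and> q 1 = sym_p 1 \<longrightarrow>
       (let I1 = (\<forall>n\<ge>1. (\<Sum>lam \<in> partitions_of n. E_part lam q) = sym_p 1 ^ n);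
            I2 = (plethysm E_series (formal_sum (\<lambda>n. (-1) ^ (n - 1) * omega (q n)) {1..})
                    = 1 + sym_p 1);
            I3 = (\<forall>n\<ge>2. (\<Sum>lam \<in> partitions_of n. (-1) ^ (n - size lam) * H_part lam q) = 0);
            I4 = (\<forall>n\<ge>2. (\<Sum>lam \<in> partitions_of n. H_part lam q) =
                    (\<Sum>lam \<in> {lam \<in> partitions_of n. \<forall>i \<in># lam. \<exists>k. i = 2 ^ k}. sym_p_part lam))
        in (I1 \<longleftrightarrow> I2) \<and> (I2 \<longleftrightarrow> I3) \<and> (I3 \<longleftrightarrow> I4))"
    using identities_iff_E unfolding Let_def by simp
qed

end
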